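(* Let $\eta\ge 3$ be an integer. Suppose $(x^*,u^* )$ is a local minimizer of the continuous problem (P) described in the context, suppose the standing smoothness assumptions hold, and suppose (A1)–(A3) hold, and that (P1)–(P4) hold for every $N$. Then there are constants $c$ and $N_0$, independent of $N$, such that for every $N\ge N_0$ with $N>\eta+1$ the nonlinear program (NLP) has a strict local minimizer $(X^N,U^N)=(X^N_0,\dots,X^N_N,U^N_1,\dots,U^N_N)$ together with a vector $\Lambda^N=(\Lambda^N_0,\dots,\Lambda^N_N)\in(\mathbb{R}^n)^{N+1}$ satisfying $\mathcal{T}(X^N,U^N,\Lambda^N)=0$, and $$\max\Big\{\max_{0\le i\le N}|X^N_i-x^*(\tau_i)|,\ \max_{1\le i\le N}|U^N_i-u^*(\tau_i)|,\ \max_{0\le i\le N}|\Lambda^N_i-\lambda^*(\tau_i)|\Big\}\le cN^{2-\eta}.$$ (Equivalently, the polynomial $x^N\in\mathcal{P}_N^n$ with $x^N(\tau_i)=X^N_i$, together with the controls $u_i=U^N_i$, is a local minimizer of the collocated problem: minimize $C(x(1))$ subject to $\dot x(\tau_i)=f(x(\tau_i),u_i)$, $1\le i\le N$, $x(-1)=x_0$, $x\in\mathcal{P}_N^n$.)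
   Context: Notation: $|\cdot|$ is the Euclidean norm; for a matrix, $\|\cdot\|_\infty$ is the largest absolute row sum; $\mathcal{P}_N$ is the space of real polynomials of degree at most $N$ on $[-1,1]$ and $\mathcal{P}_N^n$ its $n$-fold product. Radau collocation data: for an integer $N\ge 2$, let $-1<\tau_1<\dots<\tau_N=1$ and $\omega_1,\dots,\omega_N>0$ be the nodes and weights of the $N$-point Gauss–Radau quadrature rule on $[-1,1]$ with fixed node $+1$ (exact for polynomials of degree $\le 2N-2$; $\sum_i\omega_i=2$). Set $\tau_0=-1$. For $0\le j\le N$ let $L_j(\tau)=\prod_{i=0,i\ne j}^{N}\frac{\tau-\tau_i}{\tau_j-\tau_i}$ and let $D$ be the $N\times(N+1)$ matrix $D_{ij}=L_j'(\tau_i)$, $1\le i\le N$, $0\le j\le N$. Let $D_0$ denote its column indexed $0$ and $D_{1:N}$ the $N\times N$ submatrix formed by columns $1,\dots,N$. Let $D^\ddagger$ be the $N\times N$ matrix $D^\ddagger_{ij}=-(\omega_j/\omega_i)D_{ji}$, $1\le i,j\le N$, and $W=\mathrm{diag}(\omega_1,\dots,\omega_N)$. Properties: (P1) $D_{1:N}$ is invertible and $\|D_{1:N}^{-1}\|_\infty\le 2$. (P2) every row of $(W^{1/2}D_{1:N})^{-1}$ has Euclidean norm at most $\sqrt2$. (P3) $D^\ddagger$ is invertible and $\|(D^\ddagger)^{-1}\|_\infty\le 2$. (P4) every row of $(W^{1/2}D^\ddagger)^{-1}$ has Euclidean norm at most $\sqrt2$. Continuous problem (P): minimize $C(x(1))$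 subject to $\dot x(t)=f(x(t),u(t))$, $t\in[-1,1]$, $x(-1)=x_0$, where $f:\mathbb{R}^n\times\mathbb{R}^m\to\mathbb{R}^n$, $C:\mathbb{R}^n\to\mathbb{R}$, $x_0\in\mathbb{R}^n$ given. Standing assumptions: $(x^*,u^* )\in C^1([-1,1];\mathbb{R}^n)\times C^0([-1,1];\mathbb{R}^m)$ is a local minimizer; there are an open set $\Omega\subset\mathbb{R}^{n+m}$ and $\rho>0$ with the closed ball of radius $\rho$ about $(x^*(t),u^*(t))$ contained in $\Omega$ for all $t\in[-1,1]$; the first two derivatives of $f$ are continuous on the closure of $\Omega$ and those of $C$ on the closed ball of radius $\rho$ about $x^*(1)$. The Hamiltonian is $H(x,u,\lambda)=\lambda^{\mathsf T}f(x,u)$, and $\lambda^*$ solves $\dot\lambda^*(t)=-\nabla_xH(x^*(t),u^*(t),\lambda^*(t))$, $\lambda^*(1)=\nabla C(x^*(1))$; moreover $\nabla_uH(x^*(t),u^*(t),\lambda^*(t))=0$ for all $t\in[-1,1]$. Assumptions: (A1) $x^*,\lambda^*\in C^{\eta+1}$. (A2) for some $\alpha>0$ the smallest eigenvalues of $\nabla^2C(x^*(1))$ and of $\nabla^2_{(x,u)}H(x^*(t),u^*(t),\lambda^*(t))$ exceed $\alpha$ uniformly in $t\in[-1,1]$. (A3) $\|\nabla_xf(x^*(t),u^*(t))\|_\infty\le 1/4$ and $\|\nabla_xf(x^*(t),u^*(t))^{\mathsf T}\|_\infty\le1/4$ for all $t\in[-1,1]$, where $\nabla_x f$ is the $n\times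 n$ Jacobian. (NLP): minimize $C(X_N)$ over $X_0,\dots,X_N\in\mathbb{R}^n$, $U_1,\dots,U_N\in\mathbb{R}^m$ subject to $\sum_{j=0}^ND_{ij}X_j=f(X_i,U_i)$, $1\le i\le N$, and $X_0=x_0$. The map $\mathcal{T}(X,U,\Lambda)$, with $\Lambda=(\Lambda_0,\dots,\Lambda_N)\in(\mathbb{R}^n)^{N+1}$, has components $\mathcal{T}_{1i}=\sum_{j=0}^ND_{ij}X_j-f(X_i,U_i)$ ($1\le i\le N$); $\mathcal{T}_2=X_0-x_0$; $\mathcal{T}_3=\Lambda_0-\nabla C(X_N)-\sum_{i=1}^N\omega_i\nabla_xH(X_i,U_i,\Lambda_i)$; $\mathcal{T}_{4i}=\sum_{j=1}^ND^\ddagger_{ij}\Lambda_j+\nabla_xH(X_i,U_i,\Lambda_i)$ ($1\le i<N$); $\mathcal{T}_5=\sum_{j=1}^ND^\ddagger_{Nj}\Lambda_j+\nabla_xH(X_N,U_N,\Lambda_N)+\nabla C(X_N)/\omega_N$; $\mathcal{T}_{6i}=\nabla_uH(X_i,U_i,\Lambda_i)$ ($1\le i\le N$). (The system $\mathcal{T}=0$ is the first-order optimality system of (NLP), with $\Lambda_i$, $i\ge1$, equal to the multiplier of the $i$-th dynamics constraint divided by $\omega_i$ and $\Lambda_0$ the multiplier of $X_0=x_0$.) *)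

theory Defs
  imports "HOL-Analysis.Analysis" "HOL-Computational_Algebra.Polynomial"
begin

text \<open>tau i, 1 <= i <= N, and w i, 1 <= i <= N, are the nodes and weights of the N-point
  Gauss--Radau rule on [-1,1] with fixed node +1; by convention tau 0 = -1.\<close>
definition radau_rule :: "nat \<Rightarrow> (nat \<Rightarrow> real) \<Rightarrow> (nat \<Rightarrow> real) \<Rightarrow> bool" where
  "radau_rule N tau w \<longleftrightarrow>
     tau 0 = -1 \<and> -1 < tau 1 \<and> (\<forall>i\<in>{1..<N}. tau i < tau (Suc i)) \<and> tau N = 1 \<and>
     (\<forall>i\<in>{1..N}. 0 < w i) \<and>
     (\<forall>p :: real poly. degree p \<le> 2 * N - 2 \<longrightarrow>
        (\<Sum>i=1..N. w i * poly p (tau i)) = integral {-1..1} (poly p))"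

definition lagrange_basis :: "(nat \<Rightarrow> real) \<Rightarrow> nat \<Rightarrow> nat \<Rightarrow> real \<Rightarrow> real" where
  "lagrange_basis tau N j t = (\<Prod>i\<in>{0..N} - {j}. (t - tau i) / (tau j - tau i))"

text \<open>D i j = L_j'(tau i), 1 <= i <= N, 0 <= j <= N.\<close>
definition Dmat :: "(nat \<Rightarrow> real) \<Rightarrow> nat \<Rightarrow> nat \<Rightarrow> nat \<Rightarrow> real" where
  "Dmat tau N i j = deriv (lagrange_basis tau N j) (tau i)"

definition Dddag :: "(nat \<Rightarrow> real) \<Rightarrow> (nat \<Rightarrow> real) \<Rightarrow> nat \<Rightarrow> nat \<Rightarrow> nat \<Rightarrow> real" where
  "Dddag tau w N i j = - (w j / w i) * Dmat tau N j i"

definition is_inverse_on :: "nat \<Rightarrow> (nat \<Rightarrow> nat \<Rightarrow> real) \<Rightarrow> (nat \<Rightarrow> nat \<Rightarrow> real) \<Rightarrow> bool" where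
  "is_inverse_on N A B \<longleftrightarrow>
     (\<forall>i\<in>{1..N}. \<forall>j\<in>{1..N}. (\<Sum>k=1..N. A i k * B k j) = (if i = j then 1 else 0)) \<and>
     (\<forall>i\<in>{1..N}. \<forall>j\<in>{1..N}. (\<Sum>k=1..N. B i k * A k j) = (if i = j then 1 else 0))"

definition inf_norm_on :: "nat \<Rightarrow> (nat \<Rightarrow> nat \<Rightarrow> real) \<Rightarrow> real" where
  "inf_norm_on N B = Max ((\<lambda>i. \<Sum>j=1..N. \<bar>B i j\<bar>) ` {1..N})"

definition prop_P1 :: "(nat \<Rightarrow> real) \<Rightarrow> nat \<Rightarrow> bool" where
  "prop_P1 tau N \<longleftrightarrow> (\<exists>B. is_inverse_on N (\<lambda>i j. Dmat tau N i j) B \<and> inf_norm_on N B \<le> 2)"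

definition prop_P2 :: "(nat \<Rightarrow> real) \<Rightarrow> (nat \<Rightarrow> real) \<Rightarrow> nat \<Rightarrow> bool" where
  "prop_P2 tau w N \<longleftrightarrow> (\<exists>B. is_inverse_on N (\<lambda>i j. sqrt (w i) * Dmat tau N i j) B \<and>
      (\<forall>i\<in>{1..N}. sqrt (\<Sum>j=1..N. (B i j)\<^sup>2) \<le> sqrt 2))"

definition prop_P3 :: "(nat \<Rightarrow> real) \<Rightarrow> (nat \<Rightarrow> real) \<Rightarrow> nat \<Rightarrow> bool" where
  "prop_P3 tau w N \<longleftrightarrow> (\<exists>B. is_inverse_on N (\<lambda>i j. Dddag tau w N i j) B \<and> inf_norm_on N B \<le> 2)"

definition prop_P4 :: "(nat \<Rightarrow> real) \<Rightarrow> (nat \<Rightarrow> real) \<Rightarrow> nat \<Rightarrow> bool" where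
  "prop_P4 tau w N \<longleftrightarrow> (\<exists>B. is_inverse_on N (\<lambda>i j. sqrt (w i) * Dddag tau w N i j) B \<and>
      (\<forall>i\<in>{1..N}. sqrt (\<Sum>j=1..N. (B i j)\<^sup>2) \<le> sqrt 2))"

definition Ck_on :: "nat \<Rightarrow> (real \<Rightarrow> 'a::real_normed_vector) \<Rightarrow> bool" where
  "Ck_on k g \<longleftrightarrow> (\<exists>d :: nat \<Rightarrow> real \<Rightarrow> 'a. d 0 = g \<and>
     (\<forall>j<k. \<forall>t\<in>{-1..1}. (d j has_vector_derivative d (Suc j) t) (at t within {-1..1})) \<and>
     (\<forall>j\<le>k. continuous_on {-1..1} (d j)))"

definition C2_on :: "'a::euclidean_space set \<Rightarrow> ('a \<Rightarrow> 'b::euclidean_space) \<Rightarrow> bool" where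
  "C2_on S g \<longleftrightarrow> (\<exists>(Dg :: 'a \<Rightarrow> 'a \<Rightarrow>\<^sub>L 'b) (D2g :: 'a \<Rightarrow> 'a \<Rightarrow>\<^sub>L ('a \<Rightarrow>\<^sub>L 'b)).
     (\<forall>z\<in>S. (g has_derivative blinfun_apply (Dg z)) (at z within S) \<and>
             (Dg has_derivative blinfun_apply (D2g z)) (at z within S)) \<and>
     continuous_on S Dg \<and> continuous_on S D2g)"

definition grad :: "(real^'k \<Rightarrow> real) \<Rightarrow> real^'k \<Rightarrow> real^'k" where
  "grad g x = (\<chi> i. frechet_derivative g (at x) (axis i 1))"

definition hess :: "(real^'k \<Rightarrow> real) \<Rightarrow> real^'k \<Rightarrow> real^'k^'k" where
  "hess g x = (\<chi> i j. frechet_derivative (\<lambda>y. grad g y $ j) (at x) (axis i 1))"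

definition pdir :: "'n::finite + 'm::finite \<Rightarrow> (real^'n) \<times> (real^'m)" where
  "pdir a = (case a of Inl i \<Rightarrow> (axis i 1, 0) | Inr j \<Rightarrow> (0, axis j 1))"

definition hess_pair :: "((real^'n) \<times> (real^'m) \<Rightarrow> real) \<Rightarrow> (real^'n) \<times> (real^'m) \<Rightarrow> real^('n + 'm)^('n + 'm)" where
  "hess_pair g z = (\<chi> a b. frechet_derivative (\<lambda>w. frechet_derivative g (at w) (pdir b)) (at z) (pdir a))"

definition jac_x :: "(real^'n \<Rightarrow> real^'m \<Rightarrow> real^'n) \<Rightarrow> real^'n \<Rightarrow> real^'m \<Rightarrow> real^'n^'n" where
  "jac_x f x u = matrix (frechet_derivative (\<lambda>y. f y u) (at x))"

definition mat_inf_norm :: "real^'k^'k \<Rightarrow> real" where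
  "mat_inf_norm A = Max (range (\<lambda>i. \<Sum>j\<in>UNIV. \<bar>A $ i $ j\<bar>))"

text \<open>Every (real) eigenvalue of A exceeds alpha, i.e. for a symmetric A:
  the smallest eigenvalue of A exceeds alpha.\<close>
definition eigenvalues_gt :: "real^'k^'k \<Rightarrow> real \<Rightarrow> bool" where
  "eigenvalues_gt A alpha \<longleftrightarrow> (\<forall>mu v. v \<noteq> 0 \<and> A *v v = mu *\<^sub>R v \<longrightarrow> alpha < mu)"

definition Ham :: "(real^'n \<Rightarrow> real^'m \<Rightarrow> real^'n) \<Rightarrow> real^'n \<Rightarrow> real^'m \<Rightarrow> real^'n \<Rightarrow> real" where
  "Ham f x u lam = lam \<bullet> f x u"

definition gradx_H :: "(real^'n \<Rightarrow> real^'m \<Rightarrow> real^'n) \<Rightarrow> real^'n \<Rightarrow> real^'m \<Rightarrow> real^'n \<Rightarrow> real^'n" where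
  "gradx_H f x u lam = grad (\<lambda>y. Ham f y u lam) x"

definition gradu_H :: "(real^'n \<Rightarrow> real^'m \<Rightarrow> real^'n) \<Rightarrow> real^'n \<Rightarrow> real^'m \<Rightarrow> real^'n \<Rightarrow> real^'m" where
  "gradu_H f x u lam = grad (\<lambda>v. Ham f x v lam) u"

definition P_feasible :: "(real^'n \<Rightarrow> real^'m \<Rightarrow> real^'n) \<Rightarrow> real^'n \<Rightarrow> (real \<Rightarrow> real^'n) \<Rightarrow> (real \<Rightarrow> real^'m) \<Rightarrow> bool" where
  "P_feasible f x0 x u \<longleftrightarrow> Ck_on 1 x \<and> continuous_on {-1..1} u \<and> x (-1) = x0 \<and>
     (\<forall>t\<in>{-1..1}. (x has_vector_derivative f (x t) (u t)) (at t within {-1..1}))"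

definition P_local_min :: "(real^'n \<Rightarrow> real^'m \<Rightarrow> real^'n) \<Rightarrow> (real^'n \<Rightarrow> real) \<Rightarrow> real^'n \<Rightarrow>
    (real \<Rightarrow> real^'n) \<Rightarrow> (real \<Rightarrow> real^'m) \<Rightarrow> bool" where
  "P_local_min f C x0 xs us \<longleftrightarrow> P_feasible f x0 xs us \<and>
     (\<exists>e>0. \<forall>x u. P_feasible f x0 x u \<and>
        (\<forall>t\<in>{-1..1}. norm (x t - xs t) \<le> e \<and>
            norm (vector_derivative x (at t within {-1..1}) - vector_derivative xs (at t within {-1..1})) \<le> e \<and>
            norm (u t - us t) \<le> e)
        \<longrightarrow> C (xs 1) \<le> C (x 1))"

definition NLP_feasible :: "(nat \<Rightarrow> real) \<Rightarrow> nat \<Rightarrow> (real^'n \<Rightarrow> real^'m \<Rightarrow> real^'n) \<Rightarrow> real^'n \<Rightarrow>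
    (nat \<Rightarrow> real^'n) \<Rightarrow> (nat \<Rightarrow> real^'m) \<Rightarrow> bool" where
  "NLP_feasible tau N f x0 X U \<longleftrightarrow> X 0 = x0 \<and>
     (\<forall>i\<in>{1..N}. (\<Sum>j=0..N. Dmat tau N i j *\<^sub>R X j) = f (X i) (U i))"

definition NLP_strict_local_min :: "(nat \<Rightarrow> real) \<Rightarrow> nat \<Rightarrow> (real^'n \<Rightarrow> real^'m \<Rightarrow> real^'n) \<Rightarrow>
    (real^'n \<Rightarrow> real) \<Rightarrow> real^'n \<Rightarrow> (nat \<Rightarrow> real^'n) \<Rightarrow> (nat \<Rightarrow> real^'m) \<Rightarrow> bool" where
  "NLP_strict_local_min tau N f C x0 X U \<longleftrightarrow> NLP_feasible tau N f x0 X U \<and>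
     (\<exists>e>0. \<forall>X' U'. NLP_feasible tau N f x0 X' U' \<and>
        (\<forall>i\<in>{0..N}. norm (X' i - X i) < e) \<and> (\<forall>i\<in>{1..N}. norm (U' i - U i) < e) \<and>
        ((\<exists>i\<in>{0..N}. X' i \<noteq> X i) \<or> (\<exists>i\<in>{1..N}. U' i \<noteq> U i))
        \<longrightarrow> C (X N) < C (X' N))"

definition T_zero :: "(nat \<Rightarrow> real) \<Rightarrow> (nat \<Rightarrow> real) \<Rightarrow> nat \<Rightarrow> (real^'n \<Rightarrow> real^'m \<Rightarrow> real^'n) \<Rightarrow>
    (real^'n \<Rightarrow> real) \<Rightarrow> real^'n \<Rightarrow> (nat \<Rightarrow> real^'n) \<Rightarrow> (nat \<Rightarrow> real^'m) \<Rightarrow> (nat \<Rightarrow> real^'n) \<Rightarrow> bool" where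
  "T_zero tau w N f C x0 X U Lam \<longleftrightarrow>
     (\<forall>i\<in>{1..N}. (\<Sum>j=0..N. Dmat tau N i j *\<^sub>R X j) - f (X i) (U i) = 0) \<and>
     X 0 - x0 = 0 \<and>
     Lam 0 - grad C (X N) - (\<Sum>i=1..N. w i *\<^sub>R gradx_H f (X i) (U i) (Lam i)) = 0 \<and>
     (\<forall>i\<in>{1..<N}. (\<Sum>j=1..N. Dddag tau w N i j *\<^sub>R Lam j) + gradx_H f (X i) (U i) (Lam i) = 0) \<and>
     (\<Sum>j=1..N. Dddag tau w N N j *\<^sub>R Lam j) + gradx_H f (X N) (U N) (Lam N)
        + (1 / w N) *\<^sub>R grad C (X N) = 0 \<and>
     (\<forall>i\<in>{1..N}. gradu_H f (X i) (U i) (Lam i) = 0)"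

end

theory Submission
  imports Defs
begin

text \<open>
  Inverting the two differentiation matrices turns the discrete optimality system into a
  system of integral type, \<open>X = x0 + E f\<close>, \<open>Lam = grad C (X N) - E' grad_x H\<close>, \<open>grad_u H = 0\<close>,
  in which every operator is bounded independently of \<open>N\<close> in the maximum norm. Its linearization at
  the nodal values of \<open>(xs, us, lams)\<close> is uniformly invertible: pairing state and costate in the
  quadrature inner product and using convexity (A2) bounds the weighted \<open>L\<^sup>2\<close> norm of \<open>(x, u)\<close> by
  the data, and (P1)--(P4) with (A3) upgrade this to maximum norms.
  The residual at the nodal values is at most a multiple of the uniform error of approximating
  \<open>xs'\<close> and \<open>lams'\<close> by polynomials of degree \<open>N - 2\<close>, because \<open>E\<close> and \<open>E'\<close> integrate polynomials
  exactly; no Lebesgue constants enter. A Newton contraction then gives the solution, and strict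
  minimality follows because along feasible points the cost increment is a sum of convexity gaps
  of \<open>C\<close> and of the Hamiltonians.
\<close>

subsection \<open>Polynomial approximation\<close>

text \<open>Inversion is shaped by the factor \<open>1 / w N\<close> in the last adjoint equation:
  the Radau endpoint weight is \<open>2 / N^2\<close>, so the terminal gradient would be amplified
  without bound. (A3) enters as 2 * 1/4 = 1/2: rows of the inverses have absolute sum at most 2, so
  the coupling of state or costate to itself is absorbed in the maximum norm. The remaining terms
  are measured in the weighted norm, and (P2), (P4) turn that into pointwise bounds. The control is
  only continuous and is never approximated. Along the optimum \<open>f\<close> equals
  \<open>xs'\<close>, \<open>gradx_H\<close> equals \<open>- lams'\<close> and
  \<open>gradu_H\<close> vanishes, so consistency rests on the smoothness of \<open>xs\<close> and
  \<open>lams\<close>. Rate: functions in C^eta have Chebyshev coefficients of order k^(-eta); a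
  factor k^(-2) is kept to sum the tail, which leaves N^(2 - eta). The degree N - 2 arises because
  \<open>Dddag\<close> is exact only below degree N, and the approximant is integrated once. Order
  of choices: bounds on the coefficients fix the stability constant, this fixes the tolerance
  \<open>e\<close> of linearization, \<open>e\<close> fixes the radius \<open>r\<close>, and
  \<open>N0\<close> comes last.\<close>

lemma poly_antiderivative_exists:
  fixes Q :: "real poly"
  shows "\<exists>P. pderiv P = Q \<and> poly P a = b \<and> degree P \<le> Suc (degree Q)"
proof -
  define R where "R = (\<Sum>i\<le>degree Q. monom (coeff Q i / real (Suc i)) (Suc i))"
  define P where "P = R + [:b - poly R a:]"
  have "pderiv R = (\<Sum>i\<le>degree Q. monom (coeff Q i) i)"
    using higher_pderiv_sum[of 1 "\<lambda>i. monom (coeff Q i / real (Suc i)) (Suc i)" "{..degree Q}"]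
    unfolding R_def by (simp add: pderiv_monom del: of_nat_Suc)
  then have "pderiv P = Q"
    unfolding P_def by (simp add: pderiv_add pderiv_pCons poly_as_sum_of_monoms)
  moreover have "poly P a = b"
    unfolding P_def by simp
  moreover have "degree R \<le> Suc (degree Q)"
    unfolding R_def
    by (intro degree_sum_le) (auto intro: order_trans[OF degree_monom_le])
  then have "degree P \<le> Suc (degree Q)"
    unfolding P_def by (intro degree_add_le) auto
  ultimately show ?thesis by blast
qed

section \<open>Chebyshev coefficients and their decay\<close>

fun chebyshev_poly :: "nat \<Rightarrow> real poly" where
  "chebyshev_poly 0 = 1"
| "chebyshev_poly (Suc 0) = [:0, 1:]"
| "chebyshev_poly (Suc (Suc n)) = [:0, 2:] * chebyshev_poly (Suc n) - chebyshev_poly n"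

lemma poly_chebyshev_cos: "poly (chebyshev_poly n) (cos x) = cos (real n * x)"
proof (induction n rule: chebyshev_poly.induct)
  case (3 n)
  have "cos (real (Suc (Suc n)) * x) = cos (real (Suc n) * x + x)"
    and "cos (real n * x) = cos (real (Suc n) * x - x)"
    by (simp_all add: algebra_simps)
  then show ?case using 3 by (simp add: cos_add cos_diff del: of_nat_Suc)
qed auto

lemma abs_poly_chebyshev_le_1:
  assumes "t \<in> {-1..1}"
  shows "\<bar>poly (chebyshev_poly n) t\<bar> \<le> 1"
  using poly_chebyshev_cos[of n "arccos t"] assms by (simp add: cos_arccos)

lemma degree_chebyshev: "degree (chebyshev_poly n) = n"
proof (induction n rule: chebyshev_poly.induct)
  case (3 n)
  have ne: "chebyshev_poly (Suc n) \<noteq> 0" using 3(1) by auto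
  have "degree ([:0, 2:] * chebyshev_poly (Suc n)) = Suc (Suc n)"
    using ne 3 by (subst degree_mult_eq) auto
  then show ?case using 3
    by (simp only: chebyshev_poly.simps diff_conv_add_uminus)
      (subst degree_add_eq_left; simp)
qed auto

text \<open>Since \<open>chebyshev_poly k\<close> has degree exactly \<open>k\<close>, a multiple of
  the top one removes the leading coefficient and lowers the degree.\<close>

lemma chebyshev_expansion_exists:
  fixes P :: "real poly"
  assumes "degree P \<le> m"
  shows "\<exists>c. P = (\<Sum>k\<le>m. smult (c k) (chebyshev_poly k))"
  using assms
proof (induction m arbitrary: P)
  case 0
  then obtain a where "P = [:a:]" using degree_eq_zeroE by auto
  then show ?case by (intro exI[of _ "\<lambda>_. a"]) (simp add: one_pCons)
next
  case (Suc m)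
  define T where "T = chebyshev_poly (Suc m)"
  have lc: "coeff T (Suc m) \<noteq> 0"
    using degree_chebyshev[of "Suc m"] unfolding T_def
    by (metis Zero_not_Suc degree_0 leading_coeff_0_iff)
  define a where "a = coeff P (Suc m) / coeff T (Suc m)"
  have "degree (P - smult a T) \<le> m"
  proof (rule degree_le, intro allI impI)
    fix i assume "i > m"
    show "coeff (P - smult a T) i = 0"
    proof (cases "i = Suc m")
      case True then show ?thesis using lc by (simp add: a_def)
    next
      case False
      then have "i > Suc m" using \<open>i > m\<close> by simp
      then have "coeff P i = 0" "coeff T i = 0"
        using Suc.prems degree_chebyshev[of "Suc m"] by (auto simp: T_def intro!: coeff_eq_0)
      then show ?thesis by simp
    qed
  qed
  then obtain c where c: "P - smult a T = (\<Sum>k\<le>m. smult (c k) (chebyshev_poly k))"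
    using Suc.IH by blast
  have "P = (\<Sum>k\<le>m. smult (c k) (chebyshev_poly k)) + smult a T"
    using c by (simp add: algebra_simps)
  also have "\<dots> = (\<Sum>k\<le>Suc m. smult ((c(Suc m := a)) k) (chebyshev_poly k))"
    by (simp add: T_def)
  finally show ?case by blast
qed

text \<open>Under t = cos x this is the integral of \<open>P\<close> times the \<open>k\<close>-th
  Chebyshev polynomial against the weight 1 / sqrt (1 - t^2). The trigonometric form permits
  integration by parts without endpoint singularities.\<close>

definition cheb_moment :: "real poly \<Rightarrow> nat \<Rightarrow> real" where
  "cheb_moment P k = integral {0..pi} (\<lambda>x. poly P (cos x) * cos (real k * x))"

text \<open>Integer frequencies, because the product-to-sum formula produces the difference
  \<open>int j - int k\<close>.\<close>

lemma integral_cos_of_int: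
  fixes k :: int
  shows "integral {0..pi} (\<lambda>x. cos (of_int k * x)) = (if k = 0 then pi else 0)"
proof (cases "k = 0")
  case False
  have "((\<lambda>x. cos (of_int k * x)) has_integral
      (sin (of_int k * pi) / of_int k - sin (of_int k * 0) / of_int k)) {0..pi}"
    by (rule fundamental_theorem_of_calculus)
      (use False in \<open>auto intro!: derivative_eq_intros simp: has_real_derivative_iff_has_vector_derivative[symmetric]\<close>)
  then show ?thesis using False by (simp add: integral_unique mult.commute)
qed simp

lemma cos_int_integrable: "(\<lambda>x. cos (of_int k * x)) integrable_on {0..pi}"
  by (intro integrable_continuous_interval continuous_intros)

lemma integral_cos_cos:
  fixes j k :: nat
  assumes "k \<ge> 1"
  shows "integral {0..pi} (\<lambda>x. cos (real j * x) * cos (real k * x)) = (if j = k then pi / 2 else 0)"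
proof -
  have "(\<lambda>x. cos (real j * x) * cos (real k * x)) =
      (\<lambda>x. (1/2) * (cos (of_int (int j - int k) * x) + cos (of_int (int j + int k) * x)))"
  proof
    fix x
    have e: "real_of_int (int j - int k) * x = real j * x - real k * x"
      "real_of_int (int j + int k) * x = real j * x + real k * x"
      by (simp_all add: algebra_simps)
    show "cos (real j * x) * cos (real k * x) =
      (1/2) * (cos (of_int (int j - int k) * x) + cos (of_int (int j + int k) * x))"
      unfolding e by (simp add: cos_add cos_diff)
  qed
  then have "integral {0..pi} (\<lambda>x. cos (real j * x) * cos (real k * x)) =
    (1/2) * (integral {0..pi} (\<lambda>x. cos (of_int (int j - int k) * x)) + integral {0..pi} (\<lambda>x. cos (of_int (int j + int k) * x)))"
    by (simp only: integral_mult_right integral_add[OF cos_int_integrable cos_int_integrable])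
  also have "\<dots> = (if j = k then pi / 2 else 0)"
    unfolding integral_cos_of_int using assms by auto
  finally show ?thesis .
qed

text \<open>Orthogonality of cosines. The index 0 is left out because its normalization is
  \<open>pi\<close> instead of \<open>pi / 2\<close>; only coefficients in the tail of the series
  are estimated.\<close>

lemma cheb_moment_expansion:
  assumes "P = (\<Sum>k\<le>m. smult (c k) (chebyshev_poly k))" "1 \<le> k" "k \<le> m"
  shows "cheb_moment P k = c k * (pi / 2)"
proof -
  have "cheb_moment P k = integral {0..pi} (\<lambda>x. \<Sum>j\<le>m. c j * (cos (real j * x) * cos (real k * x)))"
    unfolding cheb_moment_def assms(1)
    by (simp add: poly_sum poly_chebyshev_cos sum_distrib_right mult.assoc)
  also have "\<dots> = (\<Sum>j\<le>m. integral {0..pi} (\<lambda>x. c j * (cos (real j * x) * cos (real k * x))))"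
    by (intro integral_sum) (auto intro!: integrable_continuous_interval continuous_intros)
  also have "\<dots> = (\<Sum>j\<le>m. c j * (if j = k then pi / 2 else 0))"
    by (simp only: integral_mult_right integral_cos_cos[OF assms(2)])
  also have "\<dots> = (\<Sum>j\<le>m. if j = k then c k * (pi / 2) else 0)"
    by (intro sum.cong) auto
  finally show ?thesis using assms(3) by simp
qed

lemma cheb_moment_bound:
  assumes "\<And>t. t \<in> {-1..1} \<Longrightarrow> \<bar>poly P t\<bar> \<le> M"
  shows "\<bar>cheb_moment P k\<bar> \<le> pi * M"
proof -
  have "norm (cheb_moment P k) \<le> M * (pi - 0)"
    unfolding cheb_moment_def
  proof (rule integral_bound)
    show "continuous_on {0..pi} (\<lambda>x. poly P (cos x) * cos (real k * x))"
      by (intro continuous_intros)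
    fix x :: real
    have "\<bar>poly P (cos x)\<bar> * \<bar>cos (real k * x)\<bar> \<le> M * 1"
      by (intro mult_mono assms) (use assms[of 0] in auto)
    then show "norm (poly P (cos x) * cos (real k * x)) \<le> M" by (simp add: abs_mult)
  qed simp
  then show ?thesis by (simp add: mult.commute)
qed

text \<open>Integration by parts: each derivative of \<open>P\<close> gains a factor \<open>1 / k\<close>.\<close>

lemma cheb_moment_pderiv:
  assumes "k \<ge> 1"
  shows "cheb_moment P k = (cheb_moment (pderiv P) (k - 1) - cheb_moment (pderiv P) (k + 1)) / (2 * real k)"
proof -
  define g where "g j x = poly (pderiv P) (cos x) * cos (real j * x)" for j x
  have int: "g j integrable_on {0..pi}" for j
    unfolding g_def by (intro integrable_continuous_interval continuous_intros)
  have int0: "(\<lambda>x. poly P (cos x) * cos (real k * x)) integrable_on {0..pi}"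
    by (intro integrable_continuous_interval continuous_intros)
  \<comment> \<open>The antiderivative is \<open>poly P (cos x) * sin (real k * x)\<close>, which
    vanishes at both ends; the product of sines in its derivative splits into the frequencies
    \<open>k - 1\<close> and \<open>k + 1\<close>.\<close>
  have "((\<lambda>x. real k * (poly P (cos x) * cos (real k * x)) - (1/2) * (g (k-1) x - g (k+1) x)) has_integral
      poly P (cos pi) * sin (real k * pi) - poly P (cos 0) * sin (real k * 0)) {0..pi}"
  proof (rule fundamental_theorem_of_calculus)
    fix x :: real
    have e: "real (k-1) * x = real k * x - x" "real (k+1) * x = real k * x + x"
      using assms by (simp_all add: of_nat_diff algebra_simps)
    have "((\<lambda>x. poly P (cos x) * sin (real k * x)) has_real_derivative
        (poly (pderiv P) (cos x) * (- sin x) * sin (real k * x) + (cos (real k * x) * real k) * poly P (cos x))) (at x)"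
      by (auto intro!: derivative_eq_intros DERIV_chain2[OF poly_DERIV])
    moreover have "poly (pderiv P) (cos x) * (- sin x) * sin (real k * x) + (cos (real k * x) * real k) * poly P (cos x)
       = real k * (poly P (cos x) * cos (real k * x)) - (1/2) * (g (k-1) x - g (k+1) x)"
      unfolding g_def e by (simp add: cos_add cos_diff algebra_simps)
    ultimately have "((\<lambda>x. poly P (cos x) * sin (real k * x)) has_real_derivative
      real k * (poly P (cos x) * cos (real k * x)) - (1/2) * (g (k-1) x - g (k+1) x)) (at x)"
      by (simp only:)
    then show "((\<lambda>x. poly P (cos x) * sin (real k * x)) has_vector_derivative
      real k * (poly P (cos x) * cos (real k * x)) - (1/2) * (g (k-1) x - g (k+1) x)) (at x within {0..pi})"
      unfolding has_real_derivative_iff_has_vector_derivative by (rule has_vector_derivative_at_within)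
  qed simp
  then have "integral {0..pi} (\<lambda>x. real k * (poly P (cos x) * cos (real k * x)) - (1/2) * (g (k-1) x - g (k+1) x)) = 0"
    by (simp add: integral_unique mult.commute)
  moreover have "integral {0..pi} (\<lambda>x. real k * (poly P (cos x) * cos (real k * x)) - (1/2) * (g (k-1) x - g (k+1) x))
     = real k * cheb_moment P k - (1/2) * (cheb_moment (pderiv P) (k-1) - cheb_moment (pderiv P) (k+1))"
    unfolding cheb_moment_def g_def[symmetric]
    by (simp only: integral_diff[OF integrable_on_mult_right[OF int0] integrable_on_mult_right[OF integrable_diff[OF int int]]]
        integral_mult_right integral_diff[OF int int])
  ultimately show ?thesis using assms by (simp add: field_simps)
qed

text \<open>Induction on \<open>r\<close> through \<open>cheb_moment_pderiv\<close>. The constant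
  depends on \<open>r\<close> alone and not on the degree of \<open>P\<close>, so it can be applied
  to approximants of uncontrolled degree.\<close>

lemma cheb_moment_decay:
  "\<exists>c\<ge>0. \<forall>P M. (\<forall>j\<le>r. \<forall>t\<in>{-1..1}. \<bar>poly ((pderiv ^^ j) P) t\<bar> \<le> M) \<longrightarrow>
     (\<forall>k\<ge>1. \<bar>cheb_moment P k\<bar> \<le> c * M / real k ^ r)"
proof (induction r)
  case 0
  show ?case
    by (intro exI[of _ pi]) (auto intro: cheb_moment_bound)
next
  case (Suc r)
  then obtain c where c: "c \<ge> 0"
    "\<And>P M k. \<forall>j\<le>r. \<forall>t\<in>{-1..1}. \<bar>poly ((pderiv ^^ j) P) t\<bar> \<le> M \<Longrightarrow> k \<ge> 1
       \<Longrightarrow> \<bar>cheb_moment P k\<bar> \<le> c * M / real k ^ r" by blast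
  show ?case
  \<comment> \<open>The summand \<open>pi\<close> covers \<open>k = 1\<close>, where
    \<open>k - 1 = 0\<close> is outside the induction hypothesis. For \<open>k \<ge> 2\<close> both
    neighbours of \<open>k\<close> are at least \<open>k / 2\<close>, which costs
    \<open>2 ^ r\<close>.\<close>
  proof (intro exI[of _ "pi + c * 2 ^ r"] conjI allI impI)
    show "0 \<le> pi + c * 2 ^ r" using c(1) by simp
    fix P :: "real poly" and M :: real and k :: nat
    assume b: "\<forall>j\<le>Suc r. \<forall>t\<in>{-1..1}. \<bar>poly ((pderiv ^^ j) P) t\<bar> \<le> M" and k: "1 \<le> k"
    have M0: "M \<ge> 0" using b[rule_format, of 0 0] by auto
    have b': "\<forall>j\<le>r. \<forall>t\<in>{-1..1}. \<bar>poly ((pderiv ^^ j) (pderiv P)) t\<bar> \<le> M"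
    proof (intro allI impI ballI)
      fix j and t :: real assume "j \<le> r" "t \<in> {-1..1}"
      then show "\<bar>poly ((pderiv ^^ j) (pderiv P)) t\<bar> \<le> M"
        using b[rule_format, of "Suc j" t] by (simp add: funpow_swap1)
    qed
    show "\<bar>cheb_moment P k\<bar> \<le> (pi + c * 2 ^ r) * M / real k ^ Suc r"
    proof (cases "k = 1")
      case True
      have "\<bar>cheb_moment P k\<bar> \<le> pi * M"
        by (rule cheb_moment_bound) (use b[rule_format, of 0] in auto)
      also have "\<dots> \<le> (pi + c * 2 ^ r) * M" using M0 c(1) by (intro mult_right_mono) auto
      finally show ?thesis using True by simp
    next
      case False
      then have k2: "k \<ge> 2" using k by simp
      have "\<bar>cheb_moment (pderiv P) (k - 1)\<bar> \<le> c * M / real (k - 1) ^ r"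
        by (rule c(2)[OF b']) (use k2 in auto)
      also have "\<dots> \<le> c * M / (real k / 2) ^ r"
        using k2 c(1) M0 by (intro divide_left_mono power_mono mult_pos_pos zero_less_power) (auto simp: of_nat_diff)
      finally have 1: "\<bar>cheb_moment (pderiv P) (k - 1)\<bar> \<le> c * M * 2 ^ r / real k ^ r"
        by (simp add: power_divide)
      have "\<bar>cheb_moment (pderiv P) (k + 1)\<bar> \<le> c * M / real (k + 1) ^ r"
        by (rule c(2)[OF b']) (use k2 in auto)
      also have "\<dots> \<le> c * M / (real k / 2) ^ r"
        using k2 c(1) M0 by (intro divide_left_mono power_mono mult_pos_pos zero_less_power) auto
      finally have 2: "\<bar>cheb_moment (pderiv P) (k + 1)\<bar> \<le> c * M * 2 ^ r / real k ^ r"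
        by (simp add: power_divide)
      have "\<bar>cheb_moment P k\<bar> = \<bar>cheb_moment (pderiv P) (k - 1) - cheb_moment (pderiv P) (k + 1)\<bar> / (2 * real k)"
        unfolding cheb_moment_pderiv[OF k] by (simp add: abs_divide)
      also have "\<dots> \<le> (2 * (c * M * 2 ^ r / real k ^ r)) / (2 * real k)"
        using 1 2 by (intro divide_right_mono) auto
      also have "\<dots> = (c * 2 ^ r) * M / real k ^ Suc r" by (simp add: field_simps)
      also have "\<dots> \<le> (pi + c * 2 ^ r) * M / real k ^ Suc r"
        using M0 by (intro divide_right_mono mult_right_mono) auto
      finally show ?thesis .
    qed
  qed
qed

lemma sum_inverse_squares_le: "(\<Sum>k=1..Suc m. 1 / (real k)\<^sup>2) \<le> 2 - 1 / real (Suc m)"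
proof (induction m)
  case (Suc m)
  have "1 / (real m + 2)\<^sup>2 \<le> 1 / ((real m + 1) * (real m + 2))"
    by (intro divide_left_mono) (auto simp: power2_eq_square intro!: mult_right_mono)
  also have "\<dots> = 1 / (real m + 1) - 1 / (real m + 2)"
    by (simp add: field_simps)
  finally show ?case using Suc by (simp add: algebra_simps)
qed simp

lemma sum_inverse_squares_le_2: "finite K \<Longrightarrow> 0 \<notin> K \<Longrightarrow> (\<Sum>k\<in>K. 1 / (real k)\<^sup>2) \<le> 2"
proof -
  assume K: "finite K" "0 \<notin> K"
  define m where "m = Max (insert 0 K)"
  have "K \<subseteq> {1..Suc m}"
  proof
    fix k assume "k \<in> K"
    then have "k \<noteq> 0" "k \<le> m" using K unfolding m_def by (metis, auto)
    then show "k \<in> {1..Suc m}" by auto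
  qed
  then have "(\<Sum>k\<in>K. 1 / (real k)\<^sup>2) \<le> (\<Sum>k=1..Suc m. 1 / (real k)\<^sup>2)"
    by (intro sum_mono2) auto
  then show ?thesis using sum_inverse_squares_le[of m]
    by (smt (verit) divide_nonneg_nonneg of_nat_0_le_iff)
qed

text \<open>\<open>Q\<close> is the truncated Chebyshev series. A coefficient with
  \<open>k > n\<close> is at most a multiple of k^(-r) = k^(2-r) * k^(-2), hence of n^(2-r) *
  k^(-2), and the inverse squares sum to at most 2.\<close>

lemma polynomial_truncation_error:
  assumes "r \<ge> 2"
  shows "\<exists>c\<ge>0. \<forall>P M n. (\<forall>j\<le>r. \<forall>t\<in>{-1..1}. \<bar>poly ((pderiv ^^ j) P) t\<bar> \<le> M) \<longrightarrow> n \<ge> 1 \<longrightarrow>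
     (\<exists>Q. degree Q \<le> n \<and> (\<forall>t\<in>{-1..1}. \<bar>poly Q t - poly P t\<bar> \<le> c * M * real n powr (2 - real r)))"
proof -
  obtain c where c: "c \<ge> 0"
    "\<And>P M k. \<forall>j\<le>r. \<forall>t\<in>{-1..1}. \<bar>poly ((pderiv ^^ j) P) t\<bar> \<le> M \<Longrightarrow> k \<ge> 1
       \<Longrightarrow> \<bar>cheb_moment P k\<bar> \<le> c * M / real k ^ r" using cheb_moment_decay[of r] by blast
  show ?thesis
  proof (intro exI[of _ "2 * c"] conjI allI impI)
    show "0 \<le> 2 * c" using c(1) by simp
    fix P :: "real poly" and M :: real and n :: nat
    assume b: "\<forall>j\<le>r. \<forall>t\<in>{-1..1}. \<bar>poly ((pderiv ^^ j) P) t\<bar> \<le> M" and n: "1 \<le> n"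
    have M0: "M \<ge> 0" using b[rule_format, of 0 0] by auto
    define m where "m = max n (degree P)"
    obtain a where a: "P = (\<Sum>k\<le>m. smult (a k) (chebyshev_poly k))"
      using chebyshev_expansion_exists[of P m] by (auto simp: m_def)
    define Q where "Q = (\<Sum>k\<le>n. smult (a k) (chebyshev_poly k))"
    have split: "P = Q + (\<Sum>k\<in>{n<..m}. smult (a k) (chebyshev_poly k))"
    proof -
      have "{..m} = {..n} \<union> {n<..m}" unfolding m_def by auto
      then have "P = (\<Sum>k\<in>{..n} \<union> {n<..m}. smult (a k) (chebyshev_poly k))" using a by simp
      then show ?thesis unfolding Q_def by (subst (asm) sum.union_disjoint) auto
    qed
    have ak: "\<bar>a k\<bar> \<le> c * M * real n powr (2 - real r) * (1 / (real k)\<^sup>2)" if k: "k \<in> {n<..m}" for k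
    proof -
      have kr: "real k ^ r = real k ^ (r - 2) * (real k)\<^sup>2"
        using assms by (metis le_add_diff_inverse2 power_add)
      have "\<bar>a k\<bar> * 1 \<le> \<bar>a k\<bar> * (pi / 2)" using pi_ge_two by (intro mult_left_mono) auto
      also have "\<dots> = \<bar>cheb_moment P k\<bar>"
        by (subst cheb_moment_expansion[OF a]) (use k n in \<open>auto simp: abs_mult\<close>)
      also have "\<dots> \<le> c * M / real k ^ r" using k n by (intro c(2)[OF b]) auto
      also have "\<dots> = c * M * (1 / (real k ^ (r - 2)) * (1 / (real k)\<^sup>2))"
        unfolding kr by simp
      also have "\<dots> \<le> c * M * (real n powr (2 - real r) * (1 / (real k)\<^sup>2))"
      proof (intro mult_left_mono mult_right_mono)
        have "1 / real k ^ (r - 2) \<le> 1 / real n ^ (r - 2)"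
          using k n by (intro divide_left_mono power_mono mult_pos_pos zero_less_power) auto
        also have "\<dots> = real n powr (2 - real r)"
          using n assms by (simp add: powr_realpow[symmetric] powr_minus_divide[symmetric] of_nat_diff)
        finally show "1 / real k ^ (r - 2) \<le> real n powr (2 - real r)" .
      qed (use c(1) M0 in auto)
      finally show ?thesis by (simp add: mult.assoc)
    qed
    have "degree Q \<le> n" unfolding Q_def
      by (intro degree_sum_le) (auto intro!: order_trans[OF degree_smult_le] simp: degree_chebyshev)
    moreover have "\<bar>poly Q t - poly P t\<bar> \<le> 2 * c * M * real n powr (2 - real r)" if t: "t \<in> {-1..1}" for t
    proof -
      have "poly P t = poly Q t + (\<Sum>k\<in>{n<..m}. a k * poly (chebyshev_poly k) t)"
        using arg_cong[OF split, of "\<lambda>p. poly p t"] by (simp add: poly_sum)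
      then have "\<bar>poly Q t - poly P t\<bar> = \<bar>\<Sum>k\<in>{n<..m}. a k * poly (chebyshev_poly k) t\<bar>"
        by simp
      also have "\<dots> \<le> (\<Sum>k\<in>{n<..m}. \<bar>a k * poly (chebyshev_poly k) t\<bar>)" by (rule sum_abs)
      also have "\<dots> \<le> (\<Sum>k\<in>{n<..m}. c * M * real n powr (2 - real r) * (1 / (real k)\<^sup>2))"
      proof (intro sum_mono)
        fix k assume "k \<in> {n<..m}"
        then have "\<bar>a k\<bar> * \<bar>poly (chebyshev_poly k) t\<bar> \<le> (c * M * real n powr (2 - real r) * (1 / (real k)\<^sup>2)) * 1"
          using c(1) M0 by (intro mult_mono ak abs_poly_chebyshev_le_1[OF t]) auto
        then show "\<bar>a k * poly (chebyshev_poly k) t\<bar> \<le> c * M * real n powr (2 - real r) * (1 / (real k)\<^sup>2)"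
          by (simp add: abs_mult)
      qed
      also have "\<dots> = c * M * real n powr (2 - real r) * (\<Sum>k\<in>{n<..m}. 1 / (real k)\<^sup>2)"
        by (simp only: sum_distrib_left)
      also have "\<dots> \<le> c * M * real n powr (2 - real r) * 2"
        using c(1) M0 by (intro mult_left_mono sum_inverse_squares_le_2) auto
      finally show ?thesis by (simp add: mult_ac)
    qed
    ultimately show "\<exists>Q. degree Q \<le> n \<and>
      (\<forall>t\<in>{-1..1}. \<bar>poly Q t - poly P t\<bar> \<le> 2 * c * M * real n powr (2 - real r))" by blast
  qed
qed

section \<open>From polynomials to functions with finitely many derivatives\<close>

lemma weierstrass_poly:
  fixes g :: "real \<Rightarrow> real"
  assumes "continuous_on {a..b} g" "e > 0"
  shows "\<exists>P. \<forall>t\<in>{a..b}. \<bar>poly P t - g t\<bar> \<le> e"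
proof -
  obtain p where p: "real_polynomial_function p" "\<And>x. x \<in> {a..b} \<Longrightarrow> \<bar>g x - p x\<bar> < e"
    using Stone_Weierstrass_real_polynomial_function[OF _ assms] by auto
  from p(1) obtain c n where "p = (\<lambda>x. \<Sum>i\<le>n. c i * x ^ i)"
    unfolding real_polynomial_function_iff_sum by blast
  then have "poly (\<Sum>i\<le>n. monom (c i) i) = p" by (auto simp: poly_sum poly_monom)
  then show ?thesis
    using p(2) by (intro exI[of _ "\<Sum>i\<le>n. monom (c i) i"]) (force simp: abs_minus_commute)
qed

text \<open>Mean value inequality on an interval of length 2. It lifts approximation from a
  derivative to the function, and later compares exact with collocated integration.\<close>

lemma antiderivative_error_bound:
  fixes g h :: "real \<Rightarrow> real"
  assumes g: "\<And>t. t \<in> {-1..1} \<Longrightarrow> (g has_vector_derivative h t) (at t within {-1..1})"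
    and P: "\<And>t. t \<in> {-1..1} \<Longrightarrow> \<bar>poly (pderiv P) t - h t\<bar> \<le> e"
    and s: "s \<in> {-1..1}" and t: "t \<in> {-1..1}"
  shows "\<bar>(poly P t - g t) - (poly P s - g s)\<bar> \<le> 2 * e"
proof -
  have e0: "e \<ge> 0" using P[OF s] by linarith
  have "norm ((poly P t - g t) - (poly P s - g s)) \<le> e * norm (t - s)"
  proof (rule field_differentiable_bound[of "{-1..1}"])
    fix z :: real assume z: "z \<in> {-1..1}"
    show "((\<lambda>t. poly P t - g t) has_field_derivative (poly (pderiv P) z - h z)) (at z within {-1..1})"
      using g[OF z] by (intro derivative_intros DERIV_subset[OF poly_DERIV])
        (auto simp: has_real_derivative_iff_has_vector_derivative)
    show "norm (poly (pderiv P) z - h z) \<le> e" using P[OF z] by simp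
  qed (use s t in auto)
  also have "\<dots> \<le> e * 2" using s t e0 by (intro mult_left_mono) auto
  finally show ?thesis by simp
qed

text \<open>The highest derivative is approximated and then integrated back, each time from the
  exact value at 0. One integration at most doubles the error, hence \<open>e / 2\<close> in the
  induction.\<close>

lemma weierstrass_poly_derivatives:
  fixes d :: "nat \<Rightarrow> real \<Rightarrow> real"
  assumes "\<And>j t. j < r \<Longrightarrow> t \<in> {-1..1} \<Longrightarrow> (d j has_vector_derivative d (Suc j) t) (at t within {-1..1})"
    and "continuous_on {-1..1} (d r)" and "e > 0"
  shows "\<exists>P. \<forall>j\<le>r. \<forall>t\<in>{-1..1}. \<bar>poly ((pderiv ^^ j) P) t - d j t\<bar> \<le> e"
  using assms
proof (induction r arbitrary: d e)
  case 0
  then show ?case using weierstrass_poly[of "-1" 1 "d 0" e] by auto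
next
  case (Suc r)
  obtain Q where Q: "\<forall>j\<le>r. \<forall>t\<in>{-1..1}. \<bar>poly ((pderiv ^^ j) Q) t - d (Suc j) t\<bar> \<le> e / 2"
    using Suc.IH[of "\<lambda>j. d (Suc j)" "e / 2"] Suc.prems by auto
  obtain P where P: "pderiv P = Q" "poly P 0 = d 0 0" using poly_antiderivative_exists by blast
  have "\<bar>poly ((pderiv ^^ j) P) t - d j t\<bar> \<le> e" if "j \<le> Suc r" "t \<in> {-1..1}" for j t
  proof (cases j)
    case 0
    have "\<bar>(poly P t - d 0 t) - (poly P 0 - d 0 0)\<bar> \<le> 2 * (e / 2)"
      by (rule antiderivative_error_bound[where h = "d (Suc 0)"])
        (use Suc.prems(1)[of 0] Q[rule_format, of 0] P that in auto)
    then show ?thesis using 0 P by simp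
  next
    case (Suc i)
    then show ?thesis using Q[rule_format, of i t] that P(1) \<open>e > 0\<close> by (simp add: funpow_swap1)
  qed
  then show ?case by blast
qed

text \<open>Two powers of \<open>n\<close> are given away against Jackson's theorem; the final estimate has this slack.\<close>

lemma Ck_polynomial_approximation:
  fixes g :: "real \<Rightarrow> real"
  assumes g: "Ck_on r g" and r: "r \<ge> 2"
  shows "\<exists>c\<ge>0. \<forall>n\<ge>1. \<exists>Q. degree Q \<le> n \<and> (\<forall>t\<in>{-1..1}. \<bar>poly Q t - g t\<bar> \<le> c * real n powr (2 - real r))"
proof -
  obtain d where d: "d 0 = g"
    "\<And>j t. j < r \<Longrightarrow> t \<in> {-1..1} \<Longrightarrow> (d j has_vector_derivative d (Suc j) t) (at t within {-1..1})"
    "\<And>j. j \<le> r \<Longrightarrow> continuous_on {-1..1} (d j)"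
    using g unfolding Ck_on_def by blast
  have "\<exists>B. \<forall>t\<in>{-1..1}. \<bar>d j t\<bar> \<le> B" if "j \<le> r" for j
    using compact_imp_bounded[OF compact_continuous_image[OF d(3)[OF that] compact_Icc]]
    unfolding bounded_iff by (simp add: ball_simps)
  then obtain B where B: "\<And>j t. j \<le> r \<Longrightarrow> t \<in> {-1..1} \<Longrightarrow> \<bar>d j t\<bar> \<le> B j" by metis
  define M where "M = (\<Sum>j\<le>r. \<bar>B j\<bar>) + 1"
  have M: "\<bar>d j t\<bar> \<le> M - 1" if "j \<le> r" "t \<in> {-1..1}" for j t
  proof -
    have "\<bar>B j\<bar> \<le> (\<Sum>j\<le>r. \<bar>B j\<bar>)" using that by (intro member_le_sum) auto
    then show ?thesis using B[OF that] unfolding M_def by linarith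
  qed
  have M0: "M > 0" unfolding M_def by (smt (verit) sum_nonneg abs_ge_zero)
  obtain c where c: "c \<ge> 0" "\<And>P n. \<forall>j\<le>r. \<forall>t\<in>{-1..1}. \<bar>poly ((pderiv ^^ j) P) t\<bar> \<le> M \<Longrightarrow> n \<ge> 1 \<Longrightarrow>
     (\<exists>Q. degree Q \<le> n \<and> (\<forall>t\<in>{-1..1}. \<bar>poly Q t - poly P t\<bar> \<le> c * M * real n powr (2 - real r)))"
    using polynomial_truncation_error[OF r] by metis
  show ?thesis
  proof (intro exI[of _ "c * M + 1"] conjI allI impI)
    show "0 \<le> c * M + 1" using c(1) M0 by simp
    fix n :: nat assume n: "1 \<le> n"
    \<comment> \<open>\<open>e \<le> 1\<close> keeps the derivatives of \<open>P\<close> below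
      \<open>M\<close>, which was chosen before \<open>n\<close>; the other bound lets the
      Weierstrass error be absorbed in the rate. The degree of \<open>P\<close> may grow with
      \<open>n\<close> in any way.\<close>
    define e where "e = min 1 (real n powr (2 - real r))"
    have e: "e > 0" "e \<le> 1" "e \<le> real n powr (2 - real r)" using n unfolding e_def by auto
    obtain P where P: "\<forall>j\<le>r. \<forall>t\<in>{-1..1}. \<bar>poly ((pderiv ^^ j) P) t - d j t\<bar> \<le> e"
      using weierstrass_poly_derivatives[of r d e] d e by auto
    have "\<forall>j\<le>r. \<forall>t\<in>{-1..1}. \<bar>poly ((pderiv ^^ j) P) t\<bar> \<le> M"
    proof (intro allI impI ballI)
      fix j and t :: real assume "j \<le> r" "t \<in> {-1..1}"
      then show "\<bar>poly ((pderiv ^^ j) P) t\<bar> \<le> M" using P[rule_format, of j t] M[of j t] e(2) by linarith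
    qed
    then obtain Q where Q: "degree Q \<le> n"
      "\<forall>t\<in>{-1..1}. \<bar>poly Q t - poly P t\<bar> \<le> c * M * real n powr (2 - real r)"
      using c(2) n by blast
    have "\<bar>poly Q t - g t\<bar> \<le> (c * M + 1) * real n powr (2 - real r)" if "t \<in> {-1..1}" for t
    proof -
      have "\<bar>poly P t - g t\<bar> \<le> real n powr (2 - real r)"
        using P[rule_format, of 0 t] that e(3) d(1) by auto
      then show ?thesis using Q(2)[rule_format, OF that] by (simp add: algebra_simps)
    qed
    then show "\<exists>Q. degree Q \<le> n \<and> (\<forall>t\<in>{-1..1}. \<bar>poly Q t - g t\<bar> \<le> (c * M + 1) * real n powr (2 - real r))"
      using Q(1) by blast
  qed
qed

subsection \<open>Radau differentiation matrices\<close>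

lemma radau_nodes_strict_mono:
  assumes "radau_rule N tau w" "i < j" "j \<le> N"
  shows "tau i < tau j"
  using assms(2,3)
proof (induction j)
  case (Suc j)
  have step: "tau j < tau (Suc j)"
    using assms(1) Suc.prems unfolding radau_rule_def by (cases "j = 0") auto
  show ?case
  proof (cases "i = j")
    case True then show ?thesis using step by simp
  next
    case False
    then show ?thesis using Suc step by auto
  qed
qed simp

lemma radau_nodes_in_interval:
  assumes "radau_rule N tau w" "i \<le> N"
  shows "tau i \<in> {-1..1}"
proof -
  have "tau 0 = -1" "tau N = 1" using assms(1) unfolding radau_rule_def by auto
  moreover have "tau 0 \<le> tau i" using radau_nodes_strict_mono[OF assms(1), of 0 i] assms(2) by (cases "i = 0") auto
  moreover have "tau i \<le> tau N" using radau_nodes_strict_mono[OF assms(1), of i N] assms(2) by (cases "i = N") auto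
  ultimately show ?thesis by auto
qed

definition lagrange_poly :: "(nat \<Rightarrow> real) \<Rightarrow> nat \<Rightarrow> nat \<Rightarrow> real poly" where
  "lagrange_poly tau N j = (\<Prod>i\<in>{0..N} - {j}. smult (1 / (tau j - tau i)) [:- tau i, 1:])"

lemma poly_lagrange_poly: "poly (lagrange_poly tau N j) = lagrange_basis tau N j"
  by (rule ext) (simp add: lagrange_poly_def lagrange_basis_def poly_prod diff_divide_distrib[symmetric] algebra_simps)

lemma Dmat_eq_pderiv: "Dmat tau N i j = poly (pderiv (lagrange_poly tau N j)) (tau i)"
  unfolding Dmat_def poly_lagrange_poly[symmetric] by (rule DERIV_imp_deriv[OF poly_DERIV])

lemma degree_lagrange_poly:
  assumes "j \<le> N"
  shows "degree (lagrange_poly tau N j) \<le> N"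
proof -
  have "degree (lagrange_poly tau N j) \<le> (\<Sum>i\<in>{0..N} - {j}. degree (smult (1 / (tau j - tau i)) [:- tau i, 1:]))"
    unfolding lagrange_poly_def by (intro degree_prod_sum_le[unfolded o_def]) simp
  also have "\<dots> \<le> (\<Sum>i\<in>{0..N} - {j}. 1)" by (intro sum_mono order_trans[OF degree_smult_le]) simp
  also have "\<dots> = N" using assms by simp
  finally show ?thesis .
qed

lemma lagrange_poly_at_node:
  assumes "radau_rule N tau w" "i \<le> N" "j \<le> N"
  shows "poly (lagrange_poly tau N j) (tau i) = (if i = j then 1 else 0)"
proof -
  have ne: "tau j \<noteq> tau k" if "k \<in> {0..N} - {j}" for k
    using radau_nodes_strict_mono[OF assms(1), of j k] radau_nodes_strict_mono[OF assms(1), of k j] that assms(3)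
    by (metis DiffD1 DiffD2 atLeastAtMost_iff insertI1 less_irrefl linorder_neqE_nat)
  show ?thesis
    unfolding poly_lagrange_poly lagrange_basis_def
    using ne assms(2) by (auto intro!: prod.neutral prod_zero)
qed

text \<open>The difference would have the N + 1 distinct nodes, -1 included, as roots while its
  degree is at most N.\<close>

lemma lagrange_interpolation:
  assumes "radau_rule N tau w" "degree p \<le> N"
  shows "(\<Sum>j=0..N. smult (poly p (tau j)) (lagrange_poly tau N j)) = p"
proof (rule ccontr)
  define q where "q = (\<Sum>j=0..N. smult (poly p (tau j)) (lagrange_poly tau N j)) - p"
  assume "(\<Sum>j=0..N. smult (poly p (tau j)) (lagrange_poly tau N j)) \<noteq> p"
  then have q0: "q \<noteq> 0" unfolding q_def by simp
  have "poly q (tau i) = 0" if "i \<in> {0..N}" for i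
  proof -
    have "(\<Sum>j=0..N. poly p (tau j) * poly (lagrange_poly tau N j) (tau i)) =
      (\<Sum>j=0..N. if j = i then poly p (tau i) else 0)"
      using that by (intro sum.cong) (auto simp: lagrange_poly_at_node[OF assms(1)])
    then show ?thesis using that unfolding q_def by (simp add: poly_sum)
  qed
  then have sub: "tau ` {0..N} \<subseteq> {x. poly q x = 0}" by auto
  have "inj_on tau {0..N}"
  proof (rule inj_onI)
    fix i j assume "i \<in> {0..N}" "j \<in> {0..N}" "tau i = tau j"
    then show "i = j"
      using radau_nodes_strict_mono[OF assms(1), of i j] radau_nodes_strict_mono[OF assms(1), of j i]
      by (cases i j rule: linorder_cases) auto
  qed
  then have "Suc N = card (tau ` {0..N})" by (simp add: card_image)
  also have "\<dots> \<le> card {x. poly q x = 0}" by (intro card_mono sub poly_roots_finite q0)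
  also have "\<dots> \<le> degree q" by (rule card_poly_roots_bound[OF q0])
  also have "\<dots> \<le> N" unfolding q_def using assms(2) degree_lagrange_poly
    by (intro degree_diff_le degree_sum_le order_trans[OF degree_smult_le]) auto
  finally show False by simp
qed

lemma Dmat_differentiates:
  assumes "radau_rule N tau w" "degree p \<le> N"
  shows "(\<Sum>j=0..N. Dmat tau N i j * poly p (tau j)) = poly (pderiv p) (tau i)"
proof -
  have "pderiv p = (\<Sum>j=0..N. smult (poly p (tau j)) (pderiv (lagrange_poly tau N j)))"
    using arg_cong[OF lagrange_interpolation[OF assms], of pderiv]
      higher_pderiv_sum[of 1 "\<lambda>j. smult (poly p (tau j)) (lagrange_poly tau N j)" "{0..N}"]
    by (simp add: pderiv_smult)
  then show ?thesis by (simp add: poly_sum Dmat_eq_pderiv mult.commute)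
qed

text \<open>Subtracting the value at -1 removes column 0 and leaves the square block whose inverse
  (P1) provides.\<close>

lemma Dmat_differentiates':
  assumes "radau_rule N tau w" "degree p \<le> N"
  shows "(\<Sum>j=1..N. Dmat tau N i j * (poly p (tau j) - poly p (-1))) = poly (pderiv p) (tau i)"
proof -
  have t0: "tau 0 = -1" using assms(1) unfolding radau_rule_def by auto
  have "(\<Sum>j=0..N. Dmat tau N i j * poly (p - [:poly p (-1):]) (tau j)) = poly (pderiv (p - [:poly p (-1):])) (tau i)"
    by (rule Dmat_differentiates[OF assms(1)]) (use assms(2) in \<open>auto intro!: degree_diff_le\<close>)
  moreover have "(\<Sum>j=0..N. Dmat tau N i j * poly (p - [:poly p (-1):]) (tau j)) =
     (\<Sum>j=1..N. Dmat tau N i j * (poly p (tau j) - poly p (-1)))"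
    by (simp add: sum.atLeast_Suc_atMost[of 0 N] t0)
  ultimately show ?thesis by (simp add: pderiv_diff pderiv_pCons)
qed

lemma Dmat_row_sum:
  assumes "radau_rule N tau w"
  shows "(\<Sum>j=0..N. Dmat tau N i j) = 0"
  using Dmat_differentiates[OF assms, of 1 i] by (simp add: pderiv_1)

lemma integral_pderiv: "integral {-1..1} (poly (pderiv p)) = poly p 1 - poly p (-1::real)"
proof (rule integral_unique, rule fundamental_theorem_of_calculus)
  fix x :: real
  show "(poly p has_vector_derivative poly (pderiv p) x) (at x within {-1..1})"
    using poly_DERIV[of p x] unfolding has_real_derivative_iff_has_vector_derivative
    by (rule has_vector_derivative_at_within)
qed simp

lemma radau_quadrature_pderiv:
  assumes "radau_rule N tau w" "degree p \<le> 2 * N - 1"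
  shows "(\<Sum>i=1..N. w i * poly (pderiv p) (tau i)) = poly p 1 - poly p (-1)"
proof -
  have "degree (pderiv p) \<le> 2 * N - 2" using assms(2) by (simp add: degree_pderiv)
  then show ?thesis using assms(1) unfolding radau_rule_def integral_pderiv[symmetric] by blast
qed

lemma radau_weights_sum:
  assumes "radau_rule N tau w"
  shows "(\<Sum>i=1..N. w i) = 2"
proof -
  have "(\<Sum>i=1..N. w i * poly (1 :: real poly) (tau i)) = integral {-1..1} (poly (1 :: real poly))"
    using assms unfolding radau_rule_def by (metis degree_1 zero_le)
  moreover have "poly (1 :: real poly) = (\<lambda>_. 1)" by auto
  ultimately show ?thesis by simp
qed

text \<open>Exactness of the quadrature in degree \<open>2N - 2\<close> is summation by parts:
  \<open>Dddag\<close> differentiates polynomials of degree below \<open>N\<close>, up to a boundary term at \<open>+1\<close>.\<close>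

lemma Dddag_differentiates:
  assumes R: "radau_rule N tau w" and p: "degree p \<le> N - 1" and i: "i \<in> {1..N}" and N: "N \<ge> 2"
  shows "(\<Sum>j=1..N. Dddag tau w N i j * poly p (tau j)) =
    poly (pderiv p) (tau i) - (if i = N then poly p 1 / w N else 0)"
proof -
  let ?L = "lagrange_poly tau N i"
  have wi: "w i > 0" and t0: "tau 0 = -1" and tN: "tau N = 1" using R i unfolding radau_rule_def by auto
  \<comment> \<open>The degrees N and N - 1 add up to exactly what the rule can integrate after one
    differentiation. This is why \<open>p\<close> must have degree below N here, one less than for
    \<open>Dmat\<close>.\<close>
  have "degree (?L * p) \<le> 2 * N - 1"
    using order_trans[OF degree_mult_le add_mono[OF degree_lagrange_poly[of i N tau] p]] i N by auto
  from radau_quadrature_pderiv[OF R this]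
  have "(\<Sum>j=1..N. w j * (poly (pderiv ?L) (tau j) * poly p (tau j) + poly ?L (tau j) * poly (pderiv p) (tau j)))
    = poly ?L 1 * poly p 1 - poly ?L (-1) * poly p (-1)"
    by (simp add: pderiv_mult algebra_simps)
  moreover have "poly ?L (-1) = 0"
    using lagrange_poly_at_node[OF R, of 0 i] i t0 by auto
  moreover have "poly ?L 1 = (if i = N then 1 else 0)"
    using lagrange_poly_at_node[OF R, of N i] i tN by auto
  moreover have "(\<Sum>j=1..N. w j * (poly ?L (tau j) * poly (pderiv p) (tau j))) = w i * poly (pderiv p) (tau i)"
  proof -
    have "(\<Sum>j=1..N. w j * (poly ?L (tau j) * poly (pderiv p) (tau j))) =
      (\<Sum>j=1..N. if j = i then w i * poly (pderiv p) (tau i) else 0)"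
      using i by (intro sum.cong) (auto simp: lagrange_poly_at_node[OF R])
    then show ?thesis using i by simp
  qed
  ultimately have S: "(\<Sum>j=1..N. w j * (Dmat tau N j i * poly p (tau j))) =
      (if i = N then poly p 1 else 0) - w i * poly (pderiv p) (tau i)"
    unfolding Dmat_eq_pderiv by (auto simp: distrib_left sum.distrib)
  have "(\<Sum>j=1..N. Dddag tau w N i j * poly p (tau j)) = - (1 / w i) * (\<Sum>j=1..N. w j * (Dmat tau N j i * poly p (tau j)))"
    unfolding Dddag_def sum_distrib_left by (intro sum.cong) auto
  also have "\<dots> = poly (pderiv p) (tau i) - (if i = N then poly p 1 / w N else 0)"
    unfolding S using wi by (auto simp: field_simps)
  finally show ?thesis .
qed

lemma Dddag_row_sum:
  assumes "radau_rule N tau w" "i \<in> {1..N}" "N \<ge> 2"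
  shows "(\<Sum>j=1..N. Dddag tau w N i j) = (if i = N then - 1 / w N else 0)"
  using Dddag_differentiates[OF assms(1) _ assms(2,3), of 1] by (simp add: pderiv_1)

section \<open>Inverse matrices and their weighted row norms\<close>

lemma is_inverse_on_solve:
  fixes x y :: "nat \<Rightarrow> 'a::real_vector"
  assumes "is_inverse_on N A B" "\<And>i. i \<in> {1..N} \<Longrightarrow> (\<Sum>j=1..N. A i j *\<^sub>R x j) = y i" "i \<in> {1..N}"
  shows "(\<Sum>j=1..N. B i j *\<^sub>R y j) = x i"
proof -
  have "(\<Sum>j=1..N. B i j *\<^sub>R y j) = (\<Sum>j=1..N. \<Sum>k=1..N. (B i j * A j k) *\<^sub>R x k)"
    using assms(2)[symmetric] by (intro sum.cong) (simp_all add: scaleR_sum_right)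
  also have "\<dots> = (\<Sum>k=1..N. (\<Sum>j=1..N. B i j * A j k) *\<^sub>R x k)"
    by (subst sum.swap) (simp add: scaleR_sum_left)
  also have "\<dots> = (\<Sum>k=1..N. if k = i then x i else 0)"
    using assms(1,3) unfolding is_inverse_on_def by (intro sum.cong) auto
  finally show ?thesis using assms(3) by simp
qed

lemma is_inverse_on_sym: "is_inverse_on N A B \<Longrightarrow> is_inverse_on N B A"
  unfolding is_inverse_on_def by blast

text \<open>(P1), (P2) and likewise (P3), (P4) come with separate existential witnesses; uniqueness
  allows both bounds to be used for one matrix.\<close>

lemma is_inverse_on_unique:
  assumes "is_inverse_on N A B" "is_inverse_on N A B'" "i \<in> {1..N}" "j \<in> {1..N}"
  shows "B i j = B' i j"
proof -
  have "(\<Sum>k=1..N. A m k *\<^sub>R B' k j) = (if m = j then 1 else 0)" if "m \<in> {1..N}" for m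
    using assms(2,4) that unfolding is_inverse_on_def by auto
  from is_inverse_on_solve[OF assms(1) this assms(3)] have "(\<Sum>k=1..N. B i k * (if k = j then 1 else 0)) = B' i j"
    by simp
  moreover have "(\<Sum>k=1..N. B i k * (if k = j then 1 else 0)) = (\<Sum>k=1..N. if k = j then B i j else 0)"
    by (intro sum.cong) auto
  ultimately show ?thesis using assms(4) by simp
qed

text \<open>The inverse of W^(1/2) A is A^(-1) W^(-1/2), so
  \<open>E i j = B i j * sqrt (w j)\<close>, and Cauchy-Schwarz in each row gives the bound by the
  weighted norm of \<open>v\<close>.\<close>

lemma sum_inverse_row_le:
  assumes E: "is_inverse_on N A E" and B: "is_inverse_on N (\<lambda>i j. sqrt (w i) * A i j) B"
    and row: "\<forall>i\<in>{1..N}. sqrt (\<Sum>j=1..N. (B i j)\<^sup>2) \<le> sqrt 2"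
    and w: "\<And>i. i \<in> {1..N} \<Longrightarrow> 0 < w i" and i: "i \<in> {1..N}"
  shows "(\<Sum>j=1..N. \<bar>E i j\<bar> * v j) \<le> sqrt 2 * sqrt (\<Sum>j=1..N. w j * (v j)\<^sup>2)"
proof -
  have "is_inverse_on N A (\<lambda>i j. B i j * sqrt (w j))"
    unfolding is_inverse_on_def
  proof (intro conjI ballI)
    fix i j assume ij: "i \<in> {1..N}" "j \<in> {1..N}"
    have "(\<Sum>k=1..N. B i k * sqrt (w k) * A k j) = (\<Sum>k=1..N. B i k * (sqrt (w k) * A k j))"
      by (simp add: mult.assoc)
    then show "(\<Sum>k=1..N. B i k * sqrt (w k) * A k j) = (if i = j then 1 else 0)"
      using B ij unfolding is_inverse_on_def by auto
    have "sqrt (w i) * (\<Sum>k=1..N. A i k * (B k j * sqrt (w j))) = (\<Sum>k=1..N. sqrt (w i) * A i k * B k j) * sqrt (w j)"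
      by (simp add: sum_distrib_left sum_distrib_right mult_ac)
    also have "\<dots> = (if i = j then 1 else 0) * sqrt (w j)"
      using B ij unfolding is_inverse_on_def by auto
    finally show "(\<Sum>k=1..N. A i k * (B k j * sqrt (w j))) = (if i = j then 1 else 0)"
      using w[OF ij(1)] by (auto split: if_splits)
  qed
  note eq = is_inverse_on_unique[OF E this i]
  have "(\<Sum>j=1..N. \<bar>E i j\<bar> * v j) = (\<Sum>j=1..N. \<bar>B i j\<bar> * (sqrt (w j) * v j))"
    using eq w by (intro sum.cong) (auto simp: abs_mult less_imp_le)
  also have "\<dots> \<le> sqrt ((\<Sum>j=1..N. \<bar>B i j\<bar>\<^sup>2) * (\<Sum>j=1..N. (sqrt (w j) * v j)\<^sup>2))"
    using Cauchy_Schwarz_ineq_sum[of "\<lambda>j. \<bar>B i j\<bar>" "\<lambda>j. sqrt (w j) * v j" "{1..N}"]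
    by (rule real_le_rsqrt)
  also have "(\<Sum>j=1..N. (sqrt (w j) * v j)\<^sup>2) = (\<Sum>j=1..N. w j * (v j)\<^sup>2)"
    using w by (intro sum.cong) (auto simp: power_mult_distrib less_imp_le)
  also have "sqrt ((\<Sum>j=1..N. \<bar>B i j\<bar>\<^sup>2) * (\<Sum>j=1..N. w j * (v j)\<^sup>2)) =
      sqrt (\<Sum>j=1..N. (B i j)\<^sup>2) * sqrt (\<Sum>j=1..N. w j * (v j)\<^sup>2)"
    by (simp add: real_sqrt_mult)
  also have "\<dots> \<le> sqrt 2 * sqrt (\<Sum>j=1..N. w j * (v j)\<^sup>2)"
    using row i w by (intro mult_right_mono) (auto intro!: sum_nonneg simp: less_imp_le)
  finally show ?thesis .
qed

lemma inf_norm_on_row: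
  assumes "inf_norm_on N B \<le> b" "i \<in> {1..N}"
  shows "(\<Sum>j=1..N. \<bar>B i j\<bar>) \<le> b"
  using assms unfolding inf_norm_on_def by (auto simp: Max_le_iff)

section \<open>Consistency: exact versus collocated integration\<close>

context
  fixes N :: nat and tau w :: "nat \<Rightarrow> real" and G g :: "real \<Rightarrow> real" and s :: "real poly" and e :: real
  assumes R: "radau_rule N tau w" and N: "N \<ge> 2"
    and G: "\<And>t. t \<in> {-1..1} \<Longrightarrow> (G has_vector_derivative g t) (at t within {-1..1})"
    and deg: "degree s \<le> N - 2" and s: "\<And>t. t \<in> {-1..1} \<Longrightarrow> \<bar>poly s t - g t\<bar> \<le> e"
begin

text \<open>Replacing \<open>g\<close> by its approximant costs only the absolute row sum 2. Since
  no interpolation operator is involved, the factor does not grow with \<open>N\<close>.\<close>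

lemma sum_node_error:
  assumes "(\<Sum>j=1..N. \<bar>b j\<bar>) \<le> 2"
  shows "\<bar>(\<Sum>j=1..N. b j * poly s (tau j)) - (\<Sum>j=1..N. b j * g (tau j))\<bar> \<le> 2 * e"
proof -
  have e: "e \<ge> 0" using s[of 0] by auto
  have "\<bar>(\<Sum>j=1..N. b j * poly s (tau j)) - (\<Sum>j=1..N. b j * g (tau j))\<bar>
      = \<bar>\<Sum>j=1..N. b j * (poly s (tau j) - g (tau j))\<bar>"
    by (simp add: right_diff_distrib sum_subtractf)
  also have "\<dots> \<le> (\<Sum>j=1..N. \<bar>b j\<bar> * \<bar>poly s (tau j) - g (tau j)\<bar>)"
    by (rule order_trans[OF sum_abs]) (simp add: abs_mult)
  also have "\<dots> \<le> (\<Sum>j=1..N. \<bar>b j\<bar> * e)"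
    by (intro sum_mono mult_left_mono s radau_nodes_in_interval[OF R]) auto
  also have "\<dots> \<le> 2 * e" using assms e by (simp add: sum_distrib_right[symmetric] mult_right_mono)
  finally show ?thesis .
qed

text \<open>\<open>E\<close> integrates \<open>s\<close> exactly from -1. One half of the error
  \<open>4 * e\<close> comes from the antiderivatives, the other from the node values.\<close>

lemma state_consistency:
  assumes E: "is_inverse_on N (\<lambda>i j. Dmat tau N i j) E" "inf_norm_on N E \<le> 2" and i: "i \<in> {1..N}"
  shows "\<bar>G (tau i) - G (-1) - (\<Sum>j=1..N. E i j * g (tau j))\<bar> \<le> 4 * e"
proof -
  obtain p where p: "pderiv p = s" "poly p (-1) = G (-1)" "degree p \<le> Suc (degree s)"
    using poly_antiderivative_exists by blast
  have "degree p \<le> N" using p(3) deg N by simp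
  from Dmat_differentiates'[OF R this]
  have "(\<Sum>j=1..N. Dmat tau N k j *\<^sub>R (poly p (tau j) - poly p (-1))) = poly s (tau k)" for k
    using p(1) by simp
  from is_inverse_on_solve[OF E(1) this i]
  have "(\<Sum>j=1..N. E i j * poly s (tau j)) = poly p (tau i) - G (-1)" using p(2) by simp
  moreover have "\<bar>(poly p (tau i) - G (tau i)) - (poly p (-1) - G (-1))\<bar> \<le> 2 * e"
    using radau_nodes_in_interval[OF R] i by (intro antiderivative_error_bound[OF G]) (auto simp: p(1) s)
  moreover note sum_node_error[OF inf_norm_on_row[OF E(2) i]]
  ultimately show ?thesis using p(2) by linarith
qed

text \<open>The antiderivative is normalized to vanish at +1, so the boundary term of
  \<open>Dddag_differentiates\<close> drops out. Its degree must not exceed N - 1, which dictates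
  \<open>degree s \<le> N - 2\<close>.\<close>

lemma costate_consistency:
  assumes E: "is_inverse_on N (\<lambda>i j. Dddag tau w N i j) E" "inf_norm_on N E \<le> 2" and i: "i \<in> {1..N}"
  shows "\<bar>G (tau i) - G 1 - (\<Sum>j=1..N. E i j * g (tau j))\<bar> \<le> 4 * e"
proof -
  obtain p where p: "pderiv p = s" "poly p 1 = 0" "degree p \<le> Suc (degree s)"
    using poly_antiderivative_exists by blast
  have "degree p \<le> N - 1" using p(3) deg N by simp
  from Dddag_differentiates[OF R this _ N]
  have "(\<Sum>j=1..N. Dddag tau w N k j *\<^sub>R poly p (tau j)) = poly s (tau k)" if "k \<in> {1..N}" for k
    using p(1,2) that by simp
  from is_inverse_on_solve[OF E(1) this i]
  have "(\<Sum>j=1..N. E i j * poly s (tau j)) = poly p (tau i)" by simp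
  moreover have "\<bar>(poly p (tau i) - G (tau i)) - (poly p 1 - G 1)\<bar> \<le> 2 * e"
    using radau_nodes_in_interval[OF R] i by (intro antiderivative_error_bound[OF G]) (auto simp: p(1) s)
  moreover note sum_node_error[OF inf_norm_on_row[OF E(2) i]]
  ultimately show ?thesis using p(2) by linarith
qed

text \<open>The positive weights, with sum 2, play the part of a matrix row. This serves the
  equation for the initial costate.\<close>

lemma quadrature_consistency: "\<bar>G 1 - G (-1) - (\<Sum>j=1..N. w j * g (tau j))\<bar> \<le> 4 * e"
proof -
  obtain p where p: "pderiv p = s" "poly p 1 = 0" "degree p \<le> Suc (degree s)"
    using poly_antiderivative_exists by blast
  have "degree p \<le> 2 * N - 1" using p(3) deg N by simp
  from radau_quadrature_pderiv[OF R this]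
  have "(\<Sum>j=1..N. w j * poly s (tau j)) = poly p 1 - poly p (-1)" by (simp add: p(1))
  moreover have "\<bar>(poly p 1 - G 1) - (poly p (-1) - G (-1))\<bar> \<le> 2 * e"
    by (intro antiderivative_error_bound[OF G]) (auto simp: p(1) s)
  moreover have "(\<Sum>j=1..N. \<bar>w j\<bar>) = (\<Sum>j=1..N. w j)"
    using R unfolding radau_rule_def by (intro sum.cong refl) (metis abs_of_pos)
  then have "\<bar>(\<Sum>j=1..N. w j * poly s (tau j)) - (\<Sum>j=1..N. w j * g (tau j))\<bar> \<le> 2 * e"
    using radau_weights_sum[OF R] by (intro sum_node_error) simp
  ultimately show ?thesis by linarith
qed

end

subsection \<open>Stability of the linearized discrete system\<close>

lemma abs_sum_scaleR_component_le:
  fixes v :: "nat \<Rightarrow> real^'k"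
  assumes "\<And>j. j \<in> I \<Longrightarrow> \<bar>v j $ k\<bar> \<le> b j"
  shows "\<bar>(\<Sum>j\<in>I. a j *\<^sub>R v j) $ k\<bar> \<le> (\<Sum>j\<in>I. \<bar>a j\<bar> * b j)"
proof -
  have "\<bar>(\<Sum>j\<in>I. a j *\<^sub>R v j) $ k\<bar> \<le> (\<Sum>j\<in>I. \<bar>a j * v j $ k\<bar>)"
    by (simp add: sum_abs)
  also have "\<dots> \<le> (\<Sum>j\<in>I. \<bar>a j\<bar> * b j)"
    by (intro sum_mono) (simp add: abs_mult mult_left_mono assms)
  finally show ?thesis .
qed

text \<open>At a component of maximal modulus the coupling term is at most half that modulus.\<close>

lemma fixed_point_component_bound:
  fixes v :: "nat \<Rightarrow> real^'k"
  assumes eq: "\<And>i. i \<in> {1..N} \<Longrightarrow> v i = q i + (\<Sum>j=1..N. E i j *\<^sub>R (M j (v j) + r j))"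
    and E1: "\<And>i. i \<in> {1..N} \<Longrightarrow> (\<Sum>j=1..N. \<bar>E i j\<bar>) \<le> 2"
    and M: "\<And>j y b k. j \<in> {1..N} \<Longrightarrow> (\<And>l. \<bar>y $ l\<bar> \<le> b) \<Longrightarrow> \<bar>M j y $ k\<bar> \<le> b / 4"
    and q: "\<And>i k. i \<in> {1..N} \<Longrightarrow> \<bar>q i $ k\<bar> \<le> a"
    and r: "\<And>i k. i \<in> {1..N} \<Longrightarrow> \<bar>(\<Sum>j=1..N. E i j *\<^sub>R r j) $ k\<bar> \<le> b"
    and i: "i \<in> {1..N}"
  shows "\<bar>v i $ k\<bar> \<le> 2 * (a + b)"
proof -
  define S where "S = (\<lambda>(i, k). \<bar>v i $ k\<bar>) ` ({1..N} \<times> UNIV)"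
  define m where "m = Max S"
  have fin: "finite S" "S \<noteq> {}" using i unfolding S_def by auto
  have le: "\<bar>v j $ l\<bar> \<le> m" if "j \<in> {1..N}" for j l
    unfolding m_def using fin that by (intro Max_ge) (auto simp: S_def)
  have "m \<in> S" unfolding m_def using fin by (rule Max_in)
  then obtain j l where jl: "j \<in> {1..N}" "m = \<bar>v j $ l\<bar>" unfolding S_def by auto
  have m0: "m \<ge> 0" using jl by simp
  have "v j $ l = q j $ l + (\<Sum>n=1..N. E j n *\<^sub>R M n (v n)) $ l + (\<Sum>n=1..N. E j n *\<^sub>R r n) $ l"
    by (subst eq[OF jl(1)]) (simp add: scaleR_add_right sum.distrib algebra_simps)
  moreover have "\<bar>(\<Sum>n=1..N. E j n *\<^sub>R M n (v n)) $ l\<bar> \<le> (\<Sum>n=1..N. \<bar>E j n\<bar> * (m / 4))"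
    by (intro abs_sum_scaleR_component_le M le) auto
  moreover have "(\<Sum>n=1..N. \<bar>E j n\<bar> * (m / 4)) \<le> 2 * (m / 4)"
    unfolding sum_distrib_right[symmetric] using m0 by (intro mult_right_mono E1 jl) auto
  moreover note q[OF jl(1), of l] r[OF jl(1), of l]
  ultimately have "m \<le> a + m / 2 + b" using jl(2) by linarith
  then have "m \<le> 2 * (a + b)" by (simp add: field_simps)
  then show ?thesis using order_trans[OF le[OF i]] by blast
qed

lemma norm_le_card_component:
  fixes v :: "real^'k"
  assumes "\<And>k. \<bar>v $ k\<bar> \<le> b"
  shows "norm v \<le> real CARD('k) * b"
  using order_trans[OF norm_le_l1_cart sum_bounded_above[of UNIV "\<lambda>i. \<bar>v $ i\<bar>" b]] assms by auto

text \<open>If \<open>y\<close> exceeded the bound it would exceed \<open>P\<close>, so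
  \<open>c * P\<close> could be replaced by \<open>c * y\<close> and one factor \<open>y\<close>
  cancelled.\<close>

lemma quadratic_inequality_bound:
  fixes y P a b c :: real
  assumes "a > 0" "b \<ge> 0" "c \<ge> 0" "P \<ge> 0" "a * y\<^sup>2 \<le> P * (b * y + c * P)" "y \<ge> 0"
  shows "y \<le> ((b + c) / a + 1) * P"
proof (rule ccontr)
  assume "\<not> ?thesis"
  then have y: "((b + c) / a + 1) * P < y" by simp
  have "P \<le> y"
  proof -
    have "0 \<le> (b + c) / a * P" using assms by auto
    then show ?thesis using y by (simp add: algebra_simps)
  qed
  have "P * (b * y + c * P) \<le> P * (b * y + c * y)"
    using assms \<open>P \<le> y\<close> by (intro mult_left_mono add_mono) auto
  then have "a * y\<^sup>2 \<le> P * (b + c) * y" using assms(5) by (simp add: algebra_simps)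
  moreover have "y > 0" using y \<open>P \<le> y\<close> assms
    by (metis add_nonneg_nonneg divide_nonneg_pos le_less_trans mult_nonneg_nonneg zero_le_one)
  ultimately have "a * y \<le> P * (b + c)" by (simp add: power2_eq_square)
  then have "y \<le> (b + c) / a * P" using assms(1) by (simp add: field_simps)
  then show False using y assms(4) by (simp add: algebra_simps)
qed

text \<open>As \<open>w i * D i j = - w j * D' j i\<close>, exchanging the sums moves the matrix to
  the other factor. For the Radau matrices the boundary term at +1 sits in the last row of
  \<open>D'\<close>.\<close>

lemma weighted_summation_by_parts:
  fixes a c :: "nat \<Rightarrow> 'a::real_inner"
  assumes w: "\<And>i. i \<in> {1..N} \<Longrightarrow> 0 < w i"
    and D': "\<And>i j. i \<in> {1..N} \<Longrightarrow> j \<in> {1..N} \<Longrightarrow> D' i j = - (w j / w i) * D j i"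
  shows "(\<Sum>i=1..N. w i * (a i \<bullet> (\<Sum>j=1..N. D i j *\<^sub>R c j))) =
    (\<Sum>j=1..N. - w j * ((\<Sum>i=1..N. D' j i *\<^sub>R a i) \<bullet> c j))"
proof -
  have "(\<Sum>i=1..N. w i * (a i \<bullet> (\<Sum>j=1..N. D i j *\<^sub>R c j))) = (\<Sum>i=1..N. \<Sum>j=1..N. w i * D i j * (a i \<bullet> c j))"
    by (simp add: inner_sum_right sum_distrib_left mult.assoc)
  also have "\<dots> = (\<Sum>j=1..N. \<Sum>i=1..N. w i * D i j * (a i \<bullet> c j))" by (rule sum.swap)
  also have "\<dots> = (\<Sum>j=1..N. - w j * ((\<Sum>i=1..N. D' j i *\<^sub>R a i) \<bullet> c j))"
  proof (intro sum.cong refl)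
    fix j assume j: "j \<in> {1..N}"
    have "(\<Sum>i=1..N. w i * D i j * (a i \<bullet> c j)) = (\<Sum>i=1..N. - w j * (D' j i * (a i \<bullet> c j)))"
    proof (intro sum.cong refl)
      fix i assume "i \<in> {1..N}"
      have "- w j * D' j i = w i * D i j" using D'[OF j \<open>i \<in> {1..N}\<close>] w[OF j] by simp
      then show "w i * D i j * (a i \<bullet> c j) = - w j * (D' j i * (a i \<bullet> c j))"
        by (metis mult.assoc)
    qed
    then show "(\<Sum>i=1..N. w i * D i j * (a i \<bullet> c j)) = - w j * ((\<Sum>i=1..N. D' j i *\<^sub>R a i) \<bullet> c j)"
      by (simp add: inner_sum_left sum_distrib_left)
  qed
  finally show ?thesis .
qed

text \<open>Collects the coefficients met in \<open>energy_bound\<close>: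
  \<open>2 + 5 * b + 8 * b\<^sup>2 * n\<close> stands before \<open>ynorm\<close> and
  \<open>4 * b * n\<close> before \<open>P\<close>. Dividing by \<open>\<alpha> / 2\<close> and
  adding 1 follows \<open>quadratic_inequality_bound\<close>.\<close>

definition energy_const :: "real \<Rightarrow> real \<Rightarrow> real \<Rightarrow> real" where
  "energy_const n b \<alpha> = (2 + 5 * b + 8 * b\<^sup>2 * n + 4 * b * n) / (\<alpha> / 2) + 1"

text \<open>The factor 2 is the price of absorbing the coupling term, \<open>n\<close> passes from
  components to the norm, and the summand with \<open>energy_const\<close> is the part driven by
  \<open>(x, u)\<close>.\<close>

definition state_const :: "real \<Rightarrow> real \<Rightarrow> real \<Rightarrow> real" where
  "state_const n b \<alpha> = n * (2 * (1 + 2 * b * energy_const n b \<alpha>))"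

definition control_const :: "real \<Rightarrow> real \<Rightarrow> real \<Rightarrow> real" where
  "control_const n b \<alpha> = (1 + 2 * b * state_const n b \<alpha>) / \<alpha>"

lemma stability_consts_nonneg:
  assumes "n \<ge> 0" "b \<ge> 0" "\<alpha> > 0"
  shows "energy_const n b \<alpha> \<ge> 0" "state_const n b \<alpha> \<ge> 0" "control_const n b \<alpha> \<ge> 0"
proof -
  show 1: "energy_const n b \<alpha> \<ge> 0" unfolding energy_const_def using assms by auto
  show 2: "state_const n b \<alpha> \<ge> 0" unfolding state_const_def using assms 1 by auto
  show "control_const n b \<alpha> \<ge> 0" unfolding control_const_def using assms 2 by auto
qed

lemma norm_fst_le_norm: "norm (fst z) \<le> norm z"
  by (metis norm_fst_le prod.collapse)

lemma norm_snd_le_norm: "norm (snd z) \<le> norm z"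
  by (metis norm_snd_le prod.collapse)

lemma sqrt_2_le_2: "sqrt 2 \<le> 2"
  by (rule real_le_lsqrt) auto

section \<open>A priori bounds for one solution of the linearized system with right-hand sides
  \<open>p\<close>, \<open>s\<close>, \<open>r\<close>\<close>

context
  fixes N :: nat and w :: "nat \<Rightarrow> real" and D D' E E' :: "nat \<Rightarrow> nat \<Rightarrow> real"
    and J :: "nat \<Rightarrow> (real^'n) \<times> (real^'m) \<Rightarrow> real^'n"
    and Jt :: "nat \<Rightarrow> real^'n \<Rightarrow> (real^'n) \<times> (real^'m)"
    and K :: "nat \<Rightarrow> (real^'n) \<times> (real^'m) \<Rightarrow> (real^'n) \<times> (real^'m)"
    and T :: "real^'n \<Rightarrow> real^'n" and b \<alpha> P :: real
    and x l p s :: "nat \<Rightarrow> real^'n" and u r :: "nat \<Rightarrow> real^'m"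
  assumes N: "N \<ge> 1" and w: "\<And>i. i \<in> {1..N} \<Longrightarrow> 0 < w i" and w2: "(\<Sum>i=1..N. w i) = 2"
    and D': "\<And>i j. i \<in> {1..N} \<Longrightarrow> j \<in> {1..N} \<Longrightarrow> D' i j = - (w j / w i) * D j i"
    and D'1: "\<And>i. i \<in> {1..N} \<Longrightarrow> (\<Sum>j=1..N. D' i j) = (if i = N then - 1 / w N else 0)"
    and E: "is_inverse_on N D E" and E': "is_inverse_on N D' E'"
    and E1: "\<And>i. i \<in> {1..N} \<Longrightarrow> (\<Sum>j=1..N. \<bar>E i j\<bar>) \<le> 2"
    and E1': "\<And>i. i \<in> {1..N} \<Longrightarrow> (\<Sum>j=1..N. \<bar>E' i j\<bar>) \<le> 2"
    and E2: "\<And>i v. i \<in> {1..N} \<Longrightarrow> (\<Sum>j=1..N. \<bar>E i j\<bar> * v j) \<le> sqrt 2 * sqrt (\<Sum>j=1..N. w j * (v j)\<^sup>2)"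
    and E2': "\<And>i v. i \<in> {1..N} \<Longrightarrow> (\<Sum>j=1..N. \<bar>E' i j\<bar> * v j) \<le> sqrt 2 * sqrt (\<Sum>j=1..N. w j * (v j)\<^sup>2)"
    and b: "b \<ge> 0" and \<alpha>: "\<alpha> > 0"
    and Jlin: "\<And>j. j \<in> {1..N} \<Longrightarrow> linear (J j)" and Klin: "\<And>j. j \<in> {1..N} \<Longrightarrow> linear (K j)"
    and Jb: "\<And>j z. j \<in> {1..N} \<Longrightarrow> norm (J j z) \<le> b * norm z"
    and Jtb: "\<And>j y. j \<in> {1..N} \<Longrightarrow> norm (Jt j y) \<le> b * norm y"
    and Kb: "\<And>j z. j \<in> {1..N} \<Longrightarrow> norm (K j z) \<le> b * norm z"
    and Tb: "\<And>y. norm (T y) \<le> b * norm y"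
    and Jt: "\<And>j y z. j \<in> {1..N} \<Longrightarrow> Jt j y \<bullet> z = y \<bullet> J j z"
    and JA: "\<And>j y c k. j \<in> {1..N} \<Longrightarrow> (\<And>l. \<bar>y $ l\<bar> \<le> c) \<Longrightarrow> \<bar>J j (y, 0) $ k\<bar> \<le> c / 4"
    and JtA: "\<And>j y c k. j \<in> {1..N} \<Longrightarrow> (\<And>l. \<bar>y $ l\<bar> \<le> c) \<Longrightarrow> \<bar>fst (Jt j y) $ k\<bar> \<le> c / 4"
    and Kc: "\<And>j z. j \<in> {1..N} \<Longrightarrow> \<alpha> * (norm z)\<^sup>2 \<le> K j z \<bullet> z"
    and Tc: "\<And>y. \<alpha> * (norm y)\<^sup>2 \<le> T y \<bullet> y"
    and eq_x: "\<And>i. i \<in> {1..N} \<Longrightarrow> x i - (\<Sum>j=1..N. E i j *\<^sub>R J j (x j, u j)) = p i"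
    and eq_l: "\<And>i. i \<in> {1..N} \<Longrightarrow>
        l i - T (x N) + (\<Sum>j=1..N. E' i j *\<^sub>R fst (Jt j (l j) + K j (x j, u j))) = s i"
    and eq_u: "\<And>i. i \<in> {1..N} \<Longrightarrow> snd (Jt i (l i) + K i (x i, u i)) = r i"
    and p: "\<And>i. i \<in> {1..N} \<Longrightarrow> norm (p i) \<le> P"
    and s: "\<And>i. i \<in> {1..N} \<Longrightarrow> norm (s i) \<le> P"
    and r: "\<And>i. i \<in> {1..N} \<Longrightarrow> norm (r i) \<le> P"
begin

definition "wnorm = sqrt (\<Sum>j=1..N. w j * (norm (x j, u j))\<^sup>2)"

text \<open>Exactly what convexity controls: the terminal state through \<open>T\<close>, and the
  weighted norm of \<open>(x, u)\<close> through \<open>K\<close>.\<close>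

definition "ynorm = norm (x N) + wnorm"

lemma P_nonneg: "P \<ge> 0" using order_trans[OF norm_ge_zero p[of N]] N by auto

lemma wnorm_nonneg: "wnorm \<ge> 0"
  unfolding wnorm_def using w by (auto intro!: sum_nonneg simp: less_imp_le)

lemma wnorm_square: "wnorm\<^sup>2 = (\<Sum>j=1..N. w j * (norm (x j, u j))\<^sup>2)"
  unfolding wnorm_def using w by (intro real_sqrt_pow2 sum_nonneg) (auto simp: less_imp_le)

lemma weighted_l1_le: "(\<Sum>j=1..N. w j * norm (x j, u j)) \<le> 2 * wnorm"
proof -
  have "(\<Sum>j=1..N. w j * norm (x j, u j)) = (\<Sum>j=1..N. sqrt (w j) * (sqrt (w j) * norm (x j, u j)))"
    using w by (intro sum.cong) (auto simp: mult.assoc[symmetric] less_imp_le)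
  also have "\<dots> \<le> sqrt ((\<Sum>j=1..N. (sqrt (w j))\<^sup>2) * (\<Sum>j=1..N. (sqrt (w j) * norm (x j, u j))\<^sup>2))"
    by (rule real_le_rsqrt[OF Cauchy_Schwarz_ineq_sum])
  also have "(\<Sum>j=1..N. (sqrt (w j))\<^sup>2) = 2"
    unfolding w2[symmetric] using w by (intro sum.cong) (auto simp: less_imp_le)
  also have "(\<Sum>j=1..N. (sqrt (w j) * norm (x j, u j))\<^sup>2) = (\<Sum>j=1..N. w j * (norm (x j, u j))\<^sup>2)"
    using w by (intro sum.cong) (auto simp: power_mult_distrib less_imp_le)
  also have "sqrt (2 * (\<Sum>j=1..N. w j * (norm (x j, u j))\<^sup>2)) = sqrt 2 * wnorm"
    by (simp add: real_sqrt_mult wnorm_def)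
  also have "\<dots> \<le> 2 * wnorm" by (intro mult_right_mono sqrt_2_le_2 wnorm_nonneg)
  finally show ?thesis .
qed

text \<open>Here (P2) and (P4) act: a weighted L2 quantity yields a pointwise bound, at the price of
  \<open>sqrt 2\<close>, rounded up to 2.\<close>

lemma row_weighted_bound:
  assumes "\<And>v. (\<Sum>j=1..N. \<bar>F j\<bar> * v j) \<le> sqrt 2 * sqrt (\<Sum>j=1..N. w j * (v j)\<^sup>2)"
    and "\<And>j. j \<in> {1..N} \<Longrightarrow> norm (g j :: real^'n) \<le> b * norm (x j, u j)"
  shows "\<bar>(\<Sum>j=1..N. F j *\<^sub>R g j) $ k\<bar> \<le> 2 * b * wnorm"
proof -
  have "\<bar>(\<Sum>j=1..N. F j *\<^sub>R g j) $ k\<bar> \<le> (\<Sum>j=1..N. \<bar>F j\<bar> * (b * norm (x j, u j)))"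
    by (intro abs_sum_scaleR_component_le order_trans[OF component_le_norm_cart assms(2)])
  also have "\<dots> \<le> sqrt 2 * sqrt (\<Sum>j=1..N. w j * (b * norm (x j, u j))\<^sup>2)" by (rule assms(1))
  also have "(\<Sum>j=1..N. w j * (b * norm (x j, u j))\<^sup>2) = b\<^sup>2 * (\<Sum>j=1..N. w j * (norm (x j, u j))\<^sup>2)"
    unfolding sum_distrib_left by (intro sum.cong) (auto simp: power_mult_distrib)
  also have "sqrt 2 * sqrt (b\<^sup>2 * (\<Sum>j=1..N. w j * (norm (x j, u j))\<^sup>2)) = sqrt 2 * (b * wnorm)"
    using b by (simp add: real_sqrt_mult wnorm_def)
  also have "\<dots> \<le> 2 * (b * wnorm)" using b wnorm_nonneg by (intro mult_right_mono sqrt_2_le_2) auto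
  finally show ?thesis by simp
qed

text \<open>The \<open>Jt\<close> term is absorbed by (A3); what remains involves the data,
  \<open>T\<close> at the terminal state and \<open>K\<close> at \<open>(x, u)\<close>, all covered
  by \<open>P\<close> and \<open>ynorm\<close>. So the costate needs no energy estimate of its
  own.\<close>

lemma costate_bound:
  assumes i: "i \<in> {1..N}"
  shows "norm (l i) \<le> real CARD('n) * (2 * (P + 2 * b * ynorm))"
proof (rule norm_le_card_component)
  fix k
  have "\<bar>l i $ k\<bar> \<le> 2 * ((P + b * norm (x N)) + 2 * b * wnorm)"
  proof (rule fixed_point_component_bound[where q = "\<lambda>i. s i + T (x N)" and E = E'
        and M = "\<lambda>j y. - fst (Jt j y)" and r = "\<lambda>j. - fst (K j (x j, u j))" and N = N])
    fix i assume i: "i \<in> {1..N}"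
    show "l i = s i + T (x N) + (\<Sum>j=1..N. E' i j *\<^sub>R (- fst (Jt j (l j)) + - fst (K j (x j, u j))))"
      by (subst eq_l[OF i, symmetric]) (simp add: sum_negf scaleR_add_right sum.distrib scaleR_right_diff_distrib sum_subtractf)
    show "\<bar>(s i + T (x N)) $ k\<bar> \<le> P + b * norm (x N)" for k
      using order_trans[OF component_le_norm_cart norm_triangle_ineq, of "s i" "T (x N)" k] s[OF i] Tb[of "x N"] by linarith
    show "\<bar>(\<Sum>j=1..N. E' i j *\<^sub>R - fst (K j (x j, u j))) $ k\<bar> \<le> 2 * b * wnorm" for k
      by (intro row_weighted_bound E2' i) (auto intro!: order_trans[OF norm_fst_le_norm Kb])
  qed (use E1' JtA i in auto)
  also have "\<dots> \<le> 2 * (P + 2 * b * ynorm)"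
    using b wnorm_nonneg by (simp add: ynorm_def algebra_simps)
  finally show "\<bar>l i $ k\<bar> \<le> 2 * (P + 2 * b * ynorm)" .
qed

lemma state_bound:
  assumes i: "i \<in> {1..N}"
  shows "norm (x i) \<le> real CARD('n) * (2 * (P + 2 * b * ynorm))"
proof (rule norm_le_card_component)
  fix k
  have "\<bar>x i $ k\<bar> \<le> 2 * (P + 2 * b * wnorm)"
  proof (rule fixed_point_component_bound[where q = p and E = E
        and M = "\<lambda>j y. J j (y, 0)" and r = "\<lambda>j. J j (0, u j)" and N = N])
    fix i assume i: "i \<in> {1..N}"
    \<comment> \<open>Only the state part is small by (A3) and can be absorbed; the control part is
      measured in the weighted norm.\<close>
    have split: "J j (x j, u j) = J j (x j, 0) + J j (0, u j)" if "j \<in> {1..N}" for j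
      using linear_add[OF Jlin[OF that], of "(x j, 0)" "(0, u j)"] by simp
    show "x i = p i + (\<Sum>j=1..N. E i j *\<^sub>R (J j (x j, 0) + J j (0, u j)))"
      using eq_x[OF i] split by (simp add: algebra_simps)
    show "\<bar>p i $ k\<bar> \<le> P" for k
      using order_trans[OF component_le_norm_cart p[OF i]] .
    have "norm (J j (0, u j)) \<le> b * norm (x j, u j)" if "j \<in> {1..N}" for j
      by (rule order_trans[OF Jb[OF that]]) (intro mult_left_mono b, simp add: norm_Pair)
    then show "\<bar>(\<Sum>j=1..N. E i j *\<^sub>R J j (0, u j)) $ k\<bar> \<le> 2 * b * wnorm" for k
      by (intro row_weighted_bound E2 i)
  qed (use E1 JA i in auto)
  also have "\<dots> \<le> 2 * (P + 2 * b * ynorm)"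
    using b by (simp add: ynorm_def algebra_simps)
  finally show "\<bar>x i $ k\<bar> \<le> 2 * (P + 2 * b * ynorm)" .
qed

text \<open>Testing the state equation with the costate and using that \<open>D'\<close> is the negative adjoint of
  \<open>D\<close> in the weighted inner product cancels all terms \<open>l \<bullet> J z\<close>.\<close>

lemma energy_identity:
  "T (x N) \<bullet> x N + (\<Sum>i=1..N. w i * (K i (x i, u i) \<bullet> (x i, u i))) =
    T (x N) \<bullet> p N + (\<Sum>i=1..N. w i * (r i \<bullet> u i + fst (Jt i (l i) + K i (x i, u i)) \<bullet> p i - s i \<bullet> J i (x i, u i)))"
proof -
  define z where "z i = (x i, u i)" for i
  define h where "h i = fst (Jt i (l i) + K i (z i))" for i
  have Dx: "(\<Sum>j=1..N. D i j *\<^sub>R (x j - p j)) = J i (z i)" if "i \<in> {1..N}" for i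
    by (rule is_inverse_on_solve[OF is_inverse_on_sym[OF E] _ that])
      (use eq_x in \<open>simp add: z_def algebra_simps\<close>)
  have Dl1: "(\<Sum>j=1..N. D' i j *\<^sub>R (l j - s j - T (x N))) = - h i" if "i \<in> {1..N}" for i
  proof (rule is_inverse_on_solve[OF is_inverse_on_sym[OF E'] _ that])
    fix i assume "i \<in> {1..N}"
    from eq_l[OF this] have "l i - T (x N) + (\<Sum>j = 1..N. E' i j *\<^sub>R h j) = s i"
      by (simp only: h_def z_def)
    then show "(\<Sum>j = 1..N. E' i j *\<^sub>R - h j) = l i - s i - T (x N)"
      by (simp add: sum_negf algebra_simps)
  qed
  have Dl2: "(\<Sum>j=1..N. D' i j *\<^sub>R (l j - s j - T (x N))) =
     (\<Sum>j=1..N. D' i j *\<^sub>R (l j - s j)) - (\<Sum>j=1..N. D' i j) *\<^sub>R T (x N)" for i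
    by (simp add: scaleR_right_diff_distrib sum_subtractf scaleR_sum_left)
  \<comment> \<open>The constant \<open>T (x N)\<close> is seen by the last row of \<open>D'\<close>
    only. After weighting, its factor \<open>1 / w N\<close> cancels and leaves the terminal term of
    the identity.\<close>
  have Dl: "(\<Sum>j=1..N. D' i j *\<^sub>R (l j - s j)) = - h i - (if i = N then (1 / w N) *\<^sub>R T (x N) else 0)"
    if "i \<in> {1..N}" for i
    using Dl1[OF that] unfolding Dl2 D'1[OF that] by (auto simp: eq_diff_eq add_eq_0_iff2 minus_equation_iff)
  have "(\<Sum>i=1..N. w i * ((l i - s i) \<bullet> J i (z i))) = (\<Sum>i=1..N. w i * ((l i - s i) \<bullet> (\<Sum>j=1..N. D i j *\<^sub>R (x j - p j))))"
    by (intro sum.cong refl) (simp only: Dx)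
  also have "\<dots> = (\<Sum>j=1..N. - w j * ((\<Sum>i=1..N. D' j i *\<^sub>R (l i - s i)) \<bullet> (x j - p j)))"
    by (rule weighted_summation_by_parts[OF w D'])
  also have "\<dots> = (\<Sum>j=1..N. w j * (h j \<bullet> (x j - p j)) + (if j = N then T (x N) \<bullet> (x N - p N) else 0))"
  proof (intro sum.cong refl)
    fix j assume j: "j \<in> {1..N}"
    show "- w j * ((\<Sum>i=1..N. D' j i *\<^sub>R (l i - s i)) \<bullet> (x j - p j)) =
      w j * (h j \<bullet> (x j - p j)) + (if j = N then T (x N) \<bullet> (x N - p N) else 0)"
      unfolding Dl[OF j] using w[OF j] by (auto simp: inner_diff_left right_diff_distrib)
  qed
  also have "\<dots> = (\<Sum>j=1..N. w j * (h j \<bullet> (x j - p j))) + T (x N) \<bullet> (x N - p N)"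
    using N by (simp add: sum.distrib)
  finally have 1: "(\<Sum>i=1..N. w i * ((l i - s i) \<bullet> J i (z i))) = (\<Sum>j=1..N. w j * (h j \<bullet> (x j - p j))) + T (x N) \<bullet> (x N - p N)" .
  \<comment> \<open>Pairing the full gradient equation with \<open>z i\<close>: its second component
    is \<open>r i\<close>, and adjointness of \<open>Jt\<close> and \<open>J\<close> exposes the
    term that cancels.\<close>
  have 2: "h i \<bullet> x i = l i \<bullet> J i (z i) + K i (z i) \<bullet> z i - r i \<bullet> u i" if "i \<in> {1..N}" for i
  proof -
    have "(Jt i (l i) + K i (z i)) \<bullet> z i = h i \<bullet> x i + r i \<bullet> u i"
      using eq_u[OF that] by (simp add: h_def z_def inner_prod_def)
    then show ?thesis using Jt[OF that, of "l i" "z i"] by (simp add: inner_add_left)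
  qed
  have "(\<Sum>i=1..N. w i * ((l i - s i) \<bullet> J i (z i))) =
      (\<Sum>i=1..N. w i * (l i \<bullet> J i (z i) + K i (z i) \<bullet> z i - r i \<bullet> u i - h i \<bullet> p i)) + T (x N) \<bullet> (x N - p N)"
    unfolding 1 using 2 by (simp add: inner_diff_right)
  then show ?thesis
    unfolding h_def[symmetric] z_def[symmetric]
    by (simp add: inner_diff_left inner_diff_right algebra_simps sum.distrib sum_subtractf)
qed

text \<open>The left side of \<open>energy_identity\<close> is coercive, while every term on the
  right contains \<open>p\<close>, \<open>s\<close> or \<open>r\<close> and hence a factor
  \<open>P\<close>. Bounding the costate by \<open>costate_bound\<close> leaves a quadratic
  inequality for \<open>ynorm\<close> alone.\<close>

lemma energy_bound: "ynorm \<le> energy_const (real CARD('n)) b \<alpha> * P"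
proof -
  define n where "n = real CARD('n)"
  define q where "q i = norm (x i, u i)" for i
  have n0: "n \<ge> 0" unfolding n_def by simp
  have y0: "ynorm \<ge> 0" unfolding ynorm_def using wnorm_nonneg by simp
  have "\<alpha> * ((norm (x N))\<^sup>2 + wnorm\<^sup>2) \<le> T (x N) \<bullet> x N + (\<Sum>i=1..N. w i * (K i (x i, u i) \<bullet> (x i, u i)))"
  proof -
    have "\<alpha> * wnorm\<^sup>2 = (\<Sum>i=1..N. w i * (\<alpha> * (norm (x i, u i))\<^sup>2))"
      unfolding wnorm_square sum_distrib_left by (simp add: mult_ac)
    also have "\<dots> \<le> (\<Sum>i=1..N. w i * (K i (x i, u i) \<bullet> (x i, u i)))"
      using w by (intro sum_mono mult_left_mono Kc) (auto simp: less_imp_le)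
    finally show ?thesis using Tc[of "x N"] by (simp add: distrib_left)
  qed
  also have "\<dots> \<le> P * (b * norm (x N)) + (\<Sum>i=1..N. w i * (P * (q i + 2 * b * q i + b * norm (l i))))"
    unfolding energy_identity
  proof (intro add_mono sum_mono mult_left_mono)
    have "T (x N) \<bullet> p N \<le> norm (T (x N)) * norm (p N)" by (rule norm_cauchy_schwarz)
    also have "\<dots> \<le> (b * norm (x N)) * P" using b N by (intro mult_mono Tb p) auto
    finally show "T (x N) \<bullet> p N \<le> P * (b * norm (x N))" by (simp add: mult.commute)
    fix i assume i: "i \<in> {1..N}"
    show "0 \<le> w i" using w[OF i] by simp
    have "r i \<bullet> u i \<le> P * q i"
      unfolding q_def by (rule order_trans[OF norm_cauchy_schwarz]) (intro mult_mono r i P_nonneg; simp add: norm_Pair)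
    moreover have "fst (Jt i (l i) + K i (x i, u i)) \<bullet> p i \<le> (b * norm (l i) + b * q i) * P"
    proof (rule order_trans[OF norm_cauchy_schwarz], intro mult_mono p i)
      show "norm (fst (Jt i (l i) + K i (x i, u i))) \<le> b * norm (l i) + b * q i"
        using order_trans[OF norm_fst_le_norm norm_triangle_ineq, of "Jt i (l i)" "K i (x i, u i)"]
          Jtb[OF i, of "l i"] Kb[OF i, of "(x i, u i)"]
        unfolding q_def by linarith
    qed (use b in \<open>auto simp: q_def\<close>)
    moreover have "- (s i \<bullet> J i (x i, u i)) \<le> P * (b * q i)"
    proof -
      have "\<bar>s i \<bullet> J i (x i, u i)\<bar> \<le> norm (s i) * norm (J i (x i, u i))" by (rule Cauchy_Schwarz_ineq2)
      also have "\<dots> \<le> P * (b * q i)" unfolding q_def by (intro mult_mono s i Jb P_nonneg) auto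
      finally show ?thesis by linarith
    qed
    ultimately show "r i \<bullet> u i + fst (Jt i (l i) + K i (x i, u i)) \<bullet> p i - s i \<bullet> J i (x i, u i)
        \<le> P * (q i + 2 * b * q i + b * norm (l i))"
      by (simp add: algebra_simps)
  qed
  also have "\<dots> \<le> P * (b * norm (x N)) + P * ((1 + 2 * b) * (2 * wnorm) + 2 * (b * (n * (2 * (P + 2 * b * ynorm)))))"
  proof (intro add_left_mono)
    have "(\<Sum>i=1..N. w i * (P * (q i + 2 * b * q i + b * norm (l i)))) =
       P * ((1 + 2 * b) * (\<Sum>i=1..N. w i * q i) + (\<Sum>i=1..N. w i * (b * norm (l i))))"
      by (simp add: sum_distrib_left sum.distrib[symmetric] algebra_simps)
    also have "\<dots> \<le> P * ((1 + 2 * b) * (2 * wnorm) + (\<Sum>i=1..N. w i * (b * (n * (2 * (P + 2 * b * ynorm))))))"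
      using b P_nonneg w unfolding q_def n_def
      by (intro mult_left_mono add_mono weighted_l1_le sum_mono costate_bound) (auto simp: less_imp_le)
    also have "\<dots> = P * ((1 + 2 * b) * (2 * wnorm) + 2 * (b * (n * (2 * (P + 2 * b * ynorm)))))"
      by (simp only: sum_distrib_right[symmetric] w2)
    finally show "(\<Sum>i=1..N. w i * (P * (q i + 2 * b * q i + b * norm (l i)))) \<le>
      P * ((1 + 2 * b) * (2 * wnorm) + 2 * (b * (n * (2 * (P + 2 * b * ynorm)))))" .
  qed
  also have "\<dots> = P * (b * norm (x N) + (2 + 4 * b) * wnorm + 8 * b\<^sup>2 * n * ynorm + 4 * b * n * P)"
    by (simp add: algebra_simps power2_eq_square)
  also have "\<dots> \<le> P * ((2 + 5 * b + 8 * b\<^sup>2 * n) * ynorm + 4 * b * n * P)"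
  proof (intro mult_left_mono P_nonneg)
    have "b * norm (x N) + (2 + 4 * b) * wnorm \<le> b * ynorm + (2 + 4 * b) * ynorm"
      using b wnorm_nonneg unfolding ynorm_def by (intro add_mono mult_left_mono) auto
    then show "b * norm (x N) + (2 + 4 * b) * wnorm + 8 * b\<^sup>2 * n * ynorm + 4 * b * n * P \<le>
      (2 + 5 * b + 8 * b\<^sup>2 * n) * ynorm + 4 * b * n * P"
      by (simp add: algebra_simps)
  qed
  finally have *: "\<alpha> * ((norm (x N))\<^sup>2 + wnorm\<^sup>2) \<le> P * ((2 + 5 * b + 8 * b\<^sup>2 * n) * ynorm + 4 * b * n * P)" .
  \<comment> \<open>The square of a sum of two terms costs a factor 2, so \<open>\<alpha>\<close>
    turns into \<open>\<alpha> / 2\<close>.\<close>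
  have "ynorm\<^sup>2 \<le> 2 * ((norm (x N))\<^sup>2 + wnorm\<^sup>2)"
    using sum_squares_bound[of "norm (x N)" wnorm] unfolding ynorm_def by (simp add: power2_sum)
  then have "\<alpha> / 2 * ynorm\<^sup>2 \<le> \<alpha> / 2 * (2 * ((norm (x N))\<^sup>2 + wnorm\<^sup>2))" using \<alpha> by (intro mult_left_mono) auto
  then have "\<alpha> / 2 * ynorm\<^sup>2 \<le> P * ((2 + 5 * b + 8 * b\<^sup>2 * n) * ynorm + 4 * b * n * P)" using * by (simp only: times_divide_eq_left)
  from quadratic_inequality_bound[OF _ _ _ P_nonneg this y0] show ?thesis
    using \<alpha> b n0 unfolding energy_const_def n_def by simp
qed

text \<open>State and costate follow from \<open>energy_bound\<close>. The control is recovered node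
  by node: \<open>K\<close> is coercive on directions \<open>(0, u)\<close>, so the stationarity
  equation bounds \<open>u i\<close> by state, costate and data at the same node.\<close>

lemma linear_stability:
  assumes i: "i \<in> {1..N}"
  shows "norm (x i) \<le> state_const (real CARD('n)) b \<alpha> * P"
    and "norm (l i) \<le> state_const (real CARD('n)) b \<alpha> * P"
    and "norm (u i) \<le> control_const (real CARD('n)) b \<alpha> * P"
proof -
  define c where "c = state_const (real CARD('n)) b \<alpha>"
  have "real CARD('n) * (2 * (P + 2 * b * ynorm)) \<le> real CARD('n) * (2 * (P + 2 * b * (energy_const (real CARD('n)) b \<alpha> * P)))"
    using b energy_bound by (intro mult_left_mono add_left_mono) auto
  also have "\<dots> = c * P" unfolding c_def state_const_def by (simp add: algebra_simps)
  finally have le: "real CARD('n) * (2 * (P + 2 * b * ynorm)) \<le> c * P" .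
  show x: "norm (x i) \<le> state_const (real CARD('n)) b \<alpha> * P"
    and l: "norm (l i) \<le> state_const (real CARD('n)) b \<alpha> * P"
    using order_trans[OF state_bound[OF i] le] order_trans[OF costate_bound[OF i] le] unfolding c_def by auto
  have "\<alpha> * (norm (u i))\<^sup>2 \<le> K i (0, u i) \<bullet> (0, u i)" using Kc[OF i, of "(0, u i)"] by (simp add: norm_Pair)
  also have "\<dots> = snd (K i (0, u i)) \<bullet> u i" by (simp add: inner_prod_def)
  also have "K i (x i, u i) = K i (x i, 0) + K i (0, u i)"
    using linear_add[OF Klin[OF i], of "(x i, 0)" "(0, u i)"] by simp
  then have "snd (K i (0, u i)) = r i - snd (Jt i (l i)) - snd (K i (x i, 0))"
    using eq_u[OF i] by (simp add: algebra_simps)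
  also have "(r i - snd (Jt i (l i)) - snd (K i (x i, 0))) \<bullet> u i \<le> (P + b * (c * P) + b * (c * P)) * norm (u i)"
  proof (rule order_trans[OF norm_cauchy_schwarz], intro mult_right_mono)
    have "norm (snd (Jt i (l i))) \<le> b * (c * P)"
      using norm_snd_le_norm[of "Jt i (l i)"] Jtb[OF i, of "l i"]
        mult_left_mono[OF l b] unfolding c_def[symmetric] by linarith
    moreover have "norm (snd (K i (x i, 0))) \<le> b * (c * P)"
      using norm_snd_le_norm[of "K i (x i, 0)"] Kb[OF i, of "(x i, 0)"]
        mult_left_mono[OF x b] unfolding c_def[symmetric] by (simp add: norm_Pair)
    ultimately show "norm (r i - snd (Jt i (l i)) - snd (K i (x i, 0))) \<le> P + b * (c * P) + b * (c * P)"
      using norm_triangle_ineq4[of "r i - snd (Jt i (l i))" "snd (K i (x i, 0))"]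
        norm_triangle_ineq4[of "r i" "snd (Jt i (l i))"] r[OF i] by linarith
  qed simp
  finally have "(\<alpha> * norm (u i)) * norm (u i) \<le> (P + b * (c * P) + b * (c * P)) * norm (u i)"
    by (simp add: power2_eq_square mult.assoc)
  moreover have c0: "c \<ge> 0" unfolding c_def using stability_consts_nonneg(2) b \<alpha> by simp
  ultimately have "\<alpha> * norm (u i) \<le> P + b * (c * P) + b * (c * P)"
    using b P_nonneg by (cases "u i = 0") auto
  then have "norm (u i) \<le> (P + b * (c * P) + b * (c * P)) / \<alpha>" using \<alpha> by (simp add: field_simps)
  also have "\<dots> = control_const (real CARD('n)) b \<alpha> * P"
    unfolding control_const_def c_def[symmetric] by (simp add: algebra_simps)
  finally show "norm (u i) \<le> control_const (real CARD('n)) b \<alpha> * P" .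
qed

end

subsection \<open>Strict differentiability, symmetric second derivatives, convexity\<close>

definition riesz :: "('a::euclidean_space \<Rightarrow> real) \<Rightarrow> 'a" where
  "riesz \<phi> = (\<Sum>b\<in>Basis. \<phi> b *\<^sub>R b)"

lemma riesz_inner:
  assumes "linear \<phi>"
  shows "riesz \<phi> \<bullet> v = \<phi> v"
proof -
  have "\<phi> v = \<phi> (\<Sum>b\<in>Basis. (v \<bullet> b) *\<^sub>R b)" by (simp add: euclidean_representation)
  also have "\<dots> = (\<Sum>b\<in>Basis. (v \<bullet> b) * \<phi> b)"
    by (simp only: linear_sum[OF assms] linear_scale[OF assms] real_scaleR_def)
  also have "\<dots> = riesz \<phi> \<bullet> v"
    unfolding riesz_def by (simp add: inner_sum_left inner_commute[of v] mult.commute)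
  finally show ?thesis by simp
qed

lemma norm_le_of_inner_le:
  fixes a :: "'a::real_inner"
  assumes "\<And>v. \<bar>a \<bullet> v\<bar> \<le> c * norm v" "c \<ge> 0"
  shows "norm a \<le> c"
proof (cases "a = 0")
  case False
  have "norm a * norm a \<le> c * norm a" using assms(1)[of a] by (simp add: dot_square_norm power2_eq_square)
  then show ?thesis using False by simp
qed (use assms in auto)

lemma inner_eq_all_imp_eq: "(\<And>v. a \<bullet> v = b \<bullet> v) \<Longrightarrow> a = (b :: 'a::real_inner)"
  using vector_eq_rdot by blast

text \<open>\<open>h'\<close> is uniformly continuous on the compact tube of radius
  \<open>\<rho>\<close> around \<open>K\<close>, so one radius serves all centers. The derivative is
  frozen at the center, as a Newton iteration with fixed linear part requires.\<close>

lemma uniform_strict_differentiability: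
  fixes h :: "'a::euclidean_space \<Rightarrow> 'b::real_normed_vector" and h' :: "'a \<Rightarrow> 'a \<Rightarrow>\<^sub>L 'b"
  assumes S: "open S" and K: "compact K" and \<rho>: "\<rho> > 0"
    and sub: "\<And>z. z \<in> K \<Longrightarrow> cball z \<rho> \<subseteq> S"
    and der: "\<And>z. z \<in> S \<Longrightarrow> (h has_derivative blinfun_apply (h' z)) (at z)"
    and cont: "continuous_on S h'" and e: "e > 0"
  shows "\<exists>r>0. r \<le> \<rho> \<and> (\<forall>\<zeta>\<in>K. \<forall>z\<in>cball \<zeta> r. norm (h' z - h' \<zeta>) \<le> e \<and>
     (\<forall>z'\<in>cball \<zeta> r. norm (h z' - h z - h' \<zeta> (z' - z)) \<le> e * norm (z' - z)))"
proof -
  define C where "C = {x + y | x y. x \<in> K \<and> y \<in> cball (0::'a) \<rho>}"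
  have C: "compact C" unfolding C_def by (intro compact_sums K) simp
  have KC: "cball z \<rho> \<subseteq> C" if "z \<in> K" for z
  proof
    fix y assume "y \<in> cball z \<rho>"
    then have "y = z + (y - z)" "y - z \<in> cball 0 \<rho>" by (auto simp: dist_norm norm_minus_commute)
    then show "y \<in> C" unfolding C_def using that by blast
  qed
  have "C \<subseteq> S"
  proof
    fix y assume "y \<in> C"
    then obtain x v where "y = x + v" "x \<in> K" "v \<in> cball 0 \<rho>" unfolding C_def by auto
    then have "y \<in> cball x \<rho>" by (auto simp: dist_norm)
    then show "y \<in> S" using sub \<open>x \<in> K\<close> by blast
  qed
  then have "uniformly_continuous_on C h'"
    by (intro compact_uniformly_continuous continuous_on_subset[OF cont] C)
  then obtain d where d: "d > 0" "\<And>x y. x \<in> C \<Longrightarrow> y \<in> C \<Longrightarrow> dist y x < d \<Longrightarrow> dist (h' y) (h' x) < e"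
    using e unfolding uniformly_continuous_on_def by meson
  define r where "r = min \<rho> (d / 2)"
  have near: "norm (h' z - h' \<zeta>) \<le> e" if "\<zeta> \<in> K" "z \<in> cball \<zeta> r" for z \<zeta>
  proof -
    have "z \<in> cball \<zeta> \<rho>" "\<zeta> \<in> cball \<zeta> \<rho>" "dist z \<zeta> < d"
      using that \<rho> d(1) by (auto simp: r_def dist_commute)
    then show ?thesis using d(2)[of \<zeta> z] KC[OF that(1)] by (metis dist_norm less_imp_le subsetD)
  qed
  have "norm (h z' - h z - h' \<zeta> (z' - z)) \<le> e * norm (z' - z)"
    if z: "\<zeta> \<in> K" "z \<in> cball \<zeta> r" "z' \<in> cball \<zeta> r" for z z' \<zeta>
  proof -
    have "norm (h z' - h z - h' \<zeta> (z' - z)) \<le> norm (z' - z) * e"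
    proof (rule differentiable_bound_linearization[where S = "cball \<zeta> r" and f' = "\<lambda>x. blinfun_apply (h' x)"])
      fix t :: real assume "t \<in> {0..1}"
      then show "z + t *\<^sub>R (z' - z) \<in> cball \<zeta> r"
        using convexD[OF convex_cball z(2,3), of "1 - t" t] by (auto simp: algebra_simps)
    next
      fix x assume x: "x \<in> cball \<zeta> r"
      then have "x \<in> S" using sub[OF z(1)] unfolding r_def by auto
      then show "(h has_derivative blinfun_apply (h' x)) (at x within cball \<zeta> r)"
        using der has_derivative_at_withinI by blast
      have "onorm (blinfun_apply (h' x - h' \<zeta>)) \<le> e" using near[OF z(1) x] by (simp add: norm_blinfun.rep_eq)
      moreover have "blinfun_apply (h' x) - blinfun_apply (h' \<zeta>) = blinfun_apply (h' x - h' \<zeta>)"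
        by (auto simp: blinfun.diff_left)
      ultimately show "onorm (blinfun_apply (h' x) - blinfun_apply (h' \<zeta>)) \<le> e" by simp
    next
      show "\<zeta> \<in> cball \<zeta> r" using \<rho> d(1) by (simp add: r_def)
    qed
    then show ?thesis by (simp add: mult.commute)
  qed
  then show ?thesis using near \<rho> d(1) by (intro exI[of _ r]) (auto simp: r_def)
qed

text \<open>Second difference quotients: both mixed derivatives approximate
  \<open>(\<phi>(z+ta+tb) - \<phi>(z+ta) - \<phi>(z+tb) + \<phi>(z)) / t\<^sup>2\<close>.\<close>

lemma second_difference_estimate:
  fixes \<phi> :: "'a::real_normed_vector \<Rightarrow> real"
  assumes der: "\<And>y. y \<in> ball z r \<Longrightarrow> (\<phi> has_derivative \<phi>' y) (at y)"
    and app: "\<And>y y' v. y \<in> ball z r \<Longrightarrow> y' \<in> ball z r \<Longrightarrow>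
      \<bar>\<phi>' y' v - \<phi>' y v - M (y' - y) v\<bar> \<le> e * norm (y' - y) * norm v"
    and hom: "\<And>c x v. M (c *\<^sub>R x) v = c * M x v"
    and t: "t > 0" "t * (norm a + norm b) < r"
  shows "\<bar>(\<phi> (z + t *\<^sub>R a + t *\<^sub>R b) - \<phi> (z + t *\<^sub>R a) - \<phi> (z + t *\<^sub>R b) + \<phi> z) / t\<^sup>2 - M b a\<bar> \<le> e * norm a * norm b"
proof -
  \<comment> \<open>The second difference is \<open>\<psi> t - \<psi> 0\<close>. The mean value
    theorem in direction \<open>a\<close> reduces it to an increment of the first derivative over
    \<open>t *\<^sub>R b\<close>, to which \<open>app\<close> applies.\<close>
  define \<psi> where "\<psi> s = \<phi> (z + s *\<^sub>R a + t *\<^sub>R b) - \<phi> (z + s *\<^sub>R a)" for s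
  have in1: "z + s *\<^sub>R a + t *\<^sub>R b \<in> ball z r" "z + s *\<^sub>R a \<in> ball z r" if "0 \<le> s" "s \<le> t" for s
  proof -
    have sa: "s * norm a \<le> t * norm a" using that by (intro mult_right_mono) auto
    have "norm (s *\<^sub>R a + t *\<^sub>R b) \<le> s * norm a + t * norm b"
      using norm_triangle_ineq[of "s *\<^sub>R a" "t *\<^sub>R b"] that t by simp
    then have "norm (s *\<^sub>R a + t *\<^sub>R b) < r" using sa t(2) by (simp add: distrib_left)
    then have "norm (z - (z + s *\<^sub>R a + t *\<^sub>R b)) < r"
      by (metis add.assoc add_diff_cancel_left' norm_minus_commute)
    then show "z + s *\<^sub>R a + t *\<^sub>R b \<in> ball z r" by (simp add: dist_norm)
    have "s * norm a < r" using sa t(2) mult_nonneg_nonneg[OF less_imp_le[OF t(1)] norm_ge_zero[of b]]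
      unfolding distrib_left by linarith
    then show "z + s *\<^sub>R a \<in> ball z r" using that by (simp add: dist_norm)
  qed
  have "\<exists>s>0. s < t \<and> \<psi> t - \<psi> 0 = (t - 0) * (\<phi>' (z + s *\<^sub>R a + t *\<^sub>R b) a - \<phi>' (z + s *\<^sub>R a) a)"
  proof (rule MVT2)
    fix s assume s: "0 \<le> s" "s \<le> t"
    have "((\<lambda>s. \<phi> (z + s *\<^sub>R a + t *\<^sub>R b)) has_derivative (\<lambda>h. \<phi>' (z + s *\<^sub>R a + t *\<^sub>R b) (h *\<^sub>R a))) (at s)"
      by (rule has_derivative_compose[where g = \<phi> and f = "\<lambda>s. z + s *\<^sub>R a + t *\<^sub>R b", OF _ der[OF in1(1)[OF s]]]) (auto intro!: derivative_eq_intros)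
    moreover have "((\<lambda>s. \<phi> (z + s *\<^sub>R a)) has_derivative (\<lambda>h. \<phi>' (z + s *\<^sub>R a) (h *\<^sub>R a))) (at s)"
      by (rule has_derivative_compose[where g = \<phi> and f = "\<lambda>s. z + s *\<^sub>R a", OF _ der[OF in1(2)[OF s]]]) (auto intro!: derivative_eq_intros)
    ultimately have "(\<psi> has_derivative (\<lambda>h. \<phi>' (z + s *\<^sub>R a + t *\<^sub>R b) (h *\<^sub>R a) - \<phi>' (z + s *\<^sub>R a) (h *\<^sub>R a))) (at s)"
      unfolding \<psi>_def by (rule has_derivative_diff)
    moreover have "\<phi>' y (h *\<^sub>R a) = h * \<phi>' y a" if "y \<in> ball z r" for y h
      using linear_scale[OF has_derivative_linear[OF der[OF that]], of h a] by simp
    ultimately show "(\<psi> has_real_derivative \<phi>' (z + s *\<^sub>R a + t *\<^sub>R b) a - \<phi>' (z + s *\<^sub>R a) a) (at s)"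
      using in1[OF s] unfolding has_field_derivative_def
      by (simp add: right_diff_distrib[symmetric] mult_commute_abs)
  qed (use t in auto)
  then obtain s where s: "0 < s" "s < t"
    and eq: "\<psi> t - \<psi> 0 = t * (\<phi>' (z + s *\<^sub>R a + t *\<^sub>R b) a - \<phi>' (z + s *\<^sub>R a) a)" by auto
  have "\<bar>\<phi>' (z + s *\<^sub>R a + t *\<^sub>R b) a - \<phi>' (z + s *\<^sub>R a) a - t * M b a\<bar> \<le> e * (t * norm b) * norm a"
    using app[OF in1(2,1), of s s a] s t hom by simp
  then have "t * \<bar>\<phi>' (z + s *\<^sub>R a + t *\<^sub>R b) a - \<phi>' (z + s *\<^sub>R a) a - t * M b a\<bar> \<le> t * (e * (t * norm b) * norm a)"
    using t by (intro mult_left_mono) auto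
  moreover have "(\<psi> t - \<psi> 0) / t\<^sup>2 - M b a = t * (\<phi>' (z + s *\<^sub>R a + t *\<^sub>R b) a - \<phi>' (z + s *\<^sub>R a) a - t * M b a) / t\<^sup>2"
    unfolding eq using t by (simp add: field_simps power2_eq_square)
  ultimately have "\<bar>(\<psi> t - \<psi> 0) / t\<^sup>2 - M b a\<bar> \<le> t * (e * (t * norm b) * norm a) / t\<^sup>2"
    using t by (simp add: abs_mult divide_right_mono)
  also have "\<dots> = e * norm a * norm b" using t by (simp add: field_simps power2_eq_square)
  finally show ?thesis unfolding \<psi>_def by (simp add: algebra_simps)
qed

lemma second_derivative_symmetric:
  fixes \<phi> :: "'a::real_normed_vector \<Rightarrow> real"
  assumes der: "\<And>y. y \<in> ball z \<rho> \<Longrightarrow> (\<phi> has_derivative \<phi>' y) (at y)"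
    and app: "\<And>e. e > 0 \<Longrightarrow> \<exists>r>0. \<forall>y\<in>ball z r. \<forall>y'\<in>ball z r. \<forall>v.
      \<bar>\<phi>' y' v - \<phi>' y v - M (y' - y) v\<bar> \<le> e * norm (y' - y) * norm v"
    and hom: "\<And>c x v. M (c *\<^sub>R x) v = c * M x v" and \<rho>: "\<rho> > 0"
  shows "M a b = M b a"
proof (rule ccontr)
  assume ne: "M a b \<noteq> M b a"
  define m where "m = norm a * norm b"
  \<comment> \<open>Chosen so that the two errors \<open>e * m\<close> together make up at most half
    of the assumed gap; \<open>m + 1\<close> avoids division by 0.\<close>
  define e where "e = \<bar>M a b - M b a\<bar> / (4 * (m + 1))"
  have m0: "m \<ge> 0" unfolding m_def by simp
  have e0: "e > 0" using ne m0 unfolding e_def by simp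
  obtain r0 where r0: "r0 > 0" "\<And>y y' v. y \<in> ball z r0 \<Longrightarrow> y' \<in> ball z r0 \<Longrightarrow>
      \<bar>\<phi>' y' v - \<phi>' y v - M (y' - y) v\<bar> \<le> e * norm (y' - y) * norm v"
    using app[OF e0] by blast
  define r where "r = min r0 \<rho>"
  define t where "t = r / (2 * (norm a + norm b + 1))"
  have r: "r > 0" "ball z r \<subseteq> ball z r0" "ball z r \<subseteq> ball z \<rho>" using r0 \<rho> unfolding r_def by auto
  have app_r: "\<bar>\<phi>' y' v - \<phi>' y v - M (y' - y) v\<bar> \<le> e * norm (y' - y) * norm v"
    if "y \<in> ball z r" "y' \<in> ball z r" for y y' v
    using r0(2) r(2) that by blast
  have der_r: "(\<phi> has_derivative \<phi>' y) (at y)" if "y \<in> ball z r" for y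
    using der r(3) that by blast
  have nn: "norm a + norm b + 1 > 0" by (simp add: add_nonneg_pos)
  have t: "t > 0" using r nn unfolding t_def by simp
  have "t * (norm a + norm b) \<le> t * (norm a + norm b + 1)" using t by (intro mult_left_mono) auto
  also have "\<dots> = r / 2" unfolding t_def using nn by (simp add: field_simps)
  also have "\<dots> < r" using r by simp
  finally have tr: "t * (norm a + norm b) < r" .
  have "\<bar>(\<phi> (z + t *\<^sub>R a + t *\<^sub>R b) - \<phi> (z + t *\<^sub>R a) - \<phi> (z + t *\<^sub>R b) + \<phi> z) / t\<^sup>2 - M b a\<bar> \<le> e * norm a * norm b"
    by (rule second_difference_estimate[where r = r and \<phi>' = \<phi>']) (fact app_r der_r hom t tr)+
  moreover have "\<bar>(\<phi> (z + t *\<^sub>R b + t *\<^sub>R a) - \<phi> (z + t *\<^sub>R b) - \<phi> (z + t *\<^sub>R a) + \<phi> z) / t\<^sup>2 - M a b\<bar> \<le> e * norm b * norm a"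
    by (rule second_difference_estimate[where r = r and \<phi>' = \<phi>'])
      (fact app_r der_r hom t tr[unfolded add.commute[of "norm a"]])+
  moreover have "\<phi> (z + t *\<^sub>R b + t *\<^sub>R a) - \<phi> (z + t *\<^sub>R b) - \<phi> (z + t *\<^sub>R a) + \<phi> z
    = \<phi> (z + t *\<^sub>R a + t *\<^sub>R b) - \<phi> (z + t *\<^sub>R a) - \<phi> (z + t *\<^sub>R b) + \<phi> z"
    by (simp add: algebra_simps)
  ultimately have "\<bar>M a b - M b a\<bar> \<le> 2 * (e * m)" unfolding m_def by (simp add: algebra_simps)
  also have "\<dots> \<le> 2 * (e * (m + 1))" using e0 by simp
  also have "\<dots> = \<bar>M a b - M b a\<bar> / 2" unfolding e_def using m0 by (simp add: field_simps)
  finally show False using ne by simp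
qed

text \<open>A minimizer of the Rayleigh quotient on the unit sphere is an eigenvector by symmetry,
  and the minimum is its eigenvalue.\<close>

lemma symmetric_operator_coercive:
  fixes M :: "'a::euclidean_space \<Rightarrow> 'a"
  assumes lin: "linear M" and sym: "\<And>x y. M x \<bullet> y = x \<bullet> M y"
    and ev: "\<And>\<mu> v. v \<noteq> 0 \<Longrightarrow> M v = \<mu> *\<^sub>R v \<Longrightarrow> \<alpha> < \<mu>"
  shows "\<alpha> * (norm v)\<^sup>2 \<le> M v \<bullet> v"
proof -
  obtain b :: 'a where b: "b \<in> Basis" using nonempty_Basis by blast
  have "continuous_on (sphere 0 1) (\<lambda>v. M v \<bullet> v)"
    by (intro continuous_intros linear_continuous_on linear_conv_bounded_linear[THEN iffD1] lin)
  moreover have "sphere (0::'a) 1 \<noteq> {}" using b by (auto intro!: exI[of _ b])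
  ultimately obtain e where e: "norm e = 1" "\<And>v. norm v = 1 \<Longrightarrow> M e \<bullet> e \<le> M v \<bullet> v"
    using continuous_attains_inf[of "sphere 0 1" "\<lambda>v. M v \<bullet> v"] by auto
  define \<mu> where "\<mu> = M e \<bullet> e"
  have min: "\<mu> * (norm v)\<^sup>2 \<le> M v \<bullet> v" for v
  proof (cases "v = 0")
    case True then show ?thesis using linear_0[OF lin] by simp
  next
    case False
    have "\<mu> \<le> M ((1 / norm v) *\<^sub>R v) \<bullet> ((1 / norm v) *\<^sub>R v)"
      unfolding \<mu>_def using False by (intro e(2)) simp
    then show ?thesis using False
      by (simp add: linear_scale[OF lin] power2_eq_square field_simps)
  qed
  have "M e = \<mu> *\<^sub>R e"
  proof -
    define d where "d = M e - \<mu> *\<^sub>R e"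
    define q where "q = \<bar>M d \<bullet> d - \<mu> * (norm d)\<^sup>2\<bar>"
    \<comment> \<open>First variation at the minimizer along its residual \<open>d\<close>: a linear
      term dominated by a quadratic one for every \<open>t\<close> must vanish, as small positive
      \<open>t\<close> shows.\<close>
    have ineq: "2 * t * (norm d)\<^sup>2 \<le> t\<^sup>2 * q" for t
    proof -
      have "(norm (e - t *\<^sub>R d))\<^sup>2 = (norm e)\<^sup>2 - 2 * t * (e \<bullet> d) + t\<^sup>2 * (norm d)\<^sup>2"
        unfolding power2_norm_eq_inner by (simp add: algebra_simps inner_commute power2_eq_square)
      moreover have "M (e - t *\<^sub>R d) \<bullet> (e - t *\<^sub>R d) = M e \<bullet> e - 2 * t * (M e \<bullet> d) + t\<^sup>2 * (M d \<bullet> d)"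
        using sym[of d e] by (simp add: linear_diff[OF lin] linear_scale[OF lin] algebra_simps inner_commute power2_eq_square)
      moreover note min[of "e - t *\<^sub>R d"]
      ultimately have "\<mu> * (1 - 2 * t * (e \<bullet> d) + t\<^sup>2 * (norm d)\<^sup>2) \<le> \<mu> - 2 * t * (M e \<bullet> d) + t\<^sup>2 * (M d \<bullet> d)"
        using e(1) by (simp add: \<mu>_def)
      then have "2 * t * (d \<bullet> d) \<le> t\<^sup>2 * (M d \<bullet> d - \<mu> * (norm d)\<^sup>2)"
        by (subst (2) d_def) (simp add: algebra_simps inner_commute[of d])
      also have "\<dots> \<le> t\<^sup>2 * q" unfolding q_def by (intro mult_left_mono) auto
      finally show ?thesis by (simp add: power2_norm_eq_inner)
    qed
    have "(norm d)\<^sup>2 \<le> 0"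
    proof (rule ccontr)
      assume "\<not> ?thesis"
      then have d0: "(norm d)\<^sup>2 > 0" by simp
      define t where "t = (norm d)\<^sup>2 / (q + 1)"
      have q0: "q \<ge> 0" unfolding q_def by simp
      then have t0: "t > 0" using d0 unfolding t_def by simp
      then have "2 * (norm d)\<^sup>2 \<le> t * q" using ineq[of t] by (simp add: power2_eq_square)
      also have "\<dots> \<le> t * (q + 1)" using t0 by simp
      also have "\<dots> = (norm d)\<^sup>2" unfolding t_def using q0 by simp
      finally show False using d0 by simp
    qed
    then show ?thesis unfolding d_def by simp
  qed
  then have "\<alpha> < \<mu>" using ev[of e \<mu>] e(1) by fastforce
  then have "\<alpha> * (norm v)\<^sup>2 \<le> \<mu> * (norm v)\<^sup>2" by (intro mult_right_mono) auto
  then show ?thesis using min[of v] by linarith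
qed

text \<open>The mean value theorem gives the slope at an interior point
  \<open>z + t *\<^sub>R d\<close>; strict monotonicity between \<open>z\<close> and that point,
  divided by \<open>t\<close>, compares it with the slope at \<open>z\<close>.\<close>

lemma strict_first_order_convexity:
  fixes \<phi> :: "'a::real_inner \<Rightarrow> real"
  assumes S: "convex S" "z \<in> S" "z' \<in> S" "z \<noteq> z'"
    and der: "\<And>y. y \<in> S \<Longrightarrow> (\<phi> has_derivative \<phi>' y) (at y)"
    and mono: "\<And>y y'. y \<in> S \<Longrightarrow> y' \<in> S \<Longrightarrow> y \<noteq> y' \<Longrightarrow> \<phi>' y' (y' - y) - \<phi>' y (y' - y) > 0"
  shows "\<phi> z' - \<phi> z - \<phi>' z (z' - z) > 0"
proof -
  define d where "d = z' - z"
  have lin: "\<phi>' y (c *\<^sub>R v) = c * \<phi>' y v" if "y \<in> S" for y c v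
    using linear_scale[OF has_derivative_linear[OF der[OF that]]] by simp
  have in_S: "z + t *\<^sub>R d \<in> S" if "0 \<le> t" "t \<le> 1" for t
    using convexD[OF S(1,2,3), of "1 - t" t] that unfolding d_def by (simp add: algebra_simps)
  have "\<exists>t>0. t < 1 \<and> \<phi> (z + 1 *\<^sub>R d) - \<phi> (z + 0 *\<^sub>R d) = (1 - 0) * \<phi>' (z + t *\<^sub>R d) d"
  proof (rule MVT2)
    fix t :: real assume t: "0 \<le> t" "t \<le> 1"
    have "((\<lambda>t. \<phi> (z + t *\<^sub>R d)) has_derivative (\<lambda>h. \<phi>' (z + t *\<^sub>R d) (h *\<^sub>R d))) (at t)"
      by (rule has_derivative_compose[where g = \<phi> and f = "\<lambda>t. z + t *\<^sub>R d", OF _ der[OF in_S[OF t]]])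
        (auto intro!: derivative_eq_intros)
    then show "((\<lambda>t. \<phi> (z + t *\<^sub>R d)) has_real_derivative \<phi>' (z + t *\<^sub>R d) d) (at t)"
      unfolding has_field_derivative_def by (simp add: lin[OF in_S[OF t]] mult.commute[of _ "\<phi>' (z + t *\<^sub>R d) d"])
  qed simp
  then obtain t where t: "0 < t" "t < 1" "\<phi> z' - \<phi> z = \<phi>' (z + t *\<^sub>R d) d" unfolding d_def by auto
  have "\<phi>' (z + t *\<^sub>R d) (t *\<^sub>R d) - \<phi>' z (t *\<^sub>R d) > 0"
    using mono[OF S(2) in_S[of t]] t S(4) unfolding d_def by auto
  then have "t * (\<phi>' (z + t *\<^sub>R d) d - \<phi>' z d) > 0"
    using lin[OF in_S[of t]] lin[OF S(2)] t by (simp add: algebra_simps)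
  then show ?thesis using t by (simp add: zero_less_mult_iff d_def)
qed

subsection \<open>Newton iteration on grid functions\<close>

text \<open>Dimension count inside a possibly infinite-dimensional space: a vector outside the image
  would extend the image of a basis to an independent set that is too large.\<close>

lemma linear_inj_on_finite_span_surj:
  fixes L :: "'a::real_vector \<Rightarrow> 'a"
  assumes lin: "linear L" and V: "V = span B" "finite B" and LV: "L ` V \<subseteq> V"
    and inj: "\<And>y. y \<in> V \<Longrightarrow> L y = 0 \<Longrightarrow> y = 0"
  shows "L ` V = V"
proof -
  obtain B' where B': "B' \<subseteq> B" "independent B'" "B \<subseteq> span B'"
    using maximal_independent_subset by blast
  have VB: "V = span B'"
    using B' V(1) by (metis span_mono span_span subset_antisym)
  have fin: "finite B'" using B'(1) V(2) finite_subset by blast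
  have inj': "inj_on L (span B')"
    unfolding linear_injective_on_subspace_0[OF lin subspace_span] using inj VB by blast
  have ind: "independent (L ` B')"
    by (rule linear_independent_injective_image[OF lin B'(2) inj'])
  have card: "card (L ` B') = card B'"
    by (rule card_image) (rule inj_on_subset[OF inj' span_superset])
  have LB: "L ` B' \<subseteq> V" using LV VB span_superset[of B'] by blast
  have "V \<subseteq> L ` V"
  proof
    fix v assume v: "v \<in> V"
    show "v \<in> L ` V"
    proof (rule ccontr)
      assume "v \<notin> L ` V"
      then have nsp: "v \<notin> span (L ` B')" using linear_span_image[OF lin, of B'] VB by simp
      then have "independent (insert v (L ` B'))" using ind by (simp add: independent_insert)
      moreover have "insert v (L ` B') \<subseteq> span B'" using v LB VB by blast
      ultimately have "card (insert v (L ` B')) \<le> card B'"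
        using independent_span_bound[OF fin] by blast
      moreover have "v \<notin> L ` B'" using nsp span_base by metis
      ultimately show False using card fin by simp
    qed
  qed
  then show ?thesis using LV by blast
qed

text \<open>Simplified Newton iteration y - L^(-1) F(y) with fixed \<open>L\<close>. Since L^(-1) is
  bounded by \<open>c\<close> on \<open>V\<close>, the allowed defect \<open>1 / (2 * c)\<close>
  gives contraction factor 1/2, and the ball of radius \<open>2 * c * norm (F 0)\<close> is mapped
  into itself.\<close>

lemma newton_kantorovich_subspace:
  fixes L F :: "'a::real_normed_vector \<Rightarrow> 'a"
  assumes lin: "linear L" and V: "V = span B" "finite B" and comp: "complete V" and LV: "L ` V \<subseteq> V"
    and stab: "\<And>y. y \<in> V \<Longrightarrow> norm y \<le> c * norm (L y)" and c: "c > 0"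
    and FV: "\<And>y. y \<in> V \<Longrightarrow> F y \<in> V"
    and lip: "\<And>y y'. y \<in> V \<Longrightarrow> y' \<in> V \<Longrightarrow> norm y \<le> r \<Longrightarrow> norm y' \<le> r \<Longrightarrow>
       norm (F y' - F y - L (y' - y)) \<le> norm (y' - y) / (2 * c)"
    and res: "2 * c * norm (F 0) \<le> r"
  shows "\<exists>y\<in>V. F y = 0 \<and> norm y \<le> 2 * c * norm (F 0)"
proof -
  have sub: "subspace V" using V by simp
  have inj: "y = 0" if "y \<in> V" "L y = 0" for y using stab[OF that(1)] that(2) by simp
  have surj: "L ` V = V" by (rule linear_inj_on_finite_span_surj[OF lin V LV inj])
  define G where "G y = (SOME x. x \<in> V \<and> L x = y)" for y
  have G: "G y \<in> V" "L (G y) = y" if "y \<in> V" for y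
  proof -
    have "y \<in> L ` V" using surj that by simp
    then have "\<exists>x. x \<in> V \<and> L x = y" by auto
    from someI_ex[OF this] show "G y \<in> V" "L (G y) = y" unfolding G_def by auto
  qed
  define \<Phi> where "\<Phi> y = y - G (F y)" for y
  define R where "R = 2 * c * norm (F 0)"
  define S where "S = V \<inter> cball 0 R"
  have zero: "0 \<in> V" using sub by (rule subspace_0)
  have \<Phi>V: "\<Phi> y \<in> V" if "y \<in> V" for y
    unfolding \<Phi>_def using that by (intro subspace_diff[OF sub] G FV)
  have contr: "norm (\<Phi> y' - \<Phi> y) \<le> 1/2 * norm (y' - y)" if y: "y \<in> V" "y' \<in> V" "norm y \<le> R" "norm y' \<le> R" for y y'
  proof -
    have "L (\<Phi> y' - \<Phi> y) = L (y' - y) - (F y' - F y)"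
      unfolding \<Phi>_def using G(2)[OF FV] y by (simp add: linear_diff[OF lin])
    then have "norm (L (\<Phi> y' - \<Phi> y)) = norm (F y' - F y - L (y' - y))"
      by (simp add: norm_minus_commute)
    also have "\<dots> \<le> norm (y' - y) / (2 * c)" using y res unfolding R_def by (intro lip) auto
    finally have "c * norm (L (\<Phi> y' - \<Phi> y)) \<le> c * (norm (y' - y) / (2 * c))"
      using c by (intro mult_left_mono) auto
    then show ?thesis using stab[OF subspace_diff[OF sub \<Phi>V[OF y(2)] \<Phi>V[OF y(1)]]] c by simp
  qed
  have \<Phi>0: "norm (\<Phi> 0) \<le> R / 2"
    using stab[OF \<Phi>V[OF zero]] G(2)[OF FV[OF zero]] unfolding \<Phi>_def R_def
    by (simp add: linear_neg[OF lin])
  have R0: "R \<ge> 0" unfolding R_def using c by simp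
  have "\<exists>!x\<in>S. \<Phi> x = x"
  proof (rule Banach_fix[where c = "1/2"])
    show "complete S" unfolding S_def by (intro complete_Int_closed comp closed_cball)
    show "S \<noteq> {}" unfolding S_def using zero R0 by auto
    show "\<Phi> ` S \<subseteq> S"
    proof
      fix x assume "x \<in> \<Phi> ` S"
      then obtain y where y: "y \<in> V" "norm y \<le> R" "x = \<Phi> y" unfolding S_def by auto
      have "norm (\<Phi> y) \<le> norm (\<Phi> y - \<Phi> 0) + norm (\<Phi> 0)"
        using norm_triangle_ineq[of "\<Phi> y - \<Phi> 0" "\<Phi> 0"] by simp
      also have "\<dots> \<le> 1/2 * norm (y - 0) + R / 2" using y zero R0 \<Phi>0 by (intro add_mono contr) auto
      also have "\<dots> \<le> R" using y by simp
      finally show "x \<in> S" unfolding S_def using y \<Phi>V by simp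
    qed
    show "dist (\<Phi> x) (\<Phi> y) \<le> 1/2 * dist x y" if "x \<in> S" "y \<in> S" for x y
      using contr[of y x] that unfolding S_def by (simp add: dist_norm)
  qed auto
  then obtain y where y: "y \<in> V" "norm y \<le> R" "\<Phi> y = y" unfolding S_def by auto
  have "G (F y) = 0" using y(3) unfolding \<Phi>_def by simp
  then have "F y = 0" using G(2)[OF FV[OF y(1)]] linear_0[OF lin] by simp
  then show ?thesis using y unfolding R_def by blast
qed

text \<open>\<open>N\<close> is a term, so the N-fold product is realized as a subspace of the
  bounded functions on the discrete space \<open>nat\<close>. Their norm is the maximum over nodes,
  the norm in which convergence is claimed.\<close>

definition grid_fun :: "nat \<Rightarrow> (nat \<Rightarrow> 'a) \<Rightarrow> nat \<Rightarrow>\<^sub>C ('a::real_normed_vector)" where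
  "grid_fun N g = Bcontfun (\<lambda>i. if i \<in> {1..N} then g i else 0)"

definition grid_space :: "nat \<Rightarrow> (nat \<Rightarrow>\<^sub>C ('a::real_normed_vector)) set" where
  "grid_space N = {y. \<forall>i. i \<notin> {1..N} \<longrightarrow> apply_bcontfun y i = 0}"

lemma apply_grid_fun: "apply_bcontfun (grid_fun N g) i = (if i \<in> {1..N} then g i else 0)"
proof -
  have "(\<lambda>i. if i \<in> {1..N} then g i else 0) \<in> bcontfun"
  proof (rule bcontfun_normI)
    show "continuous_on UNIV (\<lambda>i. if i \<in> {1..N} then g i else 0)" 
      by (simp add: continuous_on_open_vimage open_discrete)
    show "norm (if i \<in> {1..N} then g i else 0) \<le> (\<Sum>j=1..N. norm (g j))" for i
      by (auto intro!: member_le_sum sum_nonneg)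
  qed
  then show ?thesis unfolding grid_fun_def by (simp add: Bcontfun_inverse)
qed

lemma grid_fun_in_space: "grid_fun N g \<in> grid_space N"
  unfolding grid_space_def by (simp add: apply_grid_fun)

lemma norm_grid_le:
  assumes "y \<in> grid_space N" "\<And>i. i \<in> {1..N} \<Longrightarrow> norm (apply_bcontfun y i) \<le> b" "b \<ge> 0"
  shows "norm y \<le> b"
proof (rule norm_bound)
  fix i
  show "norm (apply_bcontfun y i) \<le> b"
    using assms unfolding grid_space_def by (cases "i \<in> {1..N}") auto
qed

lemma subspace_grid_space: "subspace (grid_space N)"
  unfolding subspace_def grid_space_def by auto

text \<open>Node values converge separately, and the supremum norm of a grid function is at most the
  finite sum of its nodal norms.\<close>

lemma complete_grid_space: "complete (grid_space N :: (nat \<Rightarrow>\<^sub>C ('a::banach)) set)"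
  unfolding complete_def
proof (intro allI impI)
  fix y :: "nat \<Rightarrow> nat \<Rightarrow>\<^sub>C 'a" assume y: "(\<forall>n. y n \<in> grid_space N) \<and> Cauchy y"
  have bl: "bounded_linear (\<lambda>y :: nat \<Rightarrow>\<^sub>C 'a. apply_bcontfun y i)" for i
    by (rule bounded_linear_intro[where K = 1]) (auto simp: norm_bounded)
  have "\<exists>l. (\<lambda>n. apply_bcontfun (y n) i) \<longlonglongrightarrow> l" for i
    using bounded_linear.Cauchy[OF bl, of y i] y Cauchy_convergent unfolding convergent_def by blast
  then obtain l where l: "\<And>i. (\<lambda>n. apply_bcontfun (y n) i) \<longlonglongrightarrow> l i" by metis
  have "y \<longlonglongrightarrow> grid_fun N l"
  proof (rule LIM_zero_cancel, rule Lim_null_comparison)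
    show "\<forall>\<^sub>F n in sequentially. norm (y n - grid_fun N l) \<le> (\<Sum>i=1..N. norm (apply_bcontfun (y n) i - l i))"
    proof (intro always_eventually allI norm_grid_le[of _ N])
      fix n
      show "y n - grid_fun N l \<in> grid_space N"
        using y by (intro subspace_diff[OF subspace_grid_space] grid_fun_in_space) auto
      show "norm (apply_bcontfun (y n - grid_fun N l) i) \<le> (\<Sum>i=1..N. norm (apply_bcontfun (y n) i - l i))"
        if "i \<in> {1..N}" for i
        using that member_le_sum[of i "{1..N}" "\<lambda>i. norm (apply_bcontfun (y n) i - l i)"] by (simp add: apply_grid_fun)
    qed (auto intro: sum_nonneg)
    show "(\<lambda>n. \<Sum>i=1..N. norm (apply_bcontfun (y n) i - l i)) \<longlonglongrightarrow> 0"
      by (intro tendsto_null_sum tendsto_norm_zero LIM_zero l)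
  qed
  then show "\<exists>l\<in>grid_space N. y \<longlonglongrightarrow> l" using grid_fun_in_space by blast
qed

lemma grid_space_span:
  "\<exists>B. finite B \<and> (grid_space N :: (nat \<Rightarrow>\<^sub>C ('a::euclidean_space)) set) = span B"
proof -
  define e :: "nat \<times> 'a \<Rightarrow> nat \<Rightarrow>\<^sub>C 'a" where "e = (\<lambda>(j, b). grid_fun N (\<lambda>i. if i = j then b else 0))"
  define B where "B = e ` ({1..N} \<times> Basis)"
  have "span B \<subseteq> grid_space N"
    by (rule span_minimal[OF _ subspace_grid_space]) (auto simp: B_def e_def grid_fun_in_space)
  moreover have "y \<in> span B" if y: "y \<in> grid_space N" for y
  proof -
    have "y = (\<Sum>(j, b)\<in>{1..N} \<times> Basis. (apply_bcontfun y j \<bullet> b) *\<^sub>R e (j, b))"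
    proof (rule bcontfun_eqI)
      fix i
      have ap: "apply_bcontfun (sum g A) i = (\<Sum>a\<in>A. apply_bcontfun (g a) i)" for g :: "nat \<times> 'a \<Rightarrow> nat \<Rightarrow>\<^sub>C 'a" and A
        by (induction A rule: infinite_finite_induct) auto
      have "apply_bcontfun (\<Sum>(j, b)\<in>{1..N} \<times> Basis. (apply_bcontfun y j \<bullet> b) *\<^sub>R e (j, b)) i =
        (\<Sum>(j, b)\<in>{1..N} \<times> Basis. (apply_bcontfun y j \<bullet> b) *\<^sub>R (if i \<in> {1..N} \<and> i = j then b else 0))"
        unfolding ap by (intro sum.cong) (auto simp: e_def apply_grid_fun)
      also have "\<dots> = (\<Sum>j\<in>{1..N}. \<Sum>b\<in>Basis. (apply_bcontfun y j \<bullet> b) *\<^sub>R (if i \<in> {1..N} \<and> i = j then b else 0))"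
        by (simp add: sum.cartesian_product)
      also have "\<dots> = (\<Sum>j\<in>{1..N}. if j = i then apply_bcontfun y i else 0)"
        by (intro sum.cong refl) (auto simp: euclidean_representation)
      also have "\<dots> = apply_bcontfun y i" using y unfolding grid_space_def by auto
      finally show "apply_bcontfun y i = apply_bcontfun (\<Sum>(j, b)\<in>{1..N} \<times> Basis. (apply_bcontfun y j \<bullet> b) *\<^sub>R e (j, b)) i" ..
    qed
    also have "\<dots> \<in> span B"
      by (intro span_sum) (auto simp: B_def intro!: span_scale[OF span_base])
    finally show ?thesis .
  qed
  ultimately have "grid_space N = span B" by blast
  moreover have "finite B" unfolding B_def by simp
  ultimately show ?thesis by blast
qed

subsection \<open>Gradients and Hessians as Frechet derivatives\<close>

lemma frechet_derivative_eqI: "(f has_derivative f') (at x) \<Longrightarrow> frechet_derivative f (at x) = f'"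
  using frechet_derivative_at by metis

lemma gradients_eq_riesz:
  fixes f :: "real^'n \<Rightarrow> real^'m \<Rightarrow> real^'n"
  assumes der: "((\<lambda>z. f (fst z) (snd z)) has_derivative G) (at (x, u))"
  shows "(gradx_H f x u lam, gradu_H f x u lam) = riesz (\<lambda>v. lam \<bullet> G v)"
proof -
  have lin: "linear (\<lambda>v. lam \<bullet> G v)"
    using has_derivative_linear[OF der] by (auto simp: linear_iff inner_add_right)
  have "((\<lambda>y. f (fst (y, u)) (snd (y, u))) has_derivative (\<lambda>v. G (v, 0))) (at x)"
    by (rule has_derivative_compose[where g = "\<lambda>z. f (fst z) (snd z)" and f = "\<lambda>y. (y, u)", OF _ der])
      (auto intro!: derivative_eq_intros)
  then have "((\<lambda>y. Ham f y u lam) has_derivative (\<lambda>v. lam \<bullet> G (v, 0))) (at x)"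
    unfolding Ham_def by (auto intro: has_derivative_inner_right)
  from frechet_derivative_eqI[OF this]
  have 1: "gradx_H f x u lam $ i = riesz (\<lambda>v. lam \<bullet> G v) \<bullet> (axis i 1, 0)" for i
    unfolding gradx_H_def grad_def riesz_inner[OF lin] by simp
  have "((\<lambda>v. f (fst (x, v)) (snd (x, v))) has_derivative (\<lambda>v. G (0, v))) (at u)"
    by (rule has_derivative_compose[where g = "\<lambda>z. f (fst z) (snd z)" and f = "\<lambda>v. (x, v)", OF _ der])
      (auto intro!: derivative_eq_intros)
  then have "((\<lambda>v. Ham f x v lam) has_derivative (\<lambda>v. lam \<bullet> G (0, v))) (at u)"
    unfolding Ham_def by (auto intro: has_derivative_inner_right)
  from frechet_derivative_eqI[OF this]
  have 2: "gradu_H f x u lam $ i = riesz (\<lambda>v. lam \<bullet> G v) \<bullet> (0, axis i 1)" for i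
    unfolding gradu_H_def grad_def riesz_inner[OF lin] by simp
  show ?thesis
    using 1 2 by (intro prod_eqI) (auto simp: vec_eq_iff inner_prod_def inner_axis)
qed

lemma grad_eq_riesz:
  fixes C :: "real^'k \<Rightarrow> real"
  assumes der: "(C has_derivative G) (at x)"
  shows "grad C x = riesz G"
proof -
  have "grad C x $ i = riesz G $ i" for i
    using riesz_inner[OF has_derivative_linear[OF der], of "axis i 1"]
    unfolding grad_def frechet_derivative_eqI[OF der] by (simp add: inner_axis)
  then show ?thesis by (simp add: vec_eq_iff)
qed

lemma has_derivative_blinfun_apply_at:
  assumes "(g has_derivative g') (at z)"
  shows "((\<lambda>w. blinfun_apply (g w) v) has_derivative (\<lambda>h. blinfun_apply (g' h) v)) (at z)"
  by (rule bounded_linear.has_derivative[OF blinfun.bounded_linear_left assms])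

text \<open>\<open>hess\<close> differentiates \<open>grad\<close>, so \<open>grad\<close> has to
  agree with \<open>DC\<close> on a neighbourhood of \<open>x\<close>; this is the purpose of the
  open set.\<close>

lemma hess_eq_second_derivative:
  fixes C :: "real^'k \<Rightarrow> real"
  assumes S: "open S" "x \<in> S" and der: "\<And>y. y \<in> S \<Longrightarrow> (C has_derivative blinfun_apply (DC y)) (at y)"
    and der2: "(DC has_derivative D2C) (at x)"
  shows "hess C x $ i $ j = D2C (axis i 1) (axis j 1)"
proof -
  have "((\<lambda>y. grad C y $ j) has_derivative (\<lambda>h. D2C h (axis j 1))) (at x)"
  proof (rule has_derivative_transform_within_open[OF has_derivative_blinfun_apply_at[OF der2] S])
    fix y assume "y \<in> S"
    show "blinfun_apply (DC y) (axis j 1) = grad C y $ j"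
      unfolding grad_def frechet_derivative_eqI[OF der[OF \<open>y \<in> S\<close>]] by simp
  qed
  from frechet_derivative_eqI[OF this] show ?thesis unfolding hess_def by simp
qed

lemma hess_pair_eq_second_derivative:
  fixes f :: "real^'n \<Rightarrow> real^'m \<Rightarrow> real^'n"
  assumes S: "open S" "z \<in> S"
    and der: "\<And>y. y \<in> S \<Longrightarrow> ((\<lambda>z. f (fst z) (snd z)) has_derivative blinfun_apply (Dg y)) (at y)"
    and der2: "(Dg has_derivative D2g) (at z)"
  shows "hess_pair (\<lambda>z. Ham f (fst z) (snd z) lam) z $ a $ b = lam \<bullet> D2g (pdir a) (pdir b)"
proof -
  have "((\<lambda>w. frechet_derivative (\<lambda>z. Ham f (fst z) (snd z) lam) (at w) (pdir b)) has_derivative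
      (\<lambda>h. lam \<bullet> D2g h (pdir b))) (at z)"
  proof (rule has_derivative_transform_within_open[OF has_derivative_inner_right[OF has_derivative_blinfun_apply_at[OF der2]] S])
    fix y assume "y \<in> S"
    then have "((\<lambda>z. Ham f (fst z) (snd z) lam) has_derivative (\<lambda>v. lam \<bullet> Dg y v)) (at y)"
      unfolding Ham_def by (intro has_derivative_inner_right der)
    from frechet_derivative_eqI[OF this]
    show "lam \<bullet> blinfun_apply (Dg y) (pdir b) = frechet_derivative (\<lambda>z. Ham f (fst z) (snd z) lam) (at y) (pdir b)"
      by simp
  qed
  from frechet_derivative_eqI[OF this] show ?thesis unfolding hess_pair_def by simp
qed

text \<open>The coordinates of an eigenvector of the operator representing \<open>M\<close> form an
  eigenvector of \<open>A\<close>, nonzero by \<open>rep\<close>. The system \<open>d\<close> stays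
  general so that it can be \<open>axis\<close> for \<open>C\<close> and \<open>pdir\<close> for the
  Hamiltonian.\<close>

lemma eigenvalues_gt_imp_coercive:
  fixes M :: "'a::euclidean_space \<Rightarrow> 'a \<Rightarrow> real" and A :: "real^'k^'k" and d :: "'k \<Rightarrow> 'a"
  assumes ev: "eigenvalues_gt A \<alpha>" and bil: "bilinear M" and sym: "\<And>x y. M x y = M y x"
    and A: "\<And>a b. A $ a $ b = M (d a) (d b)"
    and rep: "\<And>z. z = (\<Sum>a\<in>UNIV. (z \<bullet> d a) *\<^sub>R d a)"
  shows "\<alpha> * (norm z)\<^sup>2 \<le> M z z"
proof -
  define K where "K z = riesz (M z)" for z
  have l1: "linear (M x)" and l2: "linear (\<lambda>x. M x y)" for x y using bil unfolding bilinear_def by auto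
  have K: "K x \<bullet> y = M x y" for x y unfolding K_def by (rule riesz_inner[OF l1])
  have "\<alpha> * (norm z)\<^sup>2 \<le> K z \<bullet> z"
  proof (rule symmetric_operator_coercive)
    show "linear K"
    proof (rule linearI)
      show "K (x + y) = K x + K y" for x y
        by (rule inner_eq_all_imp_eq) (simp add: K inner_add_left linear_add[OF l2])
      show "K (c *\<^sub>R x) = c *\<^sub>R K x" for c x
        by (rule inner_eq_all_imp_eq) (simp add: K linear_scale[OF l2])
    qed
    show "K x \<bullet> y = x \<bullet> K y" for x y using sym[of x y] K by (simp add: inner_commute[of x])
    fix \<mu> v assume v: "v \<noteq> 0" "K v = \<mu> *\<^sub>R v"
    define q :: "real^'k" where "q = (\<chi> a. v \<bullet> d a)"
    have "q \<noteq> 0"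
    proof
      assume "q = 0"
      then have "v \<bullet> d a = 0" for a unfolding q_def by (simp add: vec_eq_iff)
      then show False using rep[of v] v(1) by simp
    qed
    moreover have "A *v q = \<mu> *\<^sub>R q"
    proof -
      have "(A *v q) $ a = \<mu> * (v \<bullet> d a)" for a
      proof -
        have "(A *v q) $ a = (\<Sum>b\<in>UNIV. (v \<bullet> d b) * M (d a) (d b))"
          by (simp add: matrix_vector_mult_def A q_def mult.commute)
        also have "\<dots> = M (d a) (\<Sum>b\<in>UNIV. (v \<bullet> d b) *\<^sub>R d b)"
          by (simp only: linear_sum[OF l1] linear_scale[OF l1] real_scaleR_def)
        also have "\<dots> = K v \<bullet> d a" using rep[of v] sym[of "d a" v] by (simp add: K)
        finally show ?thesis unfolding v(2) by simp
      qed
      then show ?thesis by (simp add: vec_eq_iff q_def)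
    qed
    ultimately show "\<alpha> < \<mu>" using ev unfolding eigenvalues_gt_def by blast
  qed
  then show ?thesis by (simp add: K)
qed

lemma axis_expansion: "(x::real^'k) = (\<Sum>a\<in>UNIV. (x \<bullet> axis a 1) *\<^sub>R axis a 1)"
  by (simp add: vec_eq_iff inner_axis) (simp add: axis_def if_distrib[of "(*) _"] cong: if_cong)

lemma pdir_expansion:
  fixes z :: "(real^'n) \<times> (real^'m)"
  shows "z = (\<Sum>a\<in>UNIV. (z \<bullet> pdir a) *\<^sub>R pdir a)"
proof -
  have "(\<Sum>a\<in>UNIV. (z \<bullet> pdir a) *\<^sub>R pdir a) =
     (\<Sum>i\<in>UNIV. (z \<bullet> pdir (Inl i)) *\<^sub>R pdir (Inl i)) + (\<Sum>j\<in>UNIV. (z \<bullet> pdir (Inr j)) *\<^sub>R pdir (Inr j))"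
    unfolding UNIV_Plus_UNIV[symmetric] by (subst sum.Plus) auto
  also have "\<dots> = (\<Sum>i\<in>UNIV. ((fst z \<bullet> axis i 1) *\<^sub>R axis i 1, 0)) + (\<Sum>j\<in>UNIV. (0, (snd z \<bullet> axis j 1) *\<^sub>R axis j 1))"
    by (simp add: pdir_def inner_prod_def)
  also have "\<dots> = (\<Sum>i\<in>UNIV. (fst z \<bullet> axis i 1) *\<^sub>R axis i 1, \<Sum>j\<in>UNIV. (snd z \<bullet> axis j 1) *\<^sub>R axis j 1)"
    by (intro prod_eqI) (simp_all add: fst_sum snd_sum)
  also have "\<dots> = z" unfolding axis_expansion[symmetric] by simp
  finally show ?thesis ..
qed

lemma mat_inf_norm_component_le:
  fixes A :: "real^'k^'k"
  assumes "mat_inf_norm A \<le> q" "\<And>l. \<bar>y $ l\<bar> \<le> c"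
  shows "\<bar>(A *v y) $ k\<bar> \<le> q * c"
proof -
  have c0: "c \<ge> 0" using order_trans[OF abs_ge_zero assms(2)] .
  have row: "(\<Sum>j\<in>UNIV. \<bar>A $ k $ j\<bar>) \<le> q"
    using assms(1) unfolding mat_inf_norm_def by (auto simp: Max_le_iff)
  have "\<bar>(A *v y) $ k\<bar> \<le> (\<Sum>j\<in>UNIV. \<bar>A $ k $ j * y $ j\<bar>)"
    unfolding matrix_vector_mult_def by (simp add: sum_abs)
  also have "\<dots> \<le> (\<Sum>j\<in>UNIV. \<bar>A $ k $ j\<bar> * c)" by (intro sum_mono) (simp add: abs_mult mult_left_mono assms(2))
  also have "\<dots> \<le> q * c" unfolding sum_distrib_right[symmetric] using row c0 by (rule mult_right_mono)
  finally show ?thesis .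
qed

text \<open>Translates the two matrix norms of (A3) into statements on the derivative and on its
  adjoint.\<close>

lemma jac_x_mult:
  fixes f :: "real^'n \<Rightarrow> real^'m \<Rightarrow> real^'n"
  assumes der: "((\<lambda>z. f (fst z) (snd z)) has_derivative G) (at (x, u))"
  shows "jac_x f x u *v y = G (y, 0)"
    and "transpose (jac_x f x u) *v y = fst (riesz (\<lambda>v. y \<bullet> G v))"
proof -
  have "((\<lambda>y. f (fst (y, u)) (snd (y, u))) has_derivative (\<lambda>v. G (v, 0))) (at x)"
    by (rule has_derivative_compose[where g = "\<lambda>z. f (fst z) (snd z)" and f = "\<lambda>y. (y, u)", OF _ der])
      (auto intro!: derivative_eq_intros)
  then have d: "((\<lambda>y. f y u) has_derivative (\<lambda>v. G (v, 0))) (at x)" by simp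
  show 1: "jac_x f x u *v y = G (y, 0)" for y
    unfolding jac_x_def frechet_derivative_eqI[OF d]
    using matrix_vector_mul(2)[OF has_derivative_linear[OF d]] by metis
  have lin: "linear (\<lambda>v. y \<bullet> G v)"
    using has_derivative_linear[OF der] by (auto simp: linear_iff inner_add_right)
  show "transpose (jac_x f x u) *v y = fst (riesz (\<lambda>v. y \<bullet> G v))"
  proof (rule inner_eq_all_imp_eq)
    fix v
    have "(transpose (jac_x f x u) *v y) \<bullet> v = y \<bullet> (jac_x f x u *v v)"
      by (simp add: dot_lmul_matrix)
    also have "\<dots> = riesz (\<lambda>v. y \<bullet> G v) \<bullet> (v, 0)" by (simp add: 1 riesz_inner[OF lin])
    finally show "(transpose (jac_x f x u) *v y) \<bullet> v = fst (riesz (\<lambda>v. y \<bullet> G v)) \<bullet> v"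
      by (simp add: inner_prod_def)
  qed
qed

lemma linear_inner_blinfun: "linear (\<lambda>v. a \<bullet> blinfun_apply F v)"
  by (rule linearI) (simp_all add: blinfun.add_right blinfun.scaleR_right inner_add_right)

lemma inner_blinfun_le: "\<bar>a \<bullet> blinfun_apply F v\<bar> \<le> norm a * norm F * norm v"
proof -
  have "\<bar>a \<bullet> blinfun_apply F v\<bar> \<le> norm a * norm (blinfun_apply F v)" by (rule Cauchy_Schwarz_ineq2)
  also have "\<dots> \<le> norm a * (norm F * norm v)" by (intro mult_left_mono norm_blinfun) auto
  finally show ?thesis by (simp add: mult.assoc)
qed

lemma bounded_image_norm_le:
  assumes "compact S" "continuous_on S g"
  shows "\<exists>B\<ge>0. \<forall>t\<in>S. norm (g t) \<le> B"
proof -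
  obtain B where "\<forall>x\<in>g ` S. norm x \<le> B"
    using compact_imp_bounded[OF compact_continuous_image[OF assms(2,1)]] unfolding bounded_iff by blast
  then show ?thesis by (intro exI[of _ "max B 0"]) (auto simp: le_max_iff_disj)
qed

text \<open>Derivatives are recorded on the open set and the open ball only, where derivatives
  within the closure are full derivatives.\<close>

locale smooth_control_problem =
  fixes f :: "real^'n \<Rightarrow> real^'m \<Rightarrow> real^'n" and C :: "real^'n \<Rightarrow> real"
    and xs :: "real \<Rightarrow> real^'n" and us :: "real \<Rightarrow> real^'m" and lams :: "real \<Rightarrow> real^'n"
    and \<Omega> :: "((real^'n) \<times> (real^'m)) set" and \<rho> \<alpha> :: real
    and Dg :: "(real^'n) \<times> (real^'m) \<Rightarrow> ((real^'n) \<times> (real^'m)) \<Rightarrow>\<^sub>L (real^'n)"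
    and D2g :: "(real^'n) \<times> (real^'m) \<Rightarrow> ((real^'n) \<times> (real^'m)) \<Rightarrow>\<^sub>L (((real^'n) \<times> (real^'m)) \<Rightarrow>\<^sub>L (real^'n))"
    and DC :: "real^'n \<Rightarrow> (real^'n) \<Rightarrow>\<^sub>L real"
    and D2C :: "real^'n \<Rightarrow> (real^'n) \<Rightarrow>\<^sub>L ((real^'n) \<Rightarrow>\<^sub>L real)"
  assumes Omega_open: "open \<Omega>" and rho_pos: "\<rho> > 0" and alpha_pos: "\<alpha> > 0"
    and balls: "\<And>t. t \<in> {-1..1} \<Longrightarrow> cball (xs t, us t) \<rho> \<subseteq> \<Omega>"
    and Dg: "\<And>z. z \<in> \<Omega> \<Longrightarrow> ((\<lambda>z. f (fst z) (snd z)) has_derivative blinfun_apply (Dg z)) (at z)"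
    and D2g: "\<And>z. z \<in> \<Omega> \<Longrightarrow> (Dg has_derivative blinfun_apply (D2g z)) (at z)"
    and Dg_cont: "continuous_on \<Omega> Dg" and D2g_cont: "continuous_on \<Omega> D2g"
    and DC: "\<And>x. x \<in> ball (xs 1) \<rho> \<Longrightarrow> (C has_derivative blinfun_apply (DC x)) (at x)"
    and D2C: "\<And>x. x \<in> ball (xs 1) \<rho> \<Longrightarrow> (DC has_derivative blinfun_apply (D2C x)) (at x)"
    and D2C_cont: "continuous_on (ball (xs 1) \<rho>) D2C"
    and xs_cont: "continuous_on {-1..1} xs" and us_cont: "continuous_on {-1..1} us"
    and lams_cont: "continuous_on {-1..1} lams"
    and hess_C: "eigenvalues_gt (hess C (xs 1)) \<alpha>"
    and hess_H: "\<And>t. t \<in> {-1..1} \<Longrightarrow>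
        eigenvalues_gt (hess_pair (\<lambda>z. Ham f (fst z) (snd z) (lams t)) (xs t, us t)) \<alpha>"
    and jac_small: "\<And>t. t \<in> {-1..1} \<Longrightarrow> mat_inf_norm (jac_x f (xs t) (us t)) \<le> 1/4 \<and>
        mat_inf_norm (transpose (jac_x f (xs t) (us t))) \<le> 1/4"
begin

definition zs :: "real \<Rightarrow> (real^'n) \<times> (real^'m)" where "zs t = (xs t, us t)"

text \<open>The gradient of the Hamiltonian in \<open>(x, u)\<close> at \<open>z\<close>; as a function of \<open>lam\<close>, the adjoint of \<open>Dg z\<close>.\<close>

definition gH :: "(real^'n) \<times> (real^'m) \<Rightarrow> real^'n \<Rightarrow> (real^'n) \<times> (real^'m)" where
  "gH z lam = riesz (\<lambda>v. lam \<bullet> Dg z v)"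

text \<open>The Hessian in \<open>(x, u)\<close> of the Hamiltonian at the optimum, with multiplier
  \<open>lams t\<close>, read as an operator; likewise \<open>T\<close> for the Hessian of
  \<open>C\<close> at \<open>xs 1\<close>.\<close>

definition K :: "real \<Rightarrow> (real^'n) \<times> (real^'m) \<Rightarrow> (real^'n) \<times> (real^'m)" where
  "K t v = riesz (\<lambda>v'. lams t \<bullet> D2g (zs t) v v')"

definition T :: "real^'n \<Rightarrow> real^'n" where
  "T v = riesz (\<lambda>v'. D2C (xs 1) v v')"

definition gC :: "real^'n \<Rightarrow> real^'n" where
  "gC x = riesz (\<lambda>v. DC x v)"

lemma zs_in: "t \<in> {-1..1} \<Longrightarrow> zs t \<in> \<Omega>"
  using balls[of t] rho_pos unfolding zs_def by auto

lemma gH_inner: "gH z lam \<bullet> v = lam \<bullet> Dg z v"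
  unfolding gH_def by (rule riesz_inner[OF linear_inner_blinfun])

lemma K_inner: "K t v \<bullet> v' = lams t \<bullet> D2g (zs t) v v'"
  unfolding K_def by (rule riesz_inner[OF linear_inner_blinfun])

lemma T_inner: "T v \<bullet> v' = D2C (xs 1) v v'"
  unfolding T_def by (rule riesz_inner[OF bounded_linear.linear[OF blinfun.bounded_linear_right]])

lemma gC_inner: "gC x \<bullet> v = DC x v"
  unfolding gC_def by (rule riesz_inner[OF bounded_linear.linear[OF blinfun.bounded_linear_right]])

lemma gradients_eq_gH:
  assumes "(x, u) \<in> \<Omega>"
  shows "gradx_H f x u lam = fst (gH (x, u) lam)" "gradu_H f x u lam = snd (gH (x, u) lam)"
  using gradients_eq_riesz[OF Dg[OF assms], of lam] unfolding gH_def by (metis fst_conv, metis snd_conv)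

lemma grad_eq_gC: "x \<in> ball (xs 1) \<rho> \<Longrightarrow> grad C x = gC x"
  unfolding gC_def using grad_eq_riesz[OF DC] by simp

lemma linear_K: "linear (K t)"
proof (rule linearI)
  show "K t (x + y) = K t x + K t y" for x y
    by (rule inner_eq_all_imp_eq) (simp add: K_inner inner_add_left inner_add_right blinfun.add_right blinfun.add_left)
  show "K t (c *\<^sub>R x) = c *\<^sub>R K t x" for c x
    by (rule inner_eq_all_imp_eq) (simp add: K_inner blinfun.scaleR_right blinfun.scaleR_left)
qed

lemma linear_T: "linear T"
proof (rule linearI)
  show "T (x + y) = T x + T y" for x y
    by (rule inner_eq_all_imp_eq) (simp add: T_inner inner_add_left blinfun.add_right blinfun.add_left)
  show "T (c *\<^sub>R x) = c *\<^sub>R T x" for c x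
    by (rule inner_eq_all_imp_eq) (simp add: T_inner blinfun.scaleR_right blinfun.scaleR_left)
qed

lemma linear_gH: "linear (gH z)"
proof (rule linearI)
  show "gH z (x + y) = gH z x + gH z y" for x y
    by (rule inner_eq_all_imp_eq) (simp add: gH_inner inner_add_left)
  show "gH z (c *\<^sub>R x) = c *\<^sub>R gH z x" for c x
    by (rule inner_eq_all_imp_eq) (simp add: gH_inner)
qed

text \<open>\<open>eigenvalues_gt\<close> constrains real eigenvalues only, so symmetry of the
  second derivative is established first, from strict differentiability of \<open>Dg\<close> at
  \<open>zs t\<close>.\<close>

lemma K_coercive:
  assumes t: "t \<in> {-1..1}"
  shows "\<alpha> * (norm v)\<^sup>2 \<le> K t v \<bullet> v"
proof -
  define M where "M a b = lams t \<bullet> D2g (zs t) a b" for a b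
  have sym: "M a b = M b a" for a b
  proof (rule second_derivative_symmetric[where z = "zs t" and \<rho> = \<rho>
        and \<phi> = "\<lambda>z. lams t \<bullet> f (fst z) (snd z)" and \<phi>' = "\<lambda>y v. lams t \<bullet> Dg y v"])
    fix y assume "y \<in> ball (zs t) \<rho>"
    then have "y \<in> \<Omega>" using balls[OF t] unfolding zs_def by auto
    then show "((\<lambda>z. lams t \<bullet> f (fst z) (snd z)) has_derivative (\<lambda>v. lams t \<bullet> Dg y v)) (at y)"
      by (intro has_derivative_inner_right Dg)
  next
    fix e :: real assume e: "e > 0"
    define e' where "e' = e / (norm (lams t) + 1)"
    have n1: "norm (lams t) + 1 > 0" by (simp add: add_nonneg_pos)
    have e': "e' > 0" using e n1 unfolding e'_def by simp
    obtain r where r: "r > 0" and app: "\<And>y y'. y \<in> cball (zs t) r \<Longrightarrow> y' \<in> cball (zs t) r \<Longrightarrow>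
        norm (Dg y' - Dg y - D2g (zs t) (y' - y)) \<le> e' * norm (y' - y)"
      using uniform_strict_differentiability[OF Omega_open compact_sing[of "zs t"] rho_pos _ D2g D2g_cont e'] balls[OF t]
      unfolding zs_def[symmetric] by (metis (no_types, lifting) singletonD singletonI)
    show "\<exists>r>0. \<forall>y\<in>ball (zs t) r. \<forall>y'\<in>ball (zs t) r. \<forall>v.
        \<bar>lams t \<bullet> Dg y' v - lams t \<bullet> Dg y v - M (y' - y) v\<bar> \<le> e * norm (y' - y) * norm v"
    proof (intro exI[of _ r] conjI ballI allI r)
      fix y y' v assume y: "y \<in> ball (zs t) r" "y' \<in> ball (zs t) r"
      have "lams t \<bullet> Dg y' v - lams t \<bullet> Dg y v - M (y' - y) v = lams t \<bullet> (Dg y' - Dg y - D2g (zs t) (y' - y)) v"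
        unfolding M_def by (simp add: blinfun.diff_left inner_diff_right)
      also have "\<bar>\<dots>\<bar> \<le> norm (lams t) * norm (Dg y' - Dg y - D2g (zs t) (y' - y)) * norm v" by (rule inner_blinfun_le)
      also have "\<dots> \<le> (norm (lams t) + 1) * (e' * norm (y' - y)) * norm v"
        using app[of y y'] y by (intro mult_right_mono mult_mono) auto
      also have "\<dots> = e * norm (y' - y) * norm v" unfolding e'_def using n1 by simp
      finally show "\<bar>lams t \<bullet> Dg y' v - lams t \<bullet> Dg y v - M (y' - y) v\<bar> \<le> e * norm (y' - y) * norm v" .
    qed
  next
    show "M (c *\<^sub>R x) v = c * M x v" for c x v
      unfolding M_def by (simp add: blinfun.scaleR_right blinfun.scaleR_left)
  qed (rule rho_pos)
  have "\<alpha> * (norm v)\<^sup>2 \<le> M v v"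
  proof (rule eigenvalues_gt_imp_coercive[where M = M and d = pdir, OF hess_H[OF t] _ sym _ pdir_expansion])
    show "bilinear M" unfolding bilinear_def M_def
      by (intro conjI allI linearI)
        (simp_all add: blinfun.add_right blinfun.add_left blinfun.scaleR_right blinfun.scaleR_left inner_add_right)
    show "hess_pair (\<lambda>z. Ham f (fst z) (snd z) (lams t)) (xs t, us t) $ a $ b = M (pdir a) (pdir b)" for a b
      unfolding M_def zs_def
      by (rule hess_pair_eq_second_derivative[OF Omega_open zs_in[OF t, unfolded zs_def] Dg D2g[OF zs_in[OF t, unfolded zs_def]]])
  qed
  then show ?thesis unfolding M_def K_inner .
qed

lemma T_coercive: "\<alpha> * (norm v)\<^sup>2 \<le> T v \<bullet> v"
proof -
  define M where "M a b = D2C (xs 1) a b" for a b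
  have in_ball: "xs 1 \<in> ball (xs 1) \<rho>" using rho_pos by simp
  have sym: "M a b = M b a" for a b
  proof (rule second_derivative_symmetric[where z = "xs 1" and \<rho> = \<rho> and \<phi> = C and \<phi>' = "\<lambda>y. blinfun_apply (DC y)"])
    show "(C has_derivative blinfun_apply (DC y)) (at y)" if "y \<in> ball (xs 1) \<rho>" for y using DC that .
  next
    fix e :: real assume e: "e > 0"
    \<comment> \<open>The radius \<open>\<rho> / 2\<close> keeps the closed balls inside the open
      ball on which \<open>DC\<close> is differentiable.\<close>
    obtain r where r: "r > 0" and app: "\<And>y y'. y \<in> cball (xs 1) r \<Longrightarrow> y' \<in> cball (xs 1) r \<Longrightarrow>
        norm (DC y' - DC y - D2C (xs 1) (y' - y)) \<le> e * norm (y' - y)"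
      using uniform_strict_differentiability[of "ball (xs 1) \<rho>" "{xs 1}" "\<rho> / 2" DC D2C e] D2C D2C_cont e rho_pos
      by (auto simp: subset_iff)
    show "\<exists>r>0. \<forall>y\<in>ball (xs 1) r. \<forall>y'\<in>ball (xs 1) r. \<forall>v.
        \<bar>DC y' v - DC y v - M (y' - y) v\<bar> \<le> e * norm (y' - y) * norm v"
    proof (intro exI[of _ r] conjI ballI allI r)
      fix y y' v assume y: "y \<in> ball (xs 1) r" "y' \<in> ball (xs 1) r"
      have "norm ((DC y' - DC y - D2C (xs 1) (y' - y)) v) \<le> norm (DC y' - DC y - D2C (xs 1) (y' - y)) * norm v"
        by (rule norm_blinfun)
      also have "\<dots> \<le> (e * norm (y' - y)) * norm v" using app[of y y'] y by (intro mult_right_mono) auto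
      finally show "\<bar>DC y' v - DC y v - M (y' - y) v\<bar> \<le> e * norm (y' - y) * norm v"
        unfolding M_def by (simp add: blinfun.diff_left)
    qed
  next
    show "M (c *\<^sub>R x) v = c * M x v" for c x v
      unfolding M_def by (simp add: blinfun.scaleR_right blinfun.scaleR_left)
  qed (rule rho_pos)
  have "\<alpha> * (norm v)\<^sup>2 \<le> M v v"
  proof (rule eigenvalues_gt_imp_coercive[where M = M and d = "\<lambda>a. axis a 1", OF hess_C _ sym _ axis_expansion])
    show "bilinear M" unfolding bilinear_def M_def
      by (intro conjI allI linearI)
        (simp_all add: blinfun.add_right blinfun.add_left blinfun.scaleR_right blinfun.scaleR_left)
    show "hess C (xs 1) $ a $ b = M (axis a 1) (axis b 1)" for a b
      unfolding M_def by (rule hess_eq_second_derivative[OF open_ball in_ball DC D2C[OF in_ball]])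
  qed
  then show ?thesis unfolding M_def T_inner .
qed

lemma jacobian_component_bounds:
  assumes t: "t \<in> {-1..1}" and y: "\<And>l. \<bar>y $ l\<bar> \<le> c"
  shows "\<bar>Dg (zs t) (y, 0) $ k\<bar> \<le> c / 4" "\<bar>fst (gH (zs t) y) $ k\<bar> \<le> c / 4"
  using jac_x_mult[OF Dg[OF zs_in[OF t], unfolded zs_def], of y] jac_small[OF t]
    mat_inf_norm_component_le[of "jac_x f (xs t) (us t)" "1/4" y c k]
    mat_inf_norm_component_le[of "transpose (jac_x f (xs t) (us t))" "1/4" y c k] y
  unfolding gH_def zs_def by auto

lemma continuous_on_zs: "continuous_on {-1..1} zs"
  unfolding zs_def by (intro continuous_intros xs_cont us_cont)

text \<open>Continuity on the compact interval; the bound refers to all times at once and therefore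
  to every grid.\<close>

lemma coefficient_bounds:
  "\<exists>b\<ge>0. (\<forall>t\<in>{-1..1}. norm (Dg (zs t)) \<le> b \<and> norm (D2g (zs t)) \<le> b \<and> norm (lams t) \<le> b \<and>
      (\<forall>v. norm (K t v) \<le> b * norm v)) \<and> (\<forall>v. norm (T v) \<le> b * norm v)"
proof -
  have c1: "continuous_on {-1..1} (\<lambda>t. Dg (zs t))"
    by (rule continuous_on_compose2[OF Dg_cont continuous_on_zs]) (use zs_in in blast)
  have c2: "continuous_on {-1..1} (\<lambda>t. D2g (zs t))"
    by (rule continuous_on_compose2[OF D2g_cont continuous_on_zs]) (use zs_in in blast)
  obtain b1 where b1: "b1 \<ge> 0" "\<And>t. t \<in> {-1..1} \<Longrightarrow> norm (Dg (zs t)) \<le> b1"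
    using bounded_image_norm_le[OF compact_Icc c1] by blast
  obtain b2 where b2: "b2 \<ge> 0" "\<And>t. t \<in> {-1..1} \<Longrightarrow> norm (D2g (zs t)) \<le> b2"
    using bounded_image_norm_le[OF compact_Icc c2] by blast
  obtain b3 where b3: "b3 \<ge> 0" "\<And>t. t \<in> {-1..1} \<Longrightarrow> norm (lams t) \<le> b3"
    using bounded_image_norm_le[OF compact_Icc lams_cont] by blast
  define b where "b = b1 + b2 + b3 + b3 * b2 + norm (D2C (xs 1))"
  have b0: "b \<ge> 0" unfolding b_def using b1 b2 b3 by simp
  have "norm (K t v) \<le> b * norm v" if t: "t \<in> {-1..1}" for t v
  proof (rule norm_le_of_inner_le)
    fix v'
    have "\<bar>K t v \<bullet> v'\<bar> \<le> norm (lams t) * norm (D2g (zs t) v) * norm v'"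
      unfolding K_inner by (rule inner_blinfun_le)
    also have "\<dots> \<le> b3 * (b2 * norm v) * norm v'"
      using b3 b2 t by (intro mult_right_mono mult_mono order_trans[OF norm_blinfun]) auto
    also have "\<dots> \<le> b * norm v * norm v'"
      unfolding mult.assoc[symmetric] using b1 b2 b3 by (intro mult_right_mono) (auto simp: b_def)
    finally show "\<bar>K t v \<bullet> v'\<bar> \<le> b * norm v * norm v'" .
  qed (use b0 in simp)
  moreover have "norm (T v) \<le> b * norm v" for v
  proof (rule norm_le_of_inner_le)
    fix v'
    have "\<bar>T v \<bullet> v'\<bar> \<le> norm (D2C (xs 1) v) * norm v'"
      unfolding T_inner using norm_blinfun[of "D2C (xs 1) v" v'] by simp
    also have "\<dots> \<le> norm (D2C (xs 1)) * norm v * norm v'" by (intro mult_right_mono norm_blinfun) auto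
    also have "\<dots> \<le> b * norm v * norm v'" using b1 b2 b3 by (intro mult_right_mono) (auto simp: b_def)
    finally show "\<bar>T v \<bullet> v'\<bar> \<le> b * norm v * norm v'" .
  qed (use b0 in simp)
  moreover have "b1 \<le> b" "b2 \<le> b" "b3 \<le> b" using b1 b2 b3 unfolding b_def by auto
  ultimately show ?thesis using b0 b1 b2 b3 by (intro exI[of _ b]) (meson order_trans)
qed

lemma gH_norm_le: "norm (Dg z) \<le> b \<Longrightarrow> norm (gH z y) \<le> b * norm y"
proof (rule norm_le_of_inner_le)
  assume b: "norm (Dg z) \<le> b"
  show "0 \<le> b * norm y" using order_trans[OF norm_ge_zero b] by simp
  fix v
  have "\<bar>gH z y \<bullet> v\<bar> \<le> norm y * norm (Dg z) * norm v" unfolding gH_inner by (rule inner_blinfun_le)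
  also have "\<dots> \<le> norm y * b * norm v" using b by (intro mult_right_mono mult_left_mono) auto
  finally show "\<bar>gH z y \<bullet> v\<bar> \<le> b * norm y * norm v" by (simp add: mult_ac)
qed

text \<open>\<open>gH\<close> depends on point and costate; its derivative at the optimum is
  \<open>gH (zs t)\<close> in the costate plus \<open>K t\<close> in the point. One radius for all
  \<open>t\<close> keeps later constants independent of the grid.\<close>

lemma linearization_estimates:
  assumes e: "e > 0"
  shows "\<exists>r>0. r < \<rho> \<and>
    (\<forall>t\<in>{-1..1}. \<forall>y\<in>cball (zs t) r. \<forall>y'\<in>cball (zs t) r.
       norm (f (fst y') (snd y') - f (fst y) (snd y) - Dg (zs t) (y' - y)) \<le> e * norm (y' - y) \<and>
       (\<forall>l\<in>cball (lams t) r. \<forall>l'\<in>cball (lams t) r.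
          norm (gH y' l' - gH y l - (gH (zs t) (l' - l) + K t (y' - y))) \<le> e * (norm (y' - y) + norm (l' - l)))) \<and>
    (\<forall>x\<in>cball (xs 1) r. \<forall>x'\<in>cball (xs 1) r. norm (gC x' - gC x - T (x' - x)) \<le> e * norm (x' - x))"
proof -
  obtain B where B: "B \<ge> 0" "\<And>t. t \<in> {-1..1} \<Longrightarrow> norm (D2g (zs t)) \<le> B" "\<And>t. t \<in> {-1..1} \<Longrightarrow> norm (lams t) \<le> B"
    using coefficient_bounds by blast
  have cancel: "c * (e / (2 * c)) = e / 2" if "c > 0" for c using that by (simp add: field_simps)
  \<comment> \<open>The remainder of \<open>Dg\<close> meets the costate, of size \<open>B\<close>,
    and may use up \<open>e / 2\<close>; \<open>e' \<le> 1\<close> makes \<open>Dg\<close> Lipschitz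
    with constant \<open>B + 1\<close> near the optimum.\<close>
  define e' where "e' = min 1 (e / (2 * (B + 1)))"
  have e': "e' > 0" "e' \<le> 1" "(B + 1) * e' \<le> e / 2"
  proof -
    show "e' > 0" "e' \<le> 1" unfolding e'_def using e B(1) by auto
    have "(B + 1) * e' \<le> (B + 1) * (e / (2 * (B + 1)))" unfolding e'_def using B(1) by (intro mult_left_mono) auto
    also have "\<dots> = e / 2" by (rule cancel) (use B(1) in simp)
    finally show "(B + 1) * e' \<le> e / 2" .
  qed
  have "1 * e' \<le> (B + 1) * e'" using B(1) e'(1) by (intro mult_right_mono) auto
  then have e'e: "e' \<le> e" using e'(3) e by linarith
  let ?Z = "zs ` {-1..1}"
  have Z: "compact ?Z" by (intro compact_continuous_image continuous_on_zs compact_Icc)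
  have Zb: "cball z \<rho> \<subseteq> \<Omega>" if "z \<in> ?Z" for z using balls that unfolding zs_def by blast
  obtain r1 where r1: "r1 > 0" and g1: "\<And>t y y'. t \<in> {-1..1} \<Longrightarrow> y \<in> cball (zs t) r1 \<Longrightarrow> y' \<in> cball (zs t) r1 \<Longrightarrow>
      norm (f (fst y') (snd y') - f (fst y) (snd y) - Dg (zs t) (y' - y)) \<le> e * norm (y' - y)"
    using uniform_strict_differentiability[OF Omega_open Z rho_pos Zb Dg Dg_cont e] by blast
  obtain r2 where r2: "r2 > 0" and g2: "\<And>t y y'. t \<in> {-1..1} \<Longrightarrow> y \<in> cball (zs t) r2 \<Longrightarrow> y' \<in> cball (zs t) r2 \<Longrightarrow>
      norm (Dg y' - Dg y - D2g (zs t) (y' - y)) \<le> e' * norm (y' - y)"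
    using uniform_strict_differentiability[OF Omega_open Z rho_pos Zb D2g D2g_cont e'(1)] by blast
  obtain r3 where r3: "r3 > 0" and g3: "\<And>t y. t \<in> {-1..1} \<Longrightarrow> y \<in> cball (zs t) r3 \<Longrightarrow> norm (Dg y - Dg (zs t)) \<le> e'"
    using uniform_strict_differentiability[OF Omega_open Z rho_pos Zb Dg Dg_cont e'(1)] by blast
  obtain r4 where r4: "r4 > 0" and g4: "\<And>x x'. x \<in> cball (xs 1) r4 \<Longrightarrow> x' \<in> cball (xs 1) r4 \<Longrightarrow>
        norm (DC x' - DC x - D2C (xs 1) (x' - x)) \<le> e * norm (x' - x)"
    using uniform_strict_differentiability[of "ball (xs 1) \<rho>" "{xs 1}" "\<rho> / 2" DC D2C e] D2C D2C_cont e rho_pos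
    by (auto simp: subset_iff)
  define r where "r = Min {r1, r2, r3, r4, \<rho> / 2, e / (2 * (B + 1))}"
  have r: "r > 0" "r \<le> r1" "r \<le> r2" "r \<le> r3" "r \<le> r4" "r < \<rho>" "r * (B + 1) \<le> e / 2"
  proof -
    show "r > 0" unfolding r_def using r1 r2 r3 r4 rho_pos e B(1) by auto
    have le: "r \<le> c" if "c \<in> {r1, r2, r3, r4, \<rho> / 2, e / (2 * (B + 1))}" for c
      unfolding r_def using that by (intro Min_le) auto
    show "r \<le> r1" "r \<le> r2" "r \<le> r3" "r \<le> r4" by (rule le, blast)+
    have "r \<le> \<rho> / 2" by (rule le) blast
    then show "r < \<rho>" using rho_pos by linarith
    have "r \<le> e / (2 * (B + 1))" by (rule le) blast
    then have "(B + 1) * r \<le> (B + 1) * (e / (2 * (B + 1)))" using B(1) by (intro mult_left_mono) auto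
    also have "\<dots> = e / 2" by (rule cancel) (use B(1) in simp)
    finally show "r * (B + 1) \<le> e / 2" by (simp only: mult.commute)
  qed
  have "norm (gH y' l' - gH y l - (gH (zs t) (l' - l) + K t (y' - y))) \<le> e * (norm (y' - y) + norm (l' - l))"
    if t: "t \<in> {-1..1}" and y: "y \<in> cball (zs t) r" "y' \<in> cball (zs t) r" and l: "l \<in> cball (lams t) r" "l' \<in> cball (lams t) r"
    for t y y' l l'
  proof (rule norm_le_of_inner_le)
    show "0 \<le> e * (norm (y' - y) + norm (l' - l))" using e by simp
    fix v
    define R where "R = Dg y' - Dg y - D2g (zs t) (y' - y)"
    have yin: "y \<in> cball (zs t) r2" "y' \<in> cball (zs t) r2" "y' \<in> cball (zs t) r3" using y r by auto
    have R: "norm R \<le> e' * norm (y' - y)" unfolding R_def by (rule g2[OF t yin(1,2)])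
    have "norm (Dg y' - Dg y) \<le> norm R + norm (D2g (zs t) (y' - y))"
      unfolding R_def using norm_triangle_ineq[of "Dg y' - Dg y - D2g (zs t) (y' - y)" "D2g (zs t) (y' - y)"] by simp
    also have "\<dots> \<le> e' * norm (y' - y) + B * norm (y' - y)"
      using R B(2)[OF t] by (intro add_mono order_trans[OF norm_blinfun] mult_right_mono) auto
    also have "\<dots> \<le> (B + 1) * norm (y' - y)" 
      using mult_right_mono[OF e'(2), of "norm (y' - y)"] by (simp add: distrib_right)
    finally have L: "norm (Dg y' - Dg y) \<le> (B + 1) * norm (y' - y)" .
    \<comment> \<open>Three errors: the costate increment against the drift of \<open>Dg\<close>,
      the distance of \<open>l\<close> from \<open>lams t\<close>, and the remainder
      \<open>R\<close>. The last two take \<open>e / 2\<close> of the point increment each.\<close>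
    have eq: "(gH y' l' - gH y l - (gH (zs t) (l' - l) + K t (y' - y))) \<bullet> v =
       (l' - l) \<bullet> (Dg y' - Dg (zs t)) v + (l - lams t) \<bullet> (Dg y' - Dg y) v + lams t \<bullet> R v"
      unfolding R_def 
      by (simp add: inner_diff_left inner_add_left gH_inner K_inner blinfun.diff_left inner_diff_right)
    have 1: "\<bar>(l' - l) \<bullet> (Dg y' - Dg (zs t)) v\<bar> \<le> norm (l' - l) * e * norm v"
      using g3[OF t yin(3)] e'e
      by (intro order_trans[OF inner_blinfun_le] mult_right_mono mult_left_mono) auto
    have 2: "\<bar>(l - lams t) \<bullet> (Dg y' - Dg y) v\<bar> \<le> r * ((B + 1) * norm (y' - y)) * norm v"
      using l(1) L r(1) by (intro order_trans[OF inner_blinfun_le] mult_right_mono mult_mono) (auto simp: dist_norm norm_minus_commute)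
    have 3: "\<bar>lams t \<bullet> R v\<bar> \<le> (B + 1) * (e' * norm (y' - y)) * norm v"
      using B(1) B(3)[OF t] R by (intro order_trans[OF inner_blinfun_le] mult_right_mono mult_mono) auto
    have "r * ((B + 1) * norm (y' - y)) * norm v \<le> e / 2 * (norm (y' - y) * norm v)"
      using mult_right_mono[OF r(7), of "norm (y' - y) * norm v"] by (simp add: mult_ac)
    moreover have "(B + 1) * (e' * norm (y' - y)) * norm v \<le> e / 2 * (norm (y' - y) * norm v)"
      using mult_right_mono[OF e'(3), of "norm (y' - y) * norm v"] by (simp add: mult_ac)
    ultimately show "\<bar>(gH y' l' - gH y l - (gH (zs t) (l' - l) + K t (y' - y))) \<bullet> v\<bar> \<le> e * (norm (y' - y) + norm (l' - l)) * norm v"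
      unfolding eq using 1 2 3 by (simp add: algebra_simps)
  qed
  moreover have "norm (gC x' - gC x - T (x' - x)) \<le> e * norm (x' - x)"
    if x: "x \<in> cball (xs 1) r" "x' \<in> cball (xs 1) r" for x x'
  proof (rule norm_le_of_inner_le)
    show "0 \<le> e * norm (x' - x)" using e by simp
    fix v
    have "(gC x' - gC x - T (x' - x)) \<bullet> v = (DC x' - DC x - D2C (xs 1) (x' - x)) v"
      by (simp add: inner_diff_left gC_inner T_inner blinfun.diff_left)
    also have "\<bar>\<dots>\<bar> \<le> norm (DC x' - DC x - D2C (xs 1) (x' - x)) * norm v"
      using norm_blinfun[of "DC x' - DC x - D2C (xs 1) (x' - x)" v] by simp
    also have "\<dots> \<le> e * norm (x' - x) * norm v" using g4[of x x'] x r by (intro mult_right_mono) auto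
    finally show "\<bar>(gC x' - gC x - T (x' - x)) \<bullet> v\<bar> \<le> e * norm (x' - x) * norm v" .
  qed
  moreover have "norm (f (fst y') (snd y') - f (fst y) (snd y) - Dg (zs t) (y' - y)) \<le> e * norm (y' - y)"
    if "t \<in> {-1..1}" "y \<in> cball (zs t) r" "y' \<in> cball (zs t) r" for t y y'
    using that r by (intro g1) auto
  ultimately show ?thesis using r(1,6) by (intro exI[of _ r]) blast
qed

end

subsection \<open>The collocated optimality system\<close>

lemma norm_sum_scaleR_le:
  fixes v :: "nat \<Rightarrow> 'a::real_normed_vector"
  assumes "(\<Sum>j\<in>I. \<bar>a j\<bar>) \<le> c" "\<And>j. j \<in> I \<Longrightarrow> norm (v j) \<le> d" "d \<ge> 0"
  shows "norm (\<Sum>j\<in>I. a j *\<^sub>R v j) \<le> c * d"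
proof -
  have "norm (\<Sum>j\<in>I. a j *\<^sub>R v j) \<le> (\<Sum>j\<in>I. norm (a j *\<^sub>R v j))" by (rule norm_sum)
  also have "\<dots> \<le> (\<Sum>j\<in>I. \<bar>a j\<bar> * d)" by (intro sum_mono) (simp add: assms(2) mult_left_mono)
  also have "\<dots> \<le> c * d" unfolding sum_distrib_right[symmetric] using assms by (intro mult_right_mono)
  finally show ?thesis .
qed

locale radau_collocation = smooth_control_problem f C xs us lams \<Omega> \<rho> \<alpha> Dg D2g DC D2C
  for f :: "real^'n \<Rightarrow> real^'m \<Rightarrow> real^'n" and C xs us lams \<Omega> \<rho> \<alpha> Dg D2g DC D2C +
  fixes N :: nat and tau w :: "nat \<Rightarrow> real" and E E' :: "nat \<Rightarrow> nat \<Rightarrow> real"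
    and x0 :: "real^'n" and b e r :: real
  assumes N: "N \<ge> 2" and R: "radau_rule N tau w"
    and E: "is_inverse_on N (\<lambda>i j. Dmat tau N i j) E"
    and E': "is_inverse_on N (\<lambda>i j. Dddag tau w N i j) E'"
    and E1: "\<And>i. i \<in> {1..N} \<Longrightarrow> (\<Sum>j=1..N. \<bar>E i j\<bar>) \<le> 2"
    and E1': "\<And>i. i \<in> {1..N} \<Longrightarrow> (\<Sum>j=1..N. \<bar>E' i j\<bar>) \<le> 2"
    and E2: "\<And>i v. i \<in> {1..N} \<Longrightarrow> (\<Sum>j=1..N. \<bar>E i j\<bar> * v j) \<le> sqrt 2 * sqrt (\<Sum>j=1..N. w j * (v j)\<^sup>2)"
    and E2': "\<And>i v. i \<in> {1..N} \<Longrightarrow> (\<Sum>j=1..N. \<bar>E' i j\<bar> * v j) \<le> sqrt 2 * sqrt (\<Sum>j=1..N. w j * (v j)\<^sup>2)"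
    and b: "b \<ge> 0" and Dg_bound: "\<And>t. t \<in> {-1..1} \<Longrightarrow> norm (Dg (xs t, us t)) \<le> b"
    and K_bound: "\<And>t v. t \<in> {-1..1} \<Longrightarrow> norm (smooth_control_problem.K xs us lams D2g t v) \<le> b * norm v"
    and T_bound: "\<And>v. norm (smooth_control_problem.T xs D2C v) \<le> b * norm v"
    and r: "0 < r" "r < \<rho>" and e: "0 < e" "e < \<alpha>"
    and lin_f: "\<And>t y y'. t \<in> {-1..1} \<Longrightarrow> y \<in> cball (xs t, us t) r \<Longrightarrow> y' \<in> cball (xs t, us t) r \<Longrightarrow>
       norm (f (fst y') (snd y') - f (fst y) (snd y) - Dg (xs t, us t) (y' - y)) \<le> e * norm (y' - y)"
    and lin_H: "\<And>t y y' l l'. t \<in> {-1..1} \<Longrightarrow> y \<in> cball (xs t, us t) r \<Longrightarrow> y' \<in> cball (xs t, us t) r \<Longrightarrow>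
       l \<in> cball (lams t) r \<Longrightarrow> l' \<in> cball (lams t) r \<Longrightarrow>
       norm (smooth_control_problem.gH Dg y' l' - smooth_control_problem.gH Dg y l -
          (smooth_control_problem.gH Dg (xs t, us t) (l' - l) + smooth_control_problem.K xs us lams D2g t (y' - y)))
        \<le> e * (norm (y' - y) + norm (l' - l))"
    and lin_C: "\<And>x x'. x \<in> cball (xs 1) r \<Longrightarrow> x' \<in> cball (xs 1) r \<Longrightarrow>
       norm (smooth_control_problem.gC DC x' - smooth_control_problem.gC DC x - smooth_control_problem.T xs D2C (x' - x))
        \<le> e * norm (x' - x)"
begin

text \<open>State and control, then costate, at one of the nodes 1 to \<open>N\<close>. Node 0 is
  eliminated: the state there is \<open>x0\<close>, and the initial costate occurs in a single
  equation that gives it explicitly.\<close>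

type_synonym ('k, 'l) triple = "((real^'k) \<times> (real^'l)) \<times> (real^'k)"

text \<open>Sum of the bounds for state, costate and control; the added 1 makes it positive.\<close>

definition stab :: real where
  "stab = 2 * state_const (real CARD('n)) b \<alpha> + control_const (real CARD('n)) b \<alpha> + 1"

definition star :: "nat \<Rightarrow> ('n, 'm) triple" where
  "star i = (zs (tau i), lams (tau i))"

text \<open>Inverting both differentiation matrices removes the factor \<open>1 / w N\<close> in front of the
  terminal gradient, since \<open>Dddag\<close> maps the constant \<open>1\<close> to \<open>- e_N / w N\<close>.\<close>

definition residual :: "(nat \<Rightarrow> ('n, 'm) triple) \<Rightarrow> nat \<Rightarrow> ('n, 'm) triple" where
  "residual Y i = ((fst (fst (Y i)) - x0 - (\<Sum>j=1..N. E i j *\<^sub>R f (fst (fst (Y j))) (snd (fst (Y j)))),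
      snd (gH (fst (Y i)) (snd (Y i)))),
     snd (Y i) - gC (fst (fst (Y N))) + (\<Sum>j=1..N. E' i j *\<^sub>R fst (gH (fst (Y j)) (snd (Y j)))))"

definition linearized :: "(nat \<Rightarrow> ('n, 'm) triple) \<Rightarrow> nat \<Rightarrow> ('n, 'm) triple" where
  "linearized y i = ((fst (fst (y i)) - (\<Sum>j=1..N. E i j *\<^sub>R Dg (zs (tau j)) (fst (y j))),
      snd (gH (zs (tau i)) (snd (y i)) + K (tau i) (fst (y i)))),
     snd (y i) - T (fst (fst (y N))) +
       (\<Sum>j=1..N. E' i j *\<^sub>R fst (gH (zs (tau j)) (snd (y j)) + K (tau j) (fst (y j)))))"

lemma tau_in: "i \<le> N \<Longrightarrow> tau i \<in> {-1..1}"
  by (rule radau_nodes_in_interval[OF R])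

lemma tau_N: "tau N = 1" and tau_0: "tau 0 = -1"
  using R unfolding radau_rule_def by auto

lemma w_pos: "i \<in> {1..N} \<Longrightarrow> 0 < w i"
  using R unfolding radau_rule_def by auto

lemma stab_pos: "stab > 0"
  unfolding stab_def using stability_consts_nonneg[of "real CARD('n)" b \<alpha>] b alpha_pos by auto

lemma linearized_add: "linearized (\<lambda>i. y i + y' i) i = linearized y i + linearized y' i"
  unfolding linearized_def
  by (simp add: linear_add[OF linear_gH] linear_add[OF linear_K] linear_add[OF linear_T] blinfun.add_right
      scaleR_add_right sum.distrib algebra_simps)

lemma linearized_scale: "linearized (\<lambda>i. c *\<^sub>R y i) i = c *\<^sub>R linearized y i"
  unfolding linearized_def
  by (simp add: linear_scale[OF linear_gH] linear_scale[OF linear_K] linear_scale[OF linear_T] blinfun.scaleR_right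
      scaleR_add_right scaleR_diff_right scaleR_sum_right sum.distrib algebra_simps)

definition L :: "(nat \<Rightarrow>\<^sub>C ('n, 'm) triple) \<Rightarrow> nat \<Rightarrow>\<^sub>C ('n, 'm) triple" where
  "L y = grid_fun N (linearized (apply_bcontfun y))"

text \<open>The unknown is the deviation from the nodal values of the optimum, so Newton starts at
  0.\<close>

definition F :: "(nat \<Rightarrow>\<^sub>C ('n, 'm) triple) \<Rightarrow> nat \<Rightarrow>\<^sub>C ('n, 'm) triple" where
  "F y = grid_fun N (residual (\<lambda>i. star i + apply_bcontfun y i))"

lemma linear_L: "linear L"
proof (rule linearI)
  show "L (x + y) = L x + L y" for x y
  proof -
    have "apply_bcontfun (x + y) = (\<lambda>i. apply_bcontfun x i + apply_bcontfun y i)" by auto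
    then show ?thesis by (intro bcontfun_eqI) (simp add: L_def apply_grid_fun linearized_add)
  qed
  show "L (c *\<^sub>R x) = c *\<^sub>R L x" for c x
  proof -
    have "apply_bcontfun (c *\<^sub>R x) = (\<lambda>i. c *\<^sub>R apply_bcontfun x i)" by auto
    then show ?thesis by (intro bcontfun_eqI) (simp add: L_def apply_grid_fun linearized_scale)
  qed
qed

lemma norm_triple_le: "norm y \<le> norm (fst (fst y)) + norm (snd (fst y)) + norm (snd y)"
  using norm_Pair_le[of "fst y" "snd y"] norm_Pair_le[of "fst (fst y)" "snd (fst y)"] by simp

lemma triple_norm_le:
  "norm (fst (fst y)) \<le> norm y" "norm (snd (fst y)) \<le> norm y" "norm (snd y) \<le> norm y" "norm (fst y) \<le> norm y"
  using norm_fst_le_norm[of y] norm_snd_le_norm[of y] norm_fst_le_norm[of "fst y"] norm_snd_le_norm[of "fst y"]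
  by linarith+

text \<open>\<open>linear_stability\<close> with the value of \<open>L y\<close> itself as
  right-hand side.\<close>

lemma L_stable: "norm y \<le> stab * norm (L y)" if y: "y \<in> grid_space N"
proof (rule norm_grid_le[OF y])
  let ?P = "norm (L y)" and ?n = "real CARD('n)"
  show "0 \<le> stab * ?P" using stab_pos by simp
  fix i assume i: "i \<in> {1..N}"
  define x where "x i = fst (fst (apply_bcontfun y i))" for i
  define u where "u i = snd (fst (apply_bcontfun y i))" for i
  define l where "l i = snd (apply_bcontfun y i)" for i
  define q where "q i = linearized (apply_bcontfun y) i" for i
  have xu: "fst (apply_bcontfun y i) = (x i, u i)" for i unfolding x_def u_def by simp
  have q: "norm (q i) \<le> ?P" if "i \<in> {1..N}" for i
    using norm_bounded[of "L y" i] that unfolding L_def apply_grid_fun q_def by simp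
  have tin: "tau j \<in> {-1..1}" if "j \<in> {1..N}" for j using tau_in that by simp
  note stability = linear_stability[where N = N and w = w and D = "\<lambda>i j. Dmat tau N i j" and D' = "\<lambda>i j. Dddag tau w N i j"
      and E = E and E' = E' and J = "\<lambda>j. blinfun_apply (Dg (zs (tau j)))" and Jt = "\<lambda>j. gH (zs (tau j))"
      and K = "\<lambda>j. K (tau j)" and T = T and b = b and \<alpha> = \<alpha> and P = ?P and x = x and l = l and u = u
      and p = "\<lambda>i. fst (fst (q i))" and s = "\<lambda>i. snd (q i)" and r = "\<lambda>i. snd (fst (q i))" and i = i]
  have prems:
    "1 \<le> N" "\<And>i. i \<in> {1..N} \<Longrightarrow> 0 < w i" "(\<Sum>i=1..N. w i) = 2"
    "\<And>i j. i \<in> {1..N} \<Longrightarrow> j \<in> {1..N} \<Longrightarrow> Dddag tau w N i j = - (w j / w i) * Dmat tau N j i"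
    "\<And>i. i \<in> {1..N} \<Longrightarrow> (\<Sum>j=1..N. Dddag tau w N i j) = (if i = N then - 1 / w N else 0)"
    "\<And>j. j \<in> {1..N} \<Longrightarrow> linear (blinfun_apply (Dg (zs (tau j))))"
    "\<And>j z. j \<in> {1..N} \<Longrightarrow> norm (Dg (zs (tau j)) z) \<le> b * norm z"
    "\<And>j y. j \<in> {1..N} \<Longrightarrow> norm (gH (zs (tau j)) y) \<le> b * norm y"
    "\<And>j z. j \<in> {1..N} \<Longrightarrow> norm (K (tau j) z) \<le> b * norm z"
    "\<And>j y z. j \<in> {1..N} \<Longrightarrow> gH (zs (tau j)) y \<bullet> z = y \<bullet> Dg (zs (tau j)) z"
    "\<And>j z. j \<in> {1..N} \<Longrightarrow> \<alpha> * (norm z)\<^sup>2 \<le> K (tau j) z \<bullet> z"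
    using N w_pos radau_weights_sum[OF R] Dddag_row_sum[OF R _ N] tin gH_inner K_coercive
    by (auto simp: Dddag_def blinfun.bounded_linear_right bounded_linear.linear K_bound zs_def
        intro!: order_trans[OF norm_blinfun] mult_right_mono Dg_bound gH_norm_le)
  have eqs: "\<And>i. i \<in> {1..N} \<Longrightarrow> x i - (\<Sum>j=1..N. E i j *\<^sub>R Dg (zs (tau j)) (x j, u j)) = fst (fst (q i))"
    "\<And>i. i \<in> {1..N} \<Longrightarrow> l i - T (x N) + (\<Sum>j=1..N. E' i j *\<^sub>R fst (gH (zs (tau j)) (l j) + K (tau j) (x j, u j))) = snd (q i)"
    "\<And>i. i \<in> {1..N} \<Longrightarrow> snd (gH (zs (tau i)) (l i) + K (tau i) (x i, u i)) = snd (fst (q i))"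
    unfolding q_def linearized_def xu x_def[symmetric] l_def[symmetric] by simp_all
  have qb: "\<And>i. i \<in> {1..N} \<Longrightarrow> norm (fst (fst (q i))) \<le> ?P" "\<And>i. i \<in> {1..N} \<Longrightarrow> norm (snd (q i)) \<le> ?P"
    "\<And>i. i \<in> {1..N} \<Longrightarrow> norm (snd (fst (q i))) \<le> ?P"
    using q triple_norm_le order_trans by blast+
  have Kl: "\<And>j. j \<in> {1..N} \<Longrightarrow> linear (K (tau j))" by (rule linear_K)
  have JA: "\<And>j y c k. j \<in> {1..N} \<Longrightarrow> (\<And>l. \<bar>y $ l\<bar> \<le> c) \<Longrightarrow> \<bar>Dg (zs (tau j)) (y, 0) $ k\<bar> \<le> c / 4"
    and JtA: "\<And>j y c k. j \<in> {1..N} \<Longrightarrow> (\<And>l. \<bar>y $ l\<bar> \<le> c) \<Longrightarrow> \<bar>fst (gH (zs (tau j)) y) $ k\<bar> \<le> c / 4"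
    using jacobian_component_bounds tin by blast+
  have st: "norm (x i) \<le> state_const ?n b \<alpha> * ?P" "norm (l i) \<le> state_const ?n b \<alpha> * ?P"
    "norm (u i) \<le> control_const ?n b \<alpha> * ?P"
    by (rule stability; fact prems E E' E1 E1' E2 E2' b alpha_pos Kl T_bound JA JtA T_coercive eqs qb i)+
  have "norm (apply_bcontfun y i) \<le> norm (x i) + norm (u i) + norm (l i)"
    using norm_triple_le[of "apply_bcontfun y i"] unfolding x_def u_def l_def .
  also have "\<dots> \<le> state_const ?n b \<alpha> * ?P + control_const ?n b \<alpha> * ?P + state_const ?n b \<alpha> * ?P"
    using st by (intro add_mono)
  also have "\<dots> \<le> stab * ?P" unfolding stab_def by (simp add: algebra_simps)
  finally show "norm (apply_bcontfun y i) \<le> stab * ?P" .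
qed

text \<open>Nonlinear remainders enter pointwise or through matrix rows of absolute sum at most 2,
  so the estimate is uniform in \<open>N\<close>.\<close>

lemma residual_linearization:
  assumes Y: "\<And>i. i \<in> {1..N} \<Longrightarrow> norm (Y i - star i) \<le> r" and Y': "\<And>i. i \<in> {1..N} \<Longrightarrow> norm (Y' i - star i) \<le> r"
    and d: "\<And>i. i \<in> {1..N} \<Longrightarrow> norm (Y' i - Y i) \<le> d" and i: "i \<in> {1..N}"
  shows "norm (residual Y' i - residual Y i - linearized (\<lambda>i. Y' i - Y i) i) \<le> 9 * e * d"
proof -
  have d0: "d \<ge> 0" using order_trans[OF norm_ge_zero d[OF i]] .
  have NN: "N \<in> {1..N}" using N by simp
  have inb: "fst (Z i) \<in> cball (xs (tau i), us (tau i)) r" "snd (Z i) \<in> cball (lams (tau i)) r"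
    if "norm (Z i - star i) \<le> r" for i and Z :: "nat \<Rightarrow> ('n, 'm) triple"
    using that triple_norm_le(3,4)[of "Z i - star i"]
    by (auto simp: star_def zs_def dist_norm norm_minus_commute)
  have dd: "norm (fst (Y' i) - fst (Y i)) \<le> d" "norm (snd (Y' i) - snd (Y i)) \<le> d" "norm (fst (fst (Y' i)) - fst (fst (Y i))) \<le> d"
    if "i \<in> {1..N}" for i
    using d[OF that] triple_norm_le[of "Y' i - Y i"] by auto
  define rf where "rf j = f (fst (fst (Y' j))) (snd (fst (Y' j))) - f (fst (fst (Y j))) (snd (fst (Y j)))
      - Dg (zs (tau j)) (fst (Y' j) - fst (Y j))" for j
  define rH where "rH j = gH (fst (Y' j)) (snd (Y' j)) - gH (fst (Y j)) (snd (Y j)) -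
     (gH (zs (tau j)) (snd (Y' j) - snd (Y j)) + K (tau j) (fst (Y' j) - fst (Y j)))" for j
  define rC where "rC = gC (fst (fst (Y' N))) - gC (fst (fst (Y N))) - T (fst (fst (Y' N)) - fst (fst (Y N)))"
  have rf: "norm (rf j) \<le> e * d" if "j \<in> {1..N}" for j
    unfolding rf_def zs_def
    using inb[where Z = Y, OF Y[OF that]] inb[where Z = Y', OF Y'[OF that]] tau_in that e dd[OF that]
    by (intro order_trans[OF lin_f] mult_left_mono) auto
  have rH: "norm (rH j) \<le> e * (d + d)" if "j \<in> {1..N}" for j
    unfolding rH_def zs_def
    using inb[where Z = Y, OF Y[OF that]] inb[where Z = Y', OF Y'[OF that]] tau_in that e dd[OF that]
    by (intro order_trans[OF lin_H] mult_left_mono add_mono) auto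
  have xN: "fst (fst (Z N)) \<in> cball (xs 1) r" if "norm (Z N - star N) \<le> r" for Z :: "nat \<Rightarrow> ('n, 'm) triple"
    using that triple_norm_le(1)[of "Z N - star N"] tau_N by (auto simp: star_def zs_def dist_norm norm_minus_commute)
  have rC: "norm rC \<le> e * d"
    unfolding rC_def using xN[where Z = Y, OF Y[OF NN]] xN[where Z = Y', OF Y'[OF NN]] e dd[OF NN]
    by (intro order_trans[OF lin_C] mult_left_mono) auto
  have p1: "fst (fst (residual Y' i - residual Y i - linearized (\<lambda>i. Y' i - Y i) i)) = - (\<Sum>j=1..N. E i j *\<^sub>R rf j)"
    unfolding residual_def linearized_def rf_def by (simp add: scaleR_diff_right sum_subtractf)
  have p2: "snd (fst (residual Y' i - residual Y i - linearized (\<lambda>i. Y' i - Y i) i)) = snd (rH i)"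
    unfolding residual_def linearized_def rH_def by simp
  have p3: "snd (residual Y' i - residual Y i - linearized (\<lambda>i. Y' i - Y i) i) = - rC + (\<Sum>j=1..N. E' i j *\<^sub>R fst (rH j))"
    unfolding residual_def linearized_def rH_def rC_def
    by (simp add: scaleR_diff_right scaleR_add_right sum_subtractf sum.distrib)
  have b1: "norm (\<Sum>j=1..N. E i j *\<^sub>R rf j) \<le> 2 * (e * d)"
    using E1[OF i] rf e d0 by (intro norm_sum_scaleR_le) auto
  have b2: "norm (snd (rH i)) \<le> e * (d + d)" using norm_snd_le_norm[of "rH i"] rH[OF i] by linarith
  have b3: "norm (\<Sum>j=1..N. E' i j *\<^sub>R fst (rH j)) \<le> 2 * (e * (d + d))"
    using E1'[OF i] e d0 by (intro norm_sum_scaleR_le order_trans[OF norm_fst_le_norm rH]) auto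
  \<comment> \<open>In multiples of \<open>e * d\<close>: state 2, control 2, terminal gradient 1,
    costate 4. The Hamiltonian remainder counts double since it involves increments of point and
    costate.\<close>
  have "norm (residual Y' i - residual Y i - linearized (\<lambda>i. Y' i - Y i) i) \<le> 2 * (e * d) + e * (d + d) + (e * d + 2 * (e * (d + d)))"
    by (rule order_trans[OF norm_triple_le]; unfold p1 p2 p3 norm_minus_cancel; intro add_mono b1 b2)
      (rule order_trans[OF norm_triangle_ineq], unfold norm_minus_cancel, intro add_mono rC b3)
  also have "\<dots> = 9 * e * d" by (simp add: algebra_simps)
  finally show ?thesis .
qed

text \<open>\<open>small\<close> says that the defect \<open>9 * e\<close> is at most
  \<open>1 / (2 * stab)\<close>, which is what \<open>newton_kantorovich_subspace\<close> asks
  for.\<close>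

lemma discrete_solution_exists:
  assumes small: "18 * stab * e \<le> 1"
    and res: "\<And>i. i \<in> {1..N} \<Longrightarrow> norm (residual star i) \<le> d" and d: "2 * stab * d \<le> r"
  shows "\<exists>Y. \<forall>i\<in>{1..N}. residual Y i = 0 \<and> norm (Y i - star i) \<le> 2 * stab * d"
proof -
  have d0: "d \<ge> 0" using order_trans[OF norm_ge_zero res[of N]] N by auto
  obtain B where B: "finite B" "grid_space N = span (B :: (nat \<Rightarrow>\<^sub>C ('n, 'm) triple) set)" using grid_space_span by blast
  have F0: "norm (F 0) \<le> d"
    using res d0 by (intro norm_grid_le[of _ N]) (auto simp: F_def grid_fun_in_space apply_grid_fun)
  then have F0': "2 * stab * norm (F 0) \<le> 2 * stab * d" using stab_pos by (intro mult_left_mono) auto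
  have "\<exists>y\<in>grid_space N. F y = 0 \<and> norm y \<le> 2 * stab * norm (F 0)"
  proof (rule newton_kantorovich_subspace[OF linear_L B(2,1) complete_grid_space _ L_stable stab_pos, where r = r])
    show "L ` grid_space N \<subseteq> grid_space N" unfolding L_def by (auto simp: grid_fun_in_space)
    show "F y \<in> grid_space N" for y unfolding F_def by (rule grid_fun_in_space)
    show "2 * stab * norm (F 0) \<le> r" using F0' d by linarith
    fix y y' :: "nat \<Rightarrow>\<^sub>C ('n, 'm) triple"
    assume n: "norm y \<le> r" "norm y' \<le> r"
    show "norm (F y' - F y - L (y' - y)) \<le> norm (y' - y) / (2 * stab)"
    proof (rule norm_grid_le[of _ N])
      show "F y' - F y - L (y' - y) \<in> grid_space N"
        unfolding F_def L_def by (intro subspace_diff[OF subspace_grid_space] grid_fun_in_space)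
      show "0 \<le> norm (y' - y) / (2 * stab)" using stab_pos by simp
      fix i assume i: "i \<in> {1..N}"
      define Y where "Y j = star j + apply_bcontfun y j" for j
      define Y' where "Y' j = star j + apply_bcontfun y' j" for j
      have dif: "apply_bcontfun (y' - y) = (\<lambda>j. Y' j - Y j)" unfolding Y_def Y'_def by auto
      have "apply_bcontfun (F y' - F y - L (y' - y)) i = residual Y' i - residual Y i - linearized (\<lambda>j. Y' j - Y j) i"
        using i unfolding F_def L_def dif[symmetric] Y_def[symmetric] Y'_def[symmetric] by (simp add: apply_grid_fun)
      also have "norm \<dots> \<le> 9 * e * norm (y' - y)"
      proof (rule residual_linearization[OF _ _ _ i])
        fix j
        show "norm (Y j - star j) \<le> r" using norm_bounded[of y j] n unfolding Y_def by simp
        show "norm (Y' j - star j) \<le> r" using norm_bounded[of y' j] n unfolding Y'_def by simp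
        show "norm (Y' j - Y j) \<le> norm (y' - y)" using norm_bounded[of "y' - y" j] unfolding dif .
      qed
      also have "\<dots> \<le> norm (y' - y) / (2 * stab)"
      proof -
        have "9 * e \<le> 1 / (2 * stab)" using small stab_pos by (simp add: field_simps)
        then have "9 * e * norm (y' - y) \<le> 1 / (2 * stab) * norm (y' - y)" by (intro mult_right_mono) auto
        then show ?thesis by simp
      qed
      finally show "norm (apply_bcontfun (F y' - F y - L (y' - y)) i) \<le> norm (y' - y) / (2 * stab)" .
    qed
  qed auto
  then obtain y where y: "F y = 0" "norm y \<le> 2 * stab * norm (F 0)" by blast
  show ?thesis
  proof (intro exI[of _ "\<lambda>i. star i + apply_bcontfun y i"] ballI conjI)
    fix i assume i: "i \<in> {1..N}"
    show "residual (\<lambda>i. star i + apply_bcontfun y i) i = 0"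
      using arg_cong[OF y(1), of "\<lambda>y. apply_bcontfun y i"] i unfolding F_def by (simp add: apply_grid_fun)
    show "norm (star i + apply_bcontfun y i - star i) \<le> 2 * stab * d"
      using norm_bounded[of y i] y(2) F0' by simp
  qed
qed

end

section \<open>From a zero of the residual back to the nonlinear program\<close>

context radau_collocation
begin

definition solX :: "(nat \<Rightarrow> ('n, 'm) triple) \<Rightarrow> nat \<Rightarrow> real^'n" where
  "solX Y i = (if i = 0 then x0 else fst (fst (Y i)))"

definition solU :: "(nat \<Rightarrow> ('n, 'm) triple) \<Rightarrow> nat \<Rightarrow> real^'m" where
  "solU Y i = snd (fst (Y i))"

text \<open>At index 0 the equation for the initial multiplier is solved explicitly.\<close>

definition solLam :: "(nat \<Rightarrow> ('n, 'm) triple) \<Rightarrow> nat \<Rightarrow> real^'n" where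
  "solLam Y i = (if i = 0 then gC (fst (fst (Y N))) + (\<Sum>i=1..N. w i *\<^sub>R fst (gH (fst (Y i)) (snd (Y i)))) else snd (Y i))"

text \<open>Rows of \<open>Dmat\<close> sum to 0, as constants have derivative 0, so column 0 is
  absorbed in the shift by \<open>v 0\<close>.\<close>

lemma Dmat_sum_shift:
  fixes v :: "nat \<Rightarrow> 'a::real_vector"
  shows "(\<Sum>j=0..N. Dmat tau N i j *\<^sub>R v j) = (\<Sum>j=1..N. Dmat tau N i j *\<^sub>R (v j - v 0))"
proof -
  have "(\<Sum>j=0..N. Dmat tau N i j *\<^sub>R (v j - v 0)) = (\<Sum>j=0..N. Dmat tau N i j *\<^sub>R v j) - (\<Sum>j=0..N. Dmat tau N i j) *\<^sub>R v 0"
    by (simp add: scaleR_diff_right sum_subtractf scaleR_sum_left)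
  then show ?thesis unfolding Dmat_row_sum[OF R] by (simp add: sum.atLeast_Suc_atMost[of 0 N])
qed

lemma near_in:
  assumes "i \<le> N" "norm (Y i - star i) \<le> r"
  shows "fst (Y i) \<in> cball (zs (tau i)) r" "snd (Y i) \<in> cball (lams (tau i)) r"
    "i = N \<Longrightarrow> fst (fst (Y i)) \<in> cball (xs 1) r"
  using assms(2) triple_norm_le[of "Y i - star i"] tau_N
  by (auto simp: star_def zs_def dist_norm norm_minus_commute)

lemma cball_r_subset: "t \<in> {-1..1} \<Longrightarrow> cball (zs t) r \<subseteq> \<Omega>"
  using balls[of t] r unfolding zs_def by auto

context
  fixes Y :: "nat \<Rightarrow> ('n, 'm) triple"
  assumes Y0: "\<And>i. i \<in> {1..N} \<Longrightarrow> residual Y i = 0"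
begin

lemma state_equation:
  assumes i: "i \<in> {1..N}"
  shows "(\<Sum>j=1..N. Dmat tau N i j *\<^sub>R (fst (fst (Y j)) - x0)) = f (fst (fst (Y i))) (snd (fst (Y i)))"
proof (rule is_inverse_on_solve[OF is_inverse_on_sym[OF E] _ i])
  fix i assume "i \<in> {1..N}"
  from arg_cong[OF Y0[OF this], of "\<lambda>q. fst (fst q)"]
  show "(\<Sum>j=1..N. E i j *\<^sub>R f (fst (fst (Y j))) (snd (fst (Y j)))) = fst (fst (Y i)) - x0"
    by (simp add: residual_def)
qed

lemma control_equation:
  assumes i: "i \<in> {1..N}"
  shows "snd (gH (fst (Y i)) (snd (Y i))) = 0"
  using arg_cong[OF Y0[OF i], of "\<lambda>q. snd (fst q)"] by (simp add: residual_def)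

text \<open>Applying \<open>Dddag\<close> to the inverted equation restores the terminal term: the
  constant shift by the gradient of \<open>C\<close> reappears with factor \<open>1 / w N\<close> in
  the last row.\<close>

lemma costate_equation:
  assumes i: "i \<in> {1..N}"
  shows "(\<Sum>j=1..N. Dddag tau w N i j *\<^sub>R snd (Y j)) =
    - fst (gH (fst (Y i)) (snd (Y i))) - (if i = N then (1 / w N) *\<^sub>R gC (fst (fst (Y N))) else 0)"
proof -
  let ?g = "gC (fst (fst (Y N)))"
  have "(\<Sum>j=1..N. Dddag tau w N i j *\<^sub>R (snd (Y j) - ?g)) = - fst (gH (fst (Y i)) (snd (Y i)))"
  proof (rule is_inverse_on_solve[OF is_inverse_on_sym[OF E'] _ i])
    fix i assume "i \<in> {1..N}"
    from arg_cong[OF Y0[OF this], of snd]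
    have "snd (Y i) - ?g + (\<Sum>j=1..N. E' i j *\<^sub>R fst (gH (fst (Y j)) (snd (Y j)))) = 0"
      by (simp add: residual_def)
    then have "(\<Sum>j=1..N. E' i j *\<^sub>R fst (gH (fst (Y j)) (snd (Y j)))) + (snd (Y i) - ?g) = 0"
      by (subst add.commute)
    from minus_unique[OF this]
    show "(\<Sum>j=1..N. E' i j *\<^sub>R - fst (gH (fst (Y j)) (snd (Y j)))) = snd (Y i) - ?g"
      by (simp only: scaleR_minus_right sum_negf)
  qed
  moreover have "(\<Sum>j=1..N. Dddag tau w N i j *\<^sub>R (snd (Y j) - ?g)) =
      (\<Sum>j=1..N. Dddag tau w N i j *\<^sub>R snd (Y j)) - (\<Sum>j=1..N. Dddag tau w N i j) *\<^sub>R ?g"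
    by (simp add: scaleR_diff_right sum_subtractf scaleR_sum_left)
  ultimately have "(\<Sum>j=1..N. Dddag tau w N i j *\<^sub>R snd (Y j)) =
      - fst (gH (fst (Y i)) (snd (Y i))) + (\<Sum>j=1..N. Dddag tau w N i j) *\<^sub>R ?g"
    by (simp only: diff_eq_eq)
  then show ?thesis unfolding Dddag_row_sum[OF R i N] by auto
qed

lemma feasible_solution: "NLP_feasible tau N f x0 (solX Y) (solU Y)"
  unfolding NLP_feasible_def
proof (intro conjI ballI)
  show "solX Y 0 = x0" by (simp add: solX_def)
  fix i assume i: "i \<in> {1..N}"
  have "(\<Sum>j=1..N. Dmat tau N i j *\<^sub>R (solX Y j - solX Y 0)) = (\<Sum>j=1..N. Dmat tau N i j *\<^sub>R (fst (fst (Y j)) - x0))"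
    by (intro sum.cong) (auto simp: solX_def)
  then show "(\<Sum>j=0..N. Dmat tau N i j *\<^sub>R solX Y j) = f (solX Y i) (solU Y i)"
    unfolding Dmat_sum_shift using state_equation[OF i] i by (simp add: solX_def solU_def)
qed

text \<open>Closeness to \<open>star\<close> keeps all points where \<open>gH\<close> and
  \<open>gC\<close> are the gradients that \<open>T_zero\<close> refers to.\<close>

lemma T_zero_solution:
  assumes near: "\<And>i. i \<in> {1..N} \<Longrightarrow> norm (Y i - star i) \<le> r"
  shows "T_zero tau w N f C x0 (solX Y) (solU Y) (solLam Y)"
proof -
  have NN: "N \<in> {1..N}" using N by simp
  have in\<Omega>: "fst (Y i) \<in> \<Omega>" if "i \<in> {1..N}" for i
    by (rule subsetD[OF cball_r_subset[OF tau_in[of i]] near_in(1)[where Y = Y, OF _ near[OF that]]]) (use that in auto)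
  have gx: "gradx_H f (solX Y i) (solU Y i) (solLam Y i) = fst (gH (fst (Y i)) (snd (Y i)))"
    and gu: "gradu_H f (solX Y i) (solU Y i) (solLam Y i) = snd (gH (fst (Y i)) (snd (Y i)))"
    if "i \<in> {1..N}" for i
    using gradients_eq_gH[of "fst (fst (Y i))" "snd (fst (Y i))" "snd (Y i)"] in\<Omega>[OF that] that
    by (auto simp: solX_def solU_def solLam_def)
  have gN: "grad C (solX Y N) = gC (fst (fst (Y N)))"
    using grad_eq_gC[of "fst (fst (Y N))"] near_in(3)[where Y = Y, OF _ near[OF NN]] r N by (auto simp: solX_def)
  have lam: "(\<Sum>j=1..N. Dddag tau w N i j *\<^sub>R solLam Y j) = (\<Sum>j=1..N. Dddag tau w N i j *\<^sub>R snd (Y j))" for i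
    by (intro sum.cong) (auto simp: solLam_def)
  have wsum: "(\<Sum>i=1..N. w i *\<^sub>R gradx_H f (solX Y i) (solU Y i) (solLam Y i)) =
      (\<Sum>i=1..N. w i *\<^sub>R fst (gH (fst (Y i)) (snd (Y i))))"
    by (intro sum.cong refl) (simp only: gx)
  show ?thesis
    unfolding T_zero_def lam wsum gN
    using feasible_solution costate_equation control_equation gx gu NN
    by (auto simp: NLP_feasible_def solLam_def)
qed

text \<open>Along feasible points the cost equals the Lagrangian, so its increment is the sum of the
  first-order convexity gaps of \<open>C\<close> and of the Hamiltonians.\<close>

lemma strict_local_min_solution:
  assumes near: "\<And>i. i \<in> {1..N} \<Longrightarrow> norm (Y i - star i) \<le> r / 2"
  shows "NLP_strict_local_min tau N f C x0 (solX Y) (solU Y)"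
  unfolding NLP_strict_local_min_def
proof (intro conjI feasible_solution exI[of _ "r / 4"] allI impI)
  \<comment> \<open>Perturbations below \<open>r / 4\<close> in state and in control, added to the
    distance \<open>r / 2\<close> of \<open>Y\<close> from \<open>star\<close>, stay within the
    radius \<open>r\<close> of the linearization estimates.\<close>
  show "r / 4 > 0" using r by simp
  fix X' U'
  assume asm: "NLP_feasible tau N f x0 X' U' \<and> (\<forall>i\<in>{0..N}. norm (X' i - solX Y i) < r / 4) \<and>
     (\<forall>i\<in>{1..N}. norm (U' i - solU Y i) < r / 4) \<and>
     ((\<exists>i\<in>{0..N}. X' i \<noteq> solX Y i) \<or> (\<exists>i\<in>{1..N}. U' i \<noteq> solU Y i))"
  have NN: "N \<in> {1..N}" using N by simp
  define y where "y i = fst (Y i)" for i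
  define y' where "y' i = (X' i, U' i)" for i
  define \<delta> where "\<delta> i = X' i - fst (y i)" for i
  define g where "g z = f (fst z) (snd z)" for z
  define gap where "gap i = snd (Y i) \<bullet> g (y' i) - snd (Y i) \<bullet> g (y i) - snd (Y i) \<bullet> Dg (y i) (y' i - y i)" for i
  define gapC where "gapC = C (X' N) - C (fst (y N)) - DC (fst (y N)) (\<delta> N)"
  have near': "norm (Y i - star i) \<le> r" if "i \<in> {1..N}" for i using near[OF that] r by linarith
  have y: "y i \<in> cball (zs (tau i)) r" and li: "snd (Y i) \<in> cball (lams (tau i)) r" if "i \<in> {1..N}" for i
    using near_in[where Y = Y, OF _ near'[OF that]] that unfolding y_def by auto
  have y': "y' i \<in> cball (zs (tau i)) r" if "i \<in> {1..N}" for i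
  proof -
    have "norm (X' i - fst (y i)) < r / 4" "norm (U' i - snd (y i)) < r / 4"
      using asm that unfolding solX_def solU_def y_def by (auto dest!: bspec[of _ _ i])
    moreover have "norm (y' i - y i) \<le> norm (X' i - fst (y i)) + norm (U' i - snd (y i))"
      using norm_Pair_le[of "X' i - fst (y i)" "U' i - snd (y i)"] unfolding y'_def by (metis diff_Pair prod.collapse)
    moreover have "norm (y i - zs (tau i)) \<le> r / 2"
      using near[OF that] triple_norm_le(4)[of "Y i - star i"] unfolding star_def y_def by simp
    ultimately have "norm (y' i - zs (tau i)) \<le> r"
      using norm_triangle_ineq[of "y' i - y i" "y i - zs (tau i)"] by simp
    then show ?thesis by (simp add: dist_norm norm_minus_commute)
  qed
  \<comment> \<open>The Hamiltonian gradient is monotone with modulus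
    \<open>\<alpha> - e > 0\<close>: \<open>K\<close> is coercive with \<open>\<alpha>\<close>, and
    the linearization error takes away at most \<open>e\<close>.\<close>
  have gap_pos: "gap i > 0" if i: "i \<in> {1..N}" and ne: "y i \<noteq> y' i" for i
    unfolding gap_def
  proof (rule strict_first_order_convexity[where S = "cball (zs (tau i)) r" and \<phi> = "\<lambda>z. snd (Y i) \<bullet> g z"
        and \<phi>' = "\<lambda>z v. snd (Y i) \<bullet> Dg z v"])
    fix z assume "z \<in> cball (zs (tau i)) r"
    then have "z \<in> \<Omega>" using subsetD[OF cball_r_subset[OF tau_in[of i]], of z] i by simp
    then show "((\<lambda>z. snd (Y i) \<bullet> g z) has_derivative (\<lambda>v. snd (Y i) \<bullet> Dg z v)) (at z)"
      unfolding g_def by (intro has_derivative_inner_right Dg)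
  next
    fix z z' assume z: "z \<in> cball (zs (tau i)) r" "z' \<in> cball (zs (tau i)) r" "z \<noteq> z'"
    have t: "tau i \<in> {-1..1}" using tau_in i by simp
    define h where "h = gH z' (snd (Y i)) - gH z (snd (Y i)) - K (tau i) (z' - z)"
    have "norm h \<le> e * norm (z' - z)"
      using lin_H[OF t z(1,2)[unfolded zs_def] li[OF i] li[OF i]] unfolding h_def
      by (simp add: linear_0[OF linear_gH])
    then have "\<bar>h \<bullet> (z' - z)\<bar> \<le> e * norm (z' - z) * norm (z' - z)"
      by (intro order_trans[OF Cauchy_Schwarz_ineq2] mult_right_mono) auto
    moreover have "snd (Y i) \<bullet> Dg z' (z' - z) - snd (Y i) \<bullet> Dg z (z' - z) = K (tau i) (z' - z) \<bullet> (z' - z) + h \<bullet> (z' - z)"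
      unfolding h_def inner_diff_left[of _ _ "z' - z"] gH_inner by simp
    moreover have "e * (norm (z' - z) * norm (z' - z)) < \<alpha> * (norm (z' - z) * norm (z' - z))"
      using e z(3) by (intro mult_strict_right_mono) auto
    moreover note K_coercive[OF t, of "z' - z"]
    ultimately show "snd (Y i) \<bullet> Dg z' (z' - z) - snd (Y i) \<bullet> Dg z (z' - z) > 0"
      by (simp add: power2_eq_square mult.assoc)
  qed (use y[OF i] y'[OF i] ne in auto)
  have gap_nonneg: "gap i \<ge> 0" if "i \<in> {1..N}" for i
    using gap_pos[OF that] by (cases "y i = y' i") (auto simp: gap_def blinfun.zero_right)
  have "fst z \<in> cball (xs 1) r" if "z \<in> cball (zs (tau N)) r" for z
    using that dist_fst_le[of "zs 1" z] by (simp add: zs_def tau_N)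
  from this[OF y[OF NN]] this[OF y'[OF NN]]
  have yN: "fst (y N) \<in> cball (xs 1) r" "X' N \<in> cball (xs 1) r" by (simp_all add: y'_def)
  have gapC_nonneg: "gapC \<ge> 0"
  proof (cases "fst (y N) = X' N")
    case True then show ?thesis by (simp add: gapC_def \<delta>_def)
  next
    case False
    have "gapC > 0"
      unfolding gapC_def \<delta>_def
    proof (rule strict_first_order_convexity[where S = "cball (xs 1) r" and \<phi> = C and \<phi>' = "\<lambda>z. blinfun_apply (DC z)"])
      show "(C has_derivative blinfun_apply (DC z)) (at z)" if "z \<in> cball (xs 1) r" for z
        using that r by (intro DC) auto
    next
      fix z z' assume z: "z \<in> cball (xs 1) r" "z' \<in> cball (xs 1) r" "z \<noteq> z'"
      define h where "h = gC z' - gC z - T (z' - z)"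
      have "norm h \<le> e * norm (z' - z)" using lin_C[OF z(1,2)] unfolding h_def .
      then have "\<bar>h \<bullet> (z' - z)\<bar> \<le> e * norm (z' - z) * norm (z' - z)"
        by (intro order_trans[OF Cauchy_Schwarz_ineq2] mult_right_mono) auto
      moreover have "DC z' (z' - z) - DC z (z' - z) = T (z' - z) \<bullet> (z' - z) + h \<bullet> (z' - z)"
        unfolding h_def inner_diff_left[of _ _ "z' - z"] gC_inner by simp
      moreover have "e * (norm (z' - z) * norm (z' - z)) < \<alpha> * (norm (z' - z) * norm (z' - z))"
        using e z(3) by (intro mult_strict_right_mono) auto
      moreover note T_coercive[of "z' - z"]
      ultimately show "DC z' (z' - z) - DC z (z' - z) > 0"
        by (simp add: power2_eq_square mult.assoc)
    qed (use yN False in auto)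
    then show ?thesis by simp
  qed
  have X'0: "X' 0 = x0" using asm unfolding NLP_feasible_def by blast
  have dyn: "g (y' i) - g (y i) = (\<Sum>j=1..N. Dmat tau N i j *\<^sub>R \<delta> j)" if i: "i \<in> {1..N}" for i
  proof -
    have "g (y' i) = (\<Sum>j=1..N. Dmat tau N i j *\<^sub>R (X' j - x0))"
      using asm i X'0 unfolding NLP_feasible_def Dmat_sum_shift by (simp add: g_def y'_def)
    moreover have "g (y i) = (\<Sum>j=1..N. Dmat tau N i j *\<^sub>R (fst (y j) - x0))"
      using state_equation[OF i] by (simp add: g_def y_def)
    ultimately show ?thesis by (simp add: sum_subtractf[symmetric] scaleR_diff_right[symmetric] \<delta>_def)
  qed
  have "(\<Sum>i=1..N. w i * (snd (Y i) \<bullet> (g (y' i) - g (y i)))) =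
      (\<Sum>i=1..N. w i * (snd (Y i) \<bullet> (\<Sum>j=1..N. Dmat tau N i j *\<^sub>R \<delta> j)))"
    by (intro sum.cong refl) (simp only: dyn)
  also have "\<dots> = (\<Sum>j=1..N. - w j * ((\<Sum>i=1..N. Dddag tau w N j i *\<^sub>R snd (Y i)) \<bullet> \<delta> j))"
    by (rule weighted_summation_by_parts[OF w_pos]) (simp_all add: Dddag_def)
  also have "\<dots> = (\<Sum>j=1..N. w j * (fst (gH (y j) (snd (Y j))) \<bullet> \<delta> j) + (if j = N then gC (fst (y N)) \<bullet> \<delta> N else 0))"
  proof (intro sum.cong refl)
    fix j assume j: "j \<in> {1..N}"
    show "- w j * ((\<Sum>i=1..N. Dddag tau w N j i *\<^sub>R snd (Y i)) \<bullet> \<delta> j) =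
      w j * (fst (gH (y j) (snd (Y j))) \<bullet> \<delta> j) + (if j = N then gC (fst (y N)) \<bullet> \<delta> N else 0)"
      unfolding costate_equation[OF j] y_def using w_pos[OF j] by (auto simp: inner_diff_left right_diff_distrib)
  qed
  also have "\<dots> = (\<Sum>j=1..N. w j * (fst (gH (y j) (snd (Y j))) \<bullet> \<delta> j)) + gC (fst (y N)) \<bullet> \<delta> N"
    using N by (simp add: sum.distrib)
  finally have parts: "(\<Sum>i=1..N. w i * (snd (Y i) \<bullet> (g (y' i) - g (y i)))) =
      (\<Sum>j=1..N. w j * (fst (gH (y j) (snd (Y j))) \<bullet> \<delta> j)) + gC (fst (y N)) \<bullet> \<delta> N" .
  \<comment> \<open>The control part of the first-order term vanishes by
    \<open>control_equation\<close>, leaving only the state increment.\<close>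
  have gap_eq: "gap i = snd (Y i) \<bullet> (g (y' i) - g (y i)) - fst (gH (y i) (snd (Y i))) \<bullet> \<delta> i" if i: "i \<in> {1..N}" for i
  proof -
    have "snd (Y i) \<bullet> Dg (y i) (y' i - y i) = gH (y i) (snd (Y i)) \<bullet> (y' i - y i)" by (rule gH_inner[symmetric])
    also have "\<dots> = fst (gH (y i) (snd (Y i))) \<bullet> \<delta> i"
      using control_equation[OF i] unfolding y_def[symmetric] inner_prod_def by (simp add: \<delta>_def y'_def)
    finally show ?thesis unfolding gap_def by (simp add: inner_diff_right)
  qed
  have "(\<Sum>i=1..N. w i * gap i) = (\<Sum>i=1..N. w i * (snd (Y i) \<bullet> (g (y' i) - g (y i))) - w i * (fst (gH (y i) (snd (Y i))) \<bullet> \<delta> i))"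
    by (intro sum.cong refl) (simp add: gap_eq right_diff_distrib)
  also have "\<dots> = gC (fst (y N)) \<bullet> \<delta> N" unfolding sum_subtractf parts by simp
  finally have "C (X' N) - C (fst (y N)) = gapC + (\<Sum>i=1..N. w i * gap i)"
    unfolding gapC_def gC_inner by simp
  moreover have "(\<Sum>i=1..N. w i * gap i) > 0"
  proof -
    \<comment> \<open>Feasible points agree at node 0, so distinct ones differ at some node with
      positive weight; this makes the inequality strict.\<close>
    have "\<exists>i\<in>{1..N}. y i \<noteq> y' i"
    proof (rule ccontr)
      assume "\<not> ?thesis"
      then have eq: "fst (Y i) = (X' i, U' i)" if "i \<in> {1..N}" for i using that unfolding y_def y'_def by blast
      have "X' i = solX Y i" if "i \<in> {0..N}" for i
        using eq[of i] X'0 that by (cases "i = 0") (auto simp: solX_def)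
      moreover have "U' i = solU Y i" if "i \<in> {1..N}" for i using eq[OF that] by (simp add: solU_def)
      ultimately show False using asm by blast
    qed
    then obtain i where i: "i \<in> {1..N}" "y i \<noteq> y' i" by blast
    have "0 < w i * gap i" using w_pos[OF i(1)] gap_pos[OF i] by simp
    also have "\<dots> \<le> (\<Sum>i=1..N. w i * gap i)"
      using i(1) w_pos gap_nonneg by (intro member_le_sum) (auto simp: less_imp_le)
    finally show ?thesis .
  qed
  ultimately show "C (solX Y N) < C (X' N)" using gapC_nonneg N by (simp add: solX_def y_def)
qed

text \<open>The terminal gradient moves by at most \<open>(b + e) * d\<close>, each Hamiltonian
  gradient by \<open>2 * (b + e) * d\<close>, and the weights sum to 2: together the factor 5.
  \<open>q\<close> is the quadrature error at the optimum.\<close>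

lemma initial_costate_bound:
  assumes near: "\<And>i. i \<in> {1..N} \<Longrightarrow> norm (Y i - star i) \<le> d" and d: "d \<le> r"
    and quad: "norm (gC (xs 1) - lams (-1) + (\<Sum>i=1..N. w i *\<^sub>R fst (gH (zs (tau i)) (lams (tau i))))) \<le> q"
  shows "norm (solLam Y 0 - lams (-1)) \<le> 5 * (b + e) * d + q"
proof -
  have NN: "N \<in> {1..N}" using N by simp
  have d0: "d \<ge> 0" using order_trans[OF norm_ge_zero near[OF NN]] .
  have near': "norm (Y i - star i) \<le> r" if "i \<in> {1..N}" for i using near[OF that] d by linarith
  define h where "h i = gH (fst (Y i)) (snd (Y i)) - gH (zs (tau i)) (lams (tau i))" for i
  have h: "norm (h i) \<le> 2 * (b + e) * d" if i: "i \<in> {1..N}" for i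
  proof -
    have t: "tau i \<in> {-1..1}" using tau_in i by simp
    let ?dz = "fst (Y i) - zs (tau i)" and ?dl = "snd (Y i) - lams (tau i)"
    have dz: "norm ?dz \<le> d" "norm ?dl \<le> d"
      using near[OF i] triple_norm_le(3,4)[of "Y i - star i"] by (auto simp: star_def)
    have "norm (h i - (gH (zs (tau i)) ?dl + K (tau i) ?dz)) \<le> e * (norm ?dz + norm ?dl)"
      unfolding h_def zs_def
      using near_in[where Y = Y, OF _ near'[OF i]] i r by (intro lin_H t) (auto simp: zs_def)
    also have "\<dots> \<le> e * (d + d)" using dz e by (intro mult_left_mono add_mono) auto
    finally have 1: "norm (h i - (gH (zs (tau i)) ?dl + K (tau i) ?dz)) \<le> e * (d + d)" .
    have 2: "norm (gH (zs (tau i)) ?dl) \<le> b * d"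
      by (rule order_trans[OF gH_norm_le mult_left_mono[OF dz(2) b]]) (simp add: zs_def Dg_bound[OF t])
    have 3: "norm (K (tau i) ?dz) \<le> b * d"
      using b dz by (intro order_trans[OF K_bound[OF t]] mult_left_mono) auto
    have "norm (h i) \<le> e * (d + d) + (b * d + b * d)"
      using norm_triangle_ineq[of "h i - (gH (zs (tau i)) ?dl + K (tau i) ?dz)" "gH (zs (tau i)) ?dl + K (tau i) ?dz"]
        norm_triangle_ineq[of "gH (zs (tau i)) ?dl" "K (tau i) ?dz"] 1 2 3 by simp
    then show ?thesis by (simp add: algebra_simps)
  qed
  have hC: "norm (gC (fst (fst (Y N))) - gC (xs 1)) \<le> (b + e) * d"
  proof -
    let ?dx = "fst (fst (Y N)) - xs 1"
    have dx: "norm ?dx \<le> d" using near[OF NN] triple_norm_le(1)[of "Y N - star N"] by (auto simp: star_def zs_def tau_N)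
    have "norm (gC (fst (fst (Y N))) - gC (xs 1) - T ?dx) \<le> e * norm ?dx"
      using near_in(3)[where Y = Y, OF _ near'[OF NN]] r by (intro lin_C) auto
    also have "\<dots> \<le> e * d" using dx e by (intro mult_left_mono) auto
    finally have "norm (gC (fst (fst (Y N))) - gC (xs 1) - T ?dx) \<le> e * d" .
    moreover have "norm (T ?dx) \<le> b * d" using b dx by (intro order_trans[OF T_bound] mult_left_mono) auto
    ultimately show ?thesis
      using norm_triangle_ineq[of "gC (fst (fst (Y N))) - gC (xs 1) - T ?dx" "T ?dx"] by (simp add: distrib_right)
  qed
  have "norm (\<Sum>i=1..N. w i *\<^sub>R fst (h i)) \<le> 2 * (2 * (b + e) * d)"
  proof (rule norm_sum_scaleR_le)
    have "(\<Sum>i=1..N. \<bar>w i\<bar>) = (\<Sum>i=1..N. w i)" using w_pos by (intro sum.cong) (auto simp: less_imp_le)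
    then show "(\<Sum>i=1..N. \<bar>w i\<bar>) \<le> 2" using radau_weights_sum[OF R] by simp
    show "norm (fst (h i)) \<le> 2 * (b + e) * d" if "i \<in> {1..N}" for i
      using norm_fst_le_norm[of "h i"] h[OF that] by linarith
    show "0 \<le> 2 * (b + e) * d" using b e d0 by simp
  qed
  moreover have "solLam Y 0 - lams (-1) = (gC (fst (fst (Y N))) - gC (xs 1)) + (\<Sum>i=1..N. w i *\<^sub>R fst (h i)) +
     (gC (xs 1) - lams (-1) + (\<Sum>i=1..N. w i *\<^sub>R fst (gH (zs (tau i)) (lams (tau i)))))"
    unfolding solLam_def h_def by (simp add: scaleR_diff_right sum_subtractf)
  then have "norm (solLam Y 0 - lams (-1)) \<le> norm (gC (fst (fst (Y N))) - gC (xs 1)) + norm (\<Sum>i=1..N. w i *\<^sub>R fst (h i)) +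
     norm (gC (xs 1) - lams (-1) + (\<Sum>i=1..N. w i *\<^sub>R fst (gH (zs (tau i)) (lams (tau i)))))"
    by (simp only:) (intro norm_triangle_le add_right_mono norm_triangle_ineq)
  ultimately show ?thesis using hC quad by (simp add: algebra_simps)
qed

end

end

subsection \<open>Convergence\<close>

lemma Ck_on_continuous: "Ck_on k g \<Longrightarrow> continuous_on {-1..1} g"
  unfolding Ck_on_def by auto

text \<open>\<open>g\<close> will be a right-hand side containing the control. Its smoothness is
  inherited from \<open>h\<close>, since on the interval it equals the first derivative of
  \<open>h\<close>.\<close>

lemma Ck_derivative_approximation:
  fixes h g :: "real \<Rightarrow> real^'k"
  assumes h: "Ck_on (r + 1) h" and r: "r \<ge> 2"
    and g: "\<And>t. t \<in> {-1..1} \<Longrightarrow> (h has_vector_derivative g t) (at t within {-1..1})"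
  shows "\<exists>c\<ge>0. \<forall>n\<ge>1. \<forall>k. \<exists>Q. degree Q \<le> n \<and>
     (\<forall>t\<in>{-1..1}. \<bar>poly Q t - g t $ k\<bar> \<le> c * real n powr (2 - real r))"
proof -
  obtain d where d: "d 0 = h"
    "\<And>j t. j < r + 1 \<Longrightarrow> t \<in> {-1..1} \<Longrightarrow> (d j has_vector_derivative d (Suc j) t) (at t within {-1..1})"
    "\<And>j. j \<le> r + 1 \<Longrightarrow> continuous_on {-1..1} (d j)"
    using h unfolding Ck_on_def by blast
  have eq: "d 1 t = g t" if "t \<in> {-1..1}" for t
    using vector_derivative_unique_within_closed_interval[of "-1" 1 t h "d 1 t" "g t"] d(2)[of 0 t] d(1) g[OF that] that
    by (auto simp: cbox_interval)
  have "Ck_on r (\<lambda>t. d 1 t $ k)" for k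
    unfolding Ck_on_def
  proof (intro exI[of _ "\<lambda>j t. d (Suc j) t $ k"] conjI allI impI ballI)
    show "((\<lambda>t. d (Suc j) t $ k) has_vector_derivative d (Suc (Suc j)) t $ k) (at t within {-1..1})"
      if "j < r" "t \<in> {-1..1}" for j t
      using that by (intro bounded_linear.has_vector_derivative[OF bounded_linear_vec_nth] d) auto
    show "continuous_on {-1..1} (\<lambda>t. d (Suc j) t $ k)" if "j \<le> r" for j
      using that by (intro continuous_intros d) auto
  qed simp
  then have "\<exists>c\<ge>0. \<forall>n\<ge>1. \<exists>Q. degree Q \<le> n \<and> (\<forall>t\<in>{-1..1}. \<bar>poly Q t - d 1 t $ k\<bar> \<le> c * real n powr (2 - real r))" for k
    using Ck_polynomial_approximation[OF _ r] by blast
  then obtain c where c: "\<And>k. c k \<ge> 0" "\<And>k n. n \<ge> 1 \<Longrightarrow>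
      \<exists>Q. degree Q \<le> n \<and> (\<forall>t\<in>{-1..1}. \<bar>poly Q t - d 1 t $ k\<bar> \<le> c k * real n powr (2 - real r))" by metis
  show ?thesis
  proof (intro exI[of _ "\<Sum>k\<in>UNIV. c k"] conjI allI impI)
    show "0 \<le> (\<Sum>k\<in>UNIV. c k)" using c(1) by (intro sum_nonneg)
    fix n :: nat and k assume "1 \<le> n"
    then obtain Q where Q: "degree Q \<le> n" "\<And>t. t \<in> {-1..1} \<Longrightarrow> \<bar>poly Q t - d 1 t $ k\<bar> \<le> c k * real n powr (2 - real r)"
      using c(2) by meson
    have "c k \<le> (\<Sum>k\<in>UNIV. c k)" using c(1) by (intro member_le_sum) auto
    then have le: "c k * real n powr (2 - real r) \<le> (\<Sum>k\<in>UNIV. c k) * real n powr (2 - real r)"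
      by (intro mult_right_mono) auto
    have "\<bar>poly Q t - g t $ k\<bar> \<le> (\<Sum>k\<in>UNIV. c k) * real n powr (2 - real r)" if "t \<in> {-1..1}" for t
      using order_trans[OF Q(2)[OF that] le] unfolding eq[OF that] .
    then show "\<exists>Q. degree Q \<le> n \<and> (\<forall>t\<in>{-1..1}. \<bar>poly Q t - g t $ k\<bar> \<le> (\<Sum>k\<in>UNIV. c k) * real n powr (2 - real r))"
      using Q(1) by blast
  qed
qed

lemma vector_consistency:
  fixes G g :: "real \<Rightarrow> real^'k"
  assumes R: "radau_rule N tau w" and N: "N \<ge> 2"
    and G: "\<And>t. t \<in> {-1..1} \<Longrightarrow> (G has_vector_derivative g t) (at t within {-1..1})"
    and Q: "\<And>k. \<exists>Q. degree Q \<le> N - 2 \<and> (\<forall>t\<in>{-1..1}. \<bar>poly Q t - g t $ k\<bar> \<le> e)"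
  shows "is_inverse_on N (\<lambda>i j. Dmat tau N i j) E \<Longrightarrow> inf_norm_on N E \<le> 2 \<Longrightarrow> i \<in> {1..N} \<Longrightarrow>
      norm (G (tau i) - G (-1) - (\<Sum>j=1..N. E i j *\<^sub>R g (tau j))) \<le> real CARD('k) * (4 * e)"
    and "is_inverse_on N (\<lambda>i j. Dddag tau w N i j) E' \<Longrightarrow> inf_norm_on N E' \<le> 2 \<Longrightarrow> i \<in> {1..N} \<Longrightarrow>
      norm (G (tau i) - G 1 - (\<Sum>j=1..N. E' i j *\<^sub>R g (tau j))) \<le> real CARD('k) * (4 * e)"
    and "norm (G 1 - G (-1) - (\<Sum>j=1..N. w j *\<^sub>R g (tau j))) \<le> real CARD('k) * (4 * e)"
proof -
  have Gk: "((\<lambda>t. G t $ k) has_vector_derivative g t $ k) (at t within {-1..1})" if "t \<in> {-1..1}" for t k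
    by (rule bounded_linear.has_vector_derivative[OF bounded_linear_vec_nth G[OF that]])
  obtain Q where Q: "\<And>k. degree (Q k) \<le> N - 2" "\<And>k t. t \<in> {-1..1} \<Longrightarrow> \<bar>poly (Q k) t - g t $ k\<bar> \<le> e"
    using Q by metis
  show "norm (G (tau i) - G (-1) - (\<Sum>j=1..N. E i j *\<^sub>R g (tau j))) \<le> real CARD('k) * (4 * e)"
    if "is_inverse_on N (\<lambda>i j. Dmat tau N i j) E" "inf_norm_on N E \<le> 2" "i \<in> {1..N}"
    using state_consistency[OF R N Gk Q that] by (intro norm_le_card_component) simp
  show "norm (G (tau i) - G 1 - (\<Sum>j=1..N. E' i j *\<^sub>R g (tau j))) \<le> real CARD('k) * (4 * e)"
    if "is_inverse_on N (\<lambda>i j. Dddag tau w N i j) E'" "inf_norm_on N E' \<le> 2" "i \<in> {1..N}"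
    using costate_consistency[OF R N Gk Q that] by (intro norm_le_card_component) simp
  show "norm (G 1 - G (-1) - (\<Sum>j=1..N. w j *\<^sub>R g (tau j))) \<le> real CARD('k) * (4 * e)"
    using quadrature_consistency[OF R N Gk Q] by (intro norm_le_card_component) simp
qed

text \<open>\<open>N - 2\<close> is at least \<open>N / 3\<close> from \<open>N = 3\<close> on, and
  the exponent is not positive.\<close>

lemma powr_shift_bound:
  fixes N \<eta> :: nat
  assumes "N \<ge> 3" "\<eta> \<ge> 2"
  shows "real (N - 2) powr (2 - real \<eta>) \<le> 3 powr (real \<eta> - 2) * real N powr (2 - real \<eta>)"
proof -
  have "real (N - 2) powr (2 - real \<eta>) \<le> (real N / 3) powr (2 - real \<eta>)"
    using assms by (intro powr_mono2') (auto simp: of_nat_diff)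
  also have "\<dots> = 3 powr (real \<eta> - 2) * real N powr (2 - real \<eta>)"
    using assms powr_minus[of 3 "real \<eta> - 2"] by (simp add: powr_divide field_simps)
  finally show ?thesis .
qed

theorem theorem1p1:
  fixes f :: "real^'n \<Rightarrow> real^'m \<Rightarrow> real^'n"
    and C :: "real^'n \<Rightarrow> real"
    and x0 :: "real^'n"
    and xs :: "real \<Rightarrow> real^'n" and us :: "real \<Rightarrow> real^'m" and lams :: "real \<Rightarrow> real^'n"
    and \<Omega> :: "((real^'n) \<times> (real^'m)) set"
    and \<rho> \<alpha> :: real and \<eta> :: nat
    and tau w :: "nat \<Rightarrow> nat \<Rightarrow> real"
  assumes eta: "\<eta> \<ge> 3"
    and radau: "\<forall>N\<ge>2. radau_rule N (tau N) (w N)"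
    and locmin: "P_local_min f C x0 xs us"
    and Omega_open: "open \<Omega>" and rho_pos: "\<rho> > 0"
    and balls: "\<forall>t\<in>{-1..1}. cball (xs t, us t) \<rho> \<subseteq> \<Omega>"
    and f_C2: "C2_on (closure \<Omega>) (\<lambda>z. f (fst z) (snd z))"
    and C_C2: "C2_on (cball (xs 1) \<rho>) C"
    and costate: "\<forall>t\<in>{-1..1}. (lams has_vector_derivative - gradx_H f (xs t) (us t) (lams t)) (at t within {-1..1})"
    and costate_end: "lams 1 = grad C (xs 1)"
    and stationary: "\<forall>t\<in>{-1..1}. gradu_H f (xs t) (us t) (lams t) = 0"
    and A1: "Ck_on (\<eta> + 1) xs" "Ck_on (\<eta> + 1) lams"
    and A2: "\<alpha> > 0" "eigenvalues_gt (hess C (xs 1)) \<alpha>"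
        "\<forall>t\<in>{-1..1}. eigenvalues_gt (hess_pair (\<lambda>z. Ham f (fst z) (snd z) (lams t)) (xs t, us t)) \<alpha>"
    and A3: "\<forall>t\<in>{-1..1}. mat_inf_norm (jac_x f (xs t) (us t)) \<le> 1/4 \<and>
                          mat_inf_norm (transpose (jac_x f (xs t) (us t))) \<le> 1/4"
    and P1: "\<forall>N\<ge>2. prop_P1 (tau N) N"
    and P2: "\<forall>N\<ge>2. prop_P2 (tau N) (w N) N"
    and P3: "\<forall>N\<ge>2. prop_P3 (tau N) (w N) N"
    and P4: "\<forall>N\<ge>2. prop_P4 (tau N) (w N) N"
  shows "\<exists>c N0. \<forall>N\<ge>N0. N > \<eta> + 1 \<longrightarrow>
     (\<exists>X U Lam. NLP_strict_local_min (tau N) N f C x0 X U \<and>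
        T_zero (tau N) (w N) N f C x0 X U Lam \<and>
        (\<forall>i\<in>{0..N}. norm (X i - xs (tau N i)) \<le> c * real N powr (2 - real \<eta>)) \<and>
        (\<forall>i\<in>{1..N}. norm (U i - us (tau N i)) \<le> c * real N powr (2 - real \<eta>)) \<and>
        (\<forall>i\<in>{0..N}. norm (Lam i - lams (tau N i)) \<le> c * real N powr (2 - real \<eta>)))"
proof -
  obtain Dg D2g where Dg': "\<And>z. z \<in> closure \<Omega> \<Longrightarrow> ((\<lambda>z. f (fst z) (snd z)) has_derivative blinfun_apply (Dg z)) (at z within closure \<Omega>)"
    and D2g': "\<And>z. z \<in> closure \<Omega> \<Longrightarrow> (Dg has_derivative blinfun_apply (D2g z)) (at z within closure \<Omega>)"
    and conts: "continuous_on (closure \<Omega>) Dg" "continuous_on (closure \<Omega>) D2g"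
    using f_C2 unfolding C2_on_def by blast
  obtain DC D2C where DC': "\<And>z. z \<in> cball (xs 1) \<rho> \<Longrightarrow> (C has_derivative blinfun_apply (DC z)) (at z within cball (xs 1) \<rho>)"
    and D2C': "\<And>z. z \<in> cball (xs 1) \<rho> \<Longrightarrow> (DC has_derivative blinfun_apply (D2C z)) (at z within cball (xs 1) \<rho>)"
    and contsC: "continuous_on (cball (xs 1) \<rho>) D2C"
    using C_C2 unfolding C2_on_def by blast
  have atO: "at z within closure \<Omega> = at z" "z \<in> closure \<Omega>" if "z \<in> \<Omega>" for z
    using at_within_open_subset[OF that Omega_open closure_subset] closure_subset that by auto
  have atB: "at z within cball (xs 1) \<rho> = at z" "z \<in> cball (xs 1) \<rho>" if "z \<in> ball (xs 1) \<rho>" for z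
    using at_within_open_subset[OF that open_ball ball_subset_cball] ball_subset_cball that by auto
  have feas: "P_feasible f x0 xs us" using locmin unfolding P_local_min_def by blast
  have xs0: "xs (-1) = x0" and us_cont: "continuous_on {-1..1} us"
    and dyn: "\<And>t. t \<in> {-1..1} \<Longrightarrow> (xs has_vector_derivative f (xs t) (us t)) (at t within {-1..1})"
    using feas unfolding P_feasible_def by auto
  have Dg: "((\<lambda>z. f (fst z) (snd z)) has_derivative blinfun_apply (Dg z)) (at z)"
    and D2g: "(Dg has_derivative blinfun_apply (D2g z)) (at z)" if "z \<in> \<Omega>" for z
    using Dg'[OF atO(2)[OF that]] D2g'[OF atO(2)[OF that]] unfolding atO(1)[OF that] .
  have DC: "(C has_derivative blinfun_apply (DC z)) (at z)"
    and D2C: "(DC has_derivative blinfun_apply (D2C z)) (at z)" if "z \<in> ball (xs 1) \<rho>" for z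
    using DC'[OF atB(2)[OF that]] D2C'[OF atB(2)[OF that]] unfolding atB(1)[OF that] .
  interpret sp: smooth_control_problem f C xs us lams \<Omega> \<rho> \<alpha> Dg D2g DC D2C
    by (rule smooth_control_problem.intro[OF Omega_open rho_pos A2(1) bspec[OF balls] Dg D2g
          continuous_on_subset[OF conts(1) closure_subset] continuous_on_subset[OF conts(2) closure_subset]
          DC D2C continuous_on_subset[OF contsC ball_subset_cball] Ck_on_continuous[OF A1(1)] us_cont
          Ck_on_continuous[OF A1(2)] A2(2) bspec[OF A2(3)] bspec[OF A3]])
  obtain b where b: "b \<ge> 0" "\<And>t. t \<in> {-1..1} \<Longrightarrow> norm (Dg (sp.zs t)) \<le> b"
    "\<And>t v. t \<in> {-1..1} \<Longrightarrow> norm (sp.K t v) \<le> b * norm v" "\<And>v. norm (sp.T v) \<le> b * norm v"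
    using sp.coefficient_bounds by blast
  define n where "n = real CARD('n)"
  define st where "st = 2 * state_const n b \<alpha> + control_const n b \<alpha> + 1"
  have n0: "n \<ge> 0" unfolding n_def by simp
  have st: "st > 0" unfolding st_def using stability_consts_nonneg[OF n0 b(1) A2(1)] by auto
  \<comment> \<open>The first bound secures convexity near the solution, the second the Newton
    contraction.\<close>
  define e where "e = min (\<alpha> / 2) (1 / (18 * st))"
  have e: "0 < e" "e < \<alpha>" "18 * st * e \<le> 1"
  proof -
    show "0 < e" "e < \<alpha>" unfolding e_def using A2(1) st by auto
    have "18 * st * e \<le> 18 * st * (1 / (18 * st))" unfolding e_def using st by (intro mult_left_mono) auto
    then show "18 * st * e \<le> 1" using st by simp
  qed
  obtain r where r: "r > 0" "r < \<rho>"
    and linf: "\<And>t y y'. t \<in> {-1..1} \<Longrightarrow> y \<in> cball (sp.zs t) r \<Longrightarrow> y' \<in> cball (sp.zs t) r \<Longrightarrow>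
       norm (f (fst y') (snd y') - f (fst y) (snd y) - Dg (sp.zs t) (y' - y)) \<le> e * norm (y' - y)"
    and linH: "\<And>t y y' l l'. t \<in> {-1..1} \<Longrightarrow> y \<in> cball (sp.zs t) r \<Longrightarrow> y' \<in> cball (sp.zs t) r \<Longrightarrow>
       l \<in> cball (lams t) r \<Longrightarrow> l' \<in> cball (lams t) r \<Longrightarrow>
       norm (sp.gH y' l' - sp.gH y l - (sp.gH (sp.zs t) (l' - l) + sp.K t (y' - y))) \<le> e * (norm (y' - y) + norm (l' - l))"
    and linC: "\<And>x x'. x \<in> cball (xs 1) r \<Longrightarrow> x' \<in> cball (xs 1) r \<Longrightarrow> norm (sp.gC x' - sp.gC x - sp.T (x' - x)) \<le> e * norm (x' - x)"
    using sp.linearization_estimates[OF e(1)] by blast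
  have eta2: "\<eta> \<ge> 2" using eta by simp
  obtain c1 where c1: "c1 \<ge> 0" "\<And>n k. n \<ge> 1 \<Longrightarrow> \<exists>Q. degree Q \<le> n \<and>
     (\<forall>t\<in>{-1..1}. \<bar>poly Q t - f (xs t) (us t) $ k\<bar> \<le> c1 * real n powr (2 - real \<eta>))"
    using Ck_derivative_approximation[OF A1(1) eta2 dyn] by blast
  obtain c2 where c2: "c2 \<ge> 0" "\<And>n k. n \<ge> 1 \<Longrightarrow> \<exists>Q. degree Q \<le> n \<and>
     (\<forall>t\<in>{-1..1}. \<bar>poly Q t - (- gradx_H f (xs t) (us t) (lams t)) $ k\<bar> \<le> c2 * real n powr (2 - real \<eta>))"
    using Ck_derivative_approximation[where g = "\<lambda>t. - gradx_H f (xs t) (us t) (lams t)",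
      OF A1(2) eta2 bspec[OF costate]] by blast
  define c3 where "c3 = (c1 + c2) * 3 powr (real \<eta> - 2)"
  \<comment> \<open>4 is the consistency factor and \<open>n\<close> counts components. In
    \<open>c\<close>, the term \<open>2 * st * (2 * cd)\<close> is the Newton radius for the
    residual bound \<open>2 * cd\<close>; the rest covers the initial costate.\<close>
  define cd where "cd = n * (4 * c3)"
  define c where "c = (1 + 5 * (b + e)) * (2 * st * (2 * cd)) + cd"
  have c3: "c3 \<ge> 0" unfolding c3_def using c1(1) c2(1) by simp
  have cd: "cd \<ge> 0" unfolding cd_def using c3 n0 by simp
  define N0 where "N0 = nat \<lceil>8 * st * cd / r\<rceil>"
  show ?thesis
  proof (intro exI[of _ c] exI[of _ N0] allI impI)
    fix N assume N0: "N0 \<le> N" and Neta: "\<eta> + 1 < N"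
    have N5: "N \<ge> 5" using Neta eta by simp
    have N2: "N \<ge> 2" and N3: "N \<ge> 3" and N21: "N - 2 \<ge> 1" using N5 by auto
    define q where "q = real N powr (2 - real \<eta>)"
    define \<epsilon> where "\<epsilon> = c3 * q"
    have q0: "q \<ge> 0" unfolding q_def by simp
    have R: "radau_rule N (tau N) (w N)" using radau N2 by blast
    have wpos: "\<And>i. i \<in> {1..N} \<Longrightarrow> 0 < w N i" using R unfolding radau_rule_def by blast
    have shift: "c' * real (N - 2) powr (2 - real \<eta>) \<le> \<epsilon>" if "0 \<le> c'" "c' \<le> c1 + c2" for c'
    proof -
      have "c' * real (N - 2) powr (2 - real \<eta>) \<le> (c1 + c2) * (3 powr (real \<eta> - 2) * q)"
        unfolding q_def using that c1(1) c2(1) by (intro mult_mono powr_shift_bound N3 eta2) auto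
      then show ?thesis unfolding \<epsilon>_def c3_def by (simp add: mult.assoc)
    qed
    have Q1: "\<exists>Q. degree Q \<le> N - 2 \<and> (\<forall>t\<in>{-1..1}. \<bar>poly Q t - f (xs t) (us t) $ k\<bar> \<le> \<epsilon>)" for k
      using c1(2)[OF N21, of k] shift[of c1] c1(1) c2(1) by (meson add_increasing2 order_refl order_trans)
    have Q2: "\<exists>Q. degree Q \<le> N - 2 \<and> (\<forall>t\<in>{-1..1}. \<bar>poly Q t - (- gradx_H f (xs t) (us t) (lams t)) $ k\<bar> \<le> \<epsilon>)" for k
      using c2(2)[OF N21, of k] shift[of c2] c1(1) c2(1) by (meson add_increasing order_refl order_trans)
    obtain E where E: "is_inverse_on N (\<lambda>i j. Dmat (tau N) N i j) E" "inf_norm_on N E \<le> 2"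
      using P1 N2 unfolding prop_P1_def by blast
    obtain E' where E': "is_inverse_on N (\<lambda>i j. Dddag (tau N) (w N) N i j) E'" "inf_norm_on N E' \<le> 2"
      using P3 N2 unfolding prop_P3_def by blast
    obtain B where B: "is_inverse_on N (\<lambda>i j. sqrt (w N i) * Dmat (tau N) N i j) B"
      "\<forall>i\<in>{1..N}. sqrt (\<Sum>j=1..N. (B i j)\<^sup>2) \<le> sqrt 2" using P2 N2 unfolding prop_P2_def by blast
    obtain B' where B': "is_inverse_on N (\<lambda>i j. sqrt (w N i) * Dddag (tau N) (w N) N i j) B'"
      "\<forall>i\<in>{1..N}. sqrt (\<Sum>j=1..N. (B' i j)\<^sup>2) \<le> sqrt 2" using P4 N2 unfolding prop_P4_def by blast
    interpret rc: radau_collocation f C xs us lams \<Omega> \<rho> \<alpha> Dg D2g DC D2C N "tau N" "w N" E E' x0 b e r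
    proof (unfold_locales, goal_cases)
      case (5 i) then show ?case by (rule inf_norm_on_row[OF E(2)])
    next
      case (6 i) then show ?case by (rule inf_norm_on_row[OF E'(2)])
    next
      case (7 i v) then show ?case by (intro sum_inverse_row_le[OF E(1) B wpos])
    next
      case (8 i v) then show ?case by (intro sum_inverse_row_le[OF E'(1) B' wpos])
    qed (fact N2 R E E' b[unfolded sp.zs_def] r e linf[unfolded sp.zs_def] linH[unfolded sp.zs_def] linC)+
    have stab: "rc.stab = st" unfolding rc.stab_def st_def n_def ..
    have tin: "tau N i \<in> {-1..1}" if "i \<in> {1..N}" for i using rc.tau_in that by simp
    \<comment> \<open>Stationarity of the optimum: the control component of the residual is exactly
      0, so only state and costate contribute to \<open>res\<close>.\<close>
    have gs: "sp.gH (sp.zs t) (lams t) = (gradx_H f (xs t) (us t) (lams t), 0)" if "t \<in> {-1..1}" for t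
      using sp.gradients_eq_gH[OF sp.zs_in[OF that, unfolded sp.zs_def], of "lams t"] stationary that
      unfolding sp.zs_def by (simp add: prod_eq_iff)
    have gC1: "sp.gC (xs 1) = lams 1" using sp.grad_eq_gC[of "xs 1"] rho_pos costate_end by simp
    have cons: "n * (4 * \<epsilon>) = cd * q" unfolding cd_def \<epsilon>_def by simp
    have res: "norm (rc.residual rc.star i) \<le> 2 * cd * q" if i: "i \<in> {1..N}" for i
    proof -
      have 1: "norm (fst (fst (rc.residual rc.star i))) \<le> cd * q"
        using vector_consistency(1)[OF R N2 dyn Q1 E i] cons unfolding n_def rc.residual_def rc.star_def
        by (simp add: sp.zs_def xs0)
      have 2: "snd (fst (rc.residual rc.star i)) = 0"
        unfolding rc.residual_def rc.star_def using gs[OF tin[OF i]] by simp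
      have "(\<Sum>j=1..N. E' i j *\<^sub>R fst (sp.gH (sp.zs (tau N j)) (lams (tau N j)))) =
          - (\<Sum>j=1..N. E' i j *\<^sub>R - gradx_H f (xs (tau N j)) (us (tau N j)) (lams (tau N j)))"
        using gs[OF tin] by (simp add: sum_negf)
      then have 3: "norm (snd (rc.residual rc.star i)) \<le> cd * q"
        using vector_consistency(2)[OF R N2 bspec[OF costate] Q2 E' i] cons
        unfolding n_def rc.residual_def rc.star_def by (simp add: sp.zs_def rc.tau_N gC1)
      show ?thesis using rc.norm_triple_le[of "rc.residual rc.star i"] 1 2 3 by simp
    qed
    have small: "2 * st * (2 * cd * q) \<le> r / 2"
    proof -
      \<comment> \<open>\<open>\<eta> \<ge> 3\<close> makes the rate at least 1 / N, so the Newton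
        radius drops below \<open>r / 2\<close> once \<open>N\<close> passes
        \<open>N0\<close>.\<close>
      have "q \<le> real N powr (- 1)" unfolding q_def using N5 eta by (intro powr_mono) auto
      then have qN: "q \<le> 1 / real N" using N5 by (simp add: powr_minus_divide)
      have "8 * st * cd / r \<le> real N0" unfolding N0_def by linarith
      then have "8 * st * cd / r \<le> real N" using N0 by linarith
      then have "8 * st * cd \<le> real N * r" using r(1) by (simp add: divide_le_eq)
      have "8 * st * cd * q \<le> 8 * st * cd * (1 / real N)" using qN st cd by (intro mult_left_mono) auto
      also have "\<dots> \<le> real N * r * (1 / real N)" using \<open>8 * st * cd \<le> real N * r\<close> by (intro mult_right_mono) auto
      also have "\<dots> = r" using N5 by simp
      finally show ?thesis by simp
    qed
    define d where "d = 2 * st * (2 * cd * q)"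
    have d: "d \<le> r / 2" "d \<le> r" using small r(1) unfolding d_def by auto
    obtain Y where Y: "\<And>i. i \<in> {1..N} \<Longrightarrow> rc.residual Y i = 0" "\<And>i. i \<in> {1..N} \<Longrightarrow> norm (Y i - rc.star i) \<le> d"
      using rc.discrete_solution_exists[unfolded stab, OF e(3) res d(2)[unfolded d_def]] unfolding d_def by blast
    have dc: "d \<le> c * q" "5 * (b + e) * d + cd * q \<le> c * q" "0 \<le> c * q"
    proof -
      have d0: "d \<ge> 0" unfolding d_def using st cd q0 by simp
      have cq: "c * q = d + 5 * (b + e) * d + cd * q" unfolding c_def d_def by (simp add: algebra_simps)
      have "5 * (b + e) * d \<ge> 0" "cd * q \<ge> 0" using b(1) e(1) d0 cd q0 by auto
      then show "d \<le> c * q" "5 * (b + e) * d + cd * q \<le> c * q" "0 \<le> c * q" unfolding cq using d0 by auto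
    qed
    have quad: "norm (sp.gC (xs 1) - lams (-1) + (\<Sum>i=1..N. w N i *\<^sub>R fst (sp.gH (sp.zs (tau N i)) (lams (tau N i))))) \<le> cd * q"
    proof -
      have "(\<Sum>j=1..N. w N j *\<^sub>R fst (sp.gH (sp.zs (tau N j)) (lams (tau N j)))) =
          - (\<Sum>j=1..N. w N j *\<^sub>R - gradx_H f (xs (tau N j)) (us (tau N j)) (lams (tau N j)))"
        using gs[OF tin] by (simp add: sum_negf)
      then show ?thesis
        using vector_consistency(3)[OF R N2 bspec[OF costate] Q2] cons unfolding n_def by (simp add: gC1)
    qed
    have err: "norm (fst (fst (Y i)) - xs (tau N i)) \<le> d" "norm (snd (fst (Y i)) - us (tau N i)) \<le> d"
      "norm (snd (Y i) - lams (tau N i)) \<le> d" if "i \<in> {1..N}" for i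
      using Y(2)[OF that] rc.triple_norm_le[of "Y i - rc.star i"] by (auto simp: rc.star_def sp.zs_def)
    show "\<exists>X U Lam. NLP_strict_local_min (tau N) N f C x0 X U \<and>
        T_zero (tau N) (w N) N f C x0 X U Lam \<and>
        (\<forall>i\<in>{0..N}. norm (X i - xs (tau N i)) \<le> c * real N powr (2 - real \<eta>)) \<and>
        (\<forall>i\<in>{1..N}. norm (U i - us (tau N i)) \<le> c * real N powr (2 - real \<eta>)) \<and>
        (\<forall>i\<in>{0..N}. norm (Lam i - lams (tau N i)) \<le> c * real N powr (2 - real \<eta>))"
      unfolding q_def[symmetric]
    proof (intro exI conjI ballI)
      show "NLP_strict_local_min (tau N) N f C x0 (rc.solX Y) (rc.solU Y)"
        by (rule rc.strict_local_min_solution[OF Y(1) order_trans[OF Y(2) d(1)]])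
      show "T_zero (tau N) (w N) N f C x0 (rc.solX Y) (rc.solU Y) (rc.solLam Y)"
        by (rule rc.T_zero_solution[OF Y(1) order_trans[OF Y(2) d(2)]])
      show "norm (rc.solX Y i - xs (tau N i)) \<le> c * q" if "i \<in> {0..N}" for i
        using that err(1)[of i] dc xs0 rc.tau_0 by (cases "i = 0") (auto simp: rc.solX_def)
      show "norm (rc.solU Y i - us (tau N i)) \<le> c * q" if "i \<in> {1..N}" for i
        using err(2)[OF that] dc by (auto simp: rc.solU_def)
      show "norm (rc.solLam Y i - lams (tau N i)) \<le> c * q" if i: "i \<in> {0..N}" for i
      proof (cases "i = 0")
        case True
        then show ?thesis
          using rc.initial_costate_bound[OF Y d(2) quad] dc(2) rc.tau_0 by simp
      next
        case False
        then show ?thesis using err(3)[of i] i dc(1) by (auto simp: rc.solLam_def)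
      qed
    qed
  qed
qed

end
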